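(* In the directed FCFS bipartite matching model, assume the stability condition $\lambda_C<\mu_{\mathcal S(C)}$ for every nonempty $C\subseteq\mathcal C$. Then the delays $L_{s_j,c_i}$ and $L_{c_i}$ are distributed as mixtures of convolutions of geometric random variables. Precisely, for every $(s_j,c_i)\in\mathcal G$ with $r_{s_j,c_i}>0$ and every $d\in\{1,2,\dots\}$, $$P(L_{s_j,c_i}=d)=\frac{1}{r_{s_j,c_i}}\frac{\mu_{s_j}}{\bar\mu}\sum_{k=1}^I\ \sum_{C\subseteq\mathcal C,\,|C|=k}\ \sum_{(C_1,\dots,C_k)\in\mathcal P(C)}\ \sum_{l=1}^k\pi_Y(C_1,\cdot,\dots,C_k,\cdot)\,\mathbf 1\big(C_l=c_i,\ s_j\notin\mathcal S(\{C_1,\dots,C_{l-1}\})\big)\,P\Big(\sum_{h=l}^kD_h(C_1,\dots,C_k)=d\Big),$$ where $D_1(C_1,\dots,C_k),\dots,D_k(C_1,\dots,C_k)$ are independent geometric random variables on $\{1,2,\dots\}$ with $P(D_h=m)=p_h(1-p_h)^{m-1}$, $p_h=\dfrac{\mu_{\mathcal S(\{C_1,\dots,C_h\})}-\lambda_{\{C_1,\dots,C_h\}}}{\bar\lambda+\bar\mu}$. Moreover, $L_{c_i}$ is distributed as the mixture $$P(L_{c_i}=d)=\sum_{s_j\in\mathcal S(c_i)}\frac{r_{s_j,c_i}}{\sum_{s_h\in\mathcal S(c_i)}r_{s_h,c_i}}\,P(L_{s_j,c_i}=d).$$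
   Context: Model. $\mathcal C=\{c_1,\dots,c_I\}$ (agent types) and $\mathcal S=\{s_1,\dots,s_J\}$ (good types) are disjoint finite sets, $\mathcal G\subseteq\mathcal S\times\mathcal C$ is a bipartite compatibility graph, $\bar\lambda,\bar\mu>0$, and $\alpha,\beta$ are probability vectors on $\mathcal C,\mathcal S$. Put $\lambda_{c_i}=\bar\lambda\alpha_{c_i}$, $\mu_{s_j}=\bar\mu\beta_{s_j}$. The sequence $(z^n)_{n\in\mathbb Z}$ is i.i.d. with $P(z^n=c_i)=\lambda_{c_i}/(\bar\lambda+\bar\mu)$, $P(z^n=s_j)=\mu_{s_j}/(\bar\lambda+\bar\mu)$. For $C\subseteq\mathcal C$: $\mathcal S(C)=\{s_j:(s_j,c)\in\mathcal G\text{ for some }c\in C\}$ (and $\mathcal S(c_i)=\mathcal S(\{c_i\})$), $\lambda_C=\sum_{c\in C}\lambda_c$; for $S\subseteq\mathcal S$: $\mu_S=\sum_{s\in S}\mu_s$. $\mathcal P(C)$ is the set of orderings of $C$. Directed FCFS matching: each item is matched at most once, and a good $z^n=s_j$ is matched with an agent $z^m=c_i$ if and only if (i) $n>m$; (ii) $(s_j,c_i)\in\mathcal G$; (iii) for every $k<m$ with $z^k=c_{i'}$ and $(s_j,c_{i'})\in\mathcal G$ there is $l<n$ such that $z^l$ is matched with $z^k$. A good with no such match remains unmatched (lost). Under the stability condition there is almost surely a unique such matching of $(z^n)_{n\in\mathbb Z}$ in which all agents are matched. Matching rate $r_{s_j,c_i}$: the long-run fraction, among all goods in the sequence, of goods that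 are of type $s_j$ and are matched to an agent of type $c_i$. Delays: $L_{s_j,c_i}$ is the value of $n-m$ for a (stationary, typical) matched pair $z^m=c_i$, $z^n=s_j$, i.e. its law is the conditional law of $n-m$ given that $z^n=s_j$ and that $z^n$ is matched to an agent of type $c_i$ (at position $m$). $L_{c_i}$ is the value of $n-m$ for a typical agent $z^m=c_i$ matched to $z^n\in\mathcal S$ of any type. $X(N)$ is the list, in order of position, of the types of agents in positions $\le N$ not matched to goods in positions $\le N$. $\pi_Y(C_1,\cdot,\dots,C_k,\cdot)$ is the stationary probability that the distinct agent types appearing in $X(N)$, in order of first appearance, are exactly $C_1,\dots,C_k$. Explicitly, $\pi_Y(C_1,\cdot,\dots,C_k,\cdot)=B\prod_{\ell=1}^k\frac{\lambda_{C_\ell}}{\mu_{\mathcal S(\{C_1,\dots,C_\ell\})}-\lambda_{\{C_1,\dots,C_\ell\}}}$, where $B=P(X(N)=\emptyset)$ makes these probabilities, together with $\pi_Y(\emptyset)=B$, sum to $1$ over all orderings of all subsets of $\mathcal C$. *)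

theory Defs
  imports "HOL-Probability.Probability" "HOL-Probability.Product_PMF"
    "HOL-Combinatorics.Multiset_Permutations"
begin

text \<open>Agent types and good types are the elements of two finite types \<open>'c\<close> and \<open>'s\<close>; the
  sum type keeps them disjoint. Positions in the sequence are integers.\<close>

type_synonym ('c, 's) item = "'c + 's"

abbreviation Agent :: "'c \<Rightarrow> ('c, 's) item" where "Agent \<equiv> Inl"
abbreviation Good :: "'s \<Rightarrow> ('c, 's) item" where "Good \<equiv> Inr"

definition compat_goods :: "('s \<times> 'c) set \<Rightarrow> 'c set \<Rightarrow> 's set" where
  "compat_goods G C = {s. \<exists>c\<in>C. (s, c) \<in> G}"

definition type_rate :: "real \<Rightarrow> 'a pmf \<Rightarrow> 'a set \<Rightarrow> real" where
  "type_rate r p A = (\<Sum>x\<in>A. r * pmf p x)"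

definition stability_condition ::
  "real \<Rightarrow> real \<Rightarrow> 'c::finite pmf \<Rightarrow> 's::finite pmf \<Rightarrow> ('s \<times> 'c) set \<Rightarrow> bool" where
  "stability_condition lbar mbar \<alpha> \<beta> G \<longleftrightarrow>
     (\<forall>C. C \<noteq> {} \<longrightarrow> type_rate lbar \<alpha> C < type_rate mbar \<beta> (compat_goods G C))"

definition iid_items ::
  "'w measure \<Rightarrow> real \<Rightarrow> real \<Rightarrow> 'c pmf \<Rightarrow> 's pmf \<Rightarrow> (int \<Rightarrow> 'w \<Rightarrow> ('c, 's) item) \<Rightarrow> bool" where
  "iid_items M lbar mbar \<alpha> \<beta> z \<longleftrightarrow>
     prob_space.indep_vars M (\<lambda>_. count_space UNIV) z UNIV \<and>
     (\<forall>n c. \<P>(\<omega> in M. z n \<omega> = Agent c) = lbar * pmf \<alpha> c / (lbar + mbar)) \<and>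
     (\<forall>n s. \<P>(\<omega> in M. z n \<omega> = Good s) = mbar * pmf \<beta> s / (lbar + mbar))"

text \<open>A matching of a realization \<open>z\<close> is a set \<open>A\<close> of pairs \<open>(m, n)\<close>: the agent in position \<open>m\<close>
  is matched with the good in position \<open>n\<close>. The last conjunct of the equivalence spells out that
  only agents which are still unmatched are available to the good: without it the equivalence
  would force later goods onto agents that are already matched, against the rule that every item
  is matched at most once.\<close>

definition directed_fcfs ::
  "('s \<times> 'c) set \<Rightarrow> (int \<Rightarrow> ('c, 's) item) \<Rightarrow> (int \<times> int) set \<Rightarrow> bool" where
  "directed_fcfs G z A \<longleftrightarrow>
     (\<forall>m n n'. (m, n) \<in> A \<and> (m, n') \<in> A \<longrightarrow> n = n') \<and>
     (\<forall>m m' n. (m, n) \<in> A \<and> (m', n) \<in> A \<longrightarrow> m = m') \<and>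
     (\<forall>m n. (m, n) \<in> A \<longleftrightarrow>
        (\<exists>s c. z n = Good s \<and> z m = Agent c \<and> n > m \<and> (s, c) \<in> G \<and>
           (\<forall>k<m. \<forall>c'. z k = Agent c' \<and> (s, c') \<in> G \<longrightarrow> (\<exists>l<n. (k, l) \<in> A)) \<and>
           \<not> (\<exists>l<n. (m, l) \<in> A)))"

definition all_agents_matched ::
  "(int \<Rightarrow> ('c, 's) item) \<Rightarrow> (int \<times> int) set \<Rightarrow> bool" where
  "all_agents_matched z A \<longleftrightarrow> (\<forall>m c. z m = Agent c \<longrightarrow> (\<exists>n. (m, n) \<in> A))"

text \<open>Invariance of the joint law of items and matching under the shift of all positions by one.\<close>

definition jointly_stationary ::
  "'w measure \<Rightarrow> (int \<Rightarrow> 'w \<Rightarrow> ('c, 's) item) \<Rightarrow> ('w \<Rightarrow> (int \<times> int) set) \<Rightarrow> bool" where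
  "jointly_stationary M z A \<longleftrightarrow>
     (let S = (\<Pi>\<^sub>M i\<in>(UNIV :: int set). count_space (UNIV :: ('c, 's) item set)) \<Otimes>\<^sub>M
              (\<Pi>\<^sub>M p\<in>(UNIV :: (int \<times> int) set). count_space (UNIV :: bool set))
      in distr M S (\<lambda>\<omega>. (\<lambda>i. z i \<omega>, \<lambda>(m, n). (m, n) \<in> A \<omega>)) =
         distr M S (\<lambda>\<omega>. (\<lambda>i. z (i + 1) \<omega>, \<lambda>(m, n). (m + 1, n + 1) \<in> A \<omega>)))"

text \<open>Stationarity is needed to pin down the matching. Realization by realization, a directed FCFS
  matching of a two-sided sequence in which all agents are matched is not unique. With a single
  agent type, a single compatible good type and arrival rates \<open>\<lambda> < \<mu>\<close>, number agents and goods by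
  position and, for any fixed \<open>K\<close>, match the \<open>i\<close>-th agent with the \<open>(i + K)\<close>-th good in the remote
  past, where almost surely this good comes later than the agent; then continue FCFS. The backlog
  of such a matching is unbounded as the position tends to minus infinity.\<close>

definition stationary_matching ::
  "'w measure \<Rightarrow> ('s \<times> 'c) set \<Rightarrow> (int \<Rightarrow> 'w \<Rightarrow> ('c, 's) item) \<Rightarrow>
     ('w \<Rightarrow> (int \<times> int) set) \<Rightarrow> bool" where
  "stationary_matching M G z A \<longleftrightarrow>
     (\<forall>m n. {\<omega> \<in> space M. (m, n) \<in> A \<omega>} \<in> sets M) \<and>
     (AE \<omega> in M. directed_fcfs G (\<lambda>i. z i \<omega>) (A \<omega>) \<and> all_agents_matched (\<lambda>i. z i \<omega>) (A \<omega>)) \<and>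
     jointly_stationary M z A"

definition matched_types ::
  "(int \<Rightarrow> ('c, 's) item) \<Rightarrow> (int \<times> int) set \<Rightarrow> 's \<Rightarrow> 'c \<Rightarrow> int \<Rightarrow> bool" where
  "matched_types z A s c n \<longleftrightarrow> z n = Good s \<and> (\<exists>m. (m, n) \<in> A \<and> z m = Agent c)"

definition matching_rate ::
  "'w measure \<Rightarrow> (int \<Rightarrow> 'w \<Rightarrow> ('c, 's) item) \<Rightarrow> ('w \<Rightarrow> (int \<times> int) set) \<Rightarrow> 's \<Rightarrow> 'c \<Rightarrow> real" where
  "matching_rate M z A s c =
     (THE r. AE \<omega> in M.
        (\<lambda>N. real (card {n \<in> {1..int N}. matched_types (\<lambda>i. z i \<omega>) (A \<omega>) s c n}) /
             real (card {n \<in> {1..int N}. \<exists>s'. z n \<omega> = Good s'})) \<longlonglongrightarrow> r)"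

text \<open>Law of \<open>L\<^bsub>s,c\<^esub>\<close>, seen from the good in position \<open>n\<close>.\<close>

definition pair_delay_prob ::
  "'w measure \<Rightarrow> (int \<Rightarrow> 'w \<Rightarrow> ('c, 's) item) \<Rightarrow> ('w \<Rightarrow> (int \<times> int) set) \<Rightarrow>
     int \<Rightarrow> 's \<Rightarrow> 'c \<Rightarrow> nat \<Rightarrow> real" where
  "pair_delay_prob M z A n s c d =
     \<P>(\<omega> in M. (\<exists>m. (m, n) \<in> A \<omega> \<and> n - m = int d) \<bar> matched_types (\<lambda>i. z i \<omega>) (A \<omega>) s c n)"

text \<open>Law of \<open>L\<^bsub>c\<^esub>\<close>, seen from the agent in position \<open>m\<close>.\<close>

definition agent_delay_prob ::
  "'w measure \<Rightarrow> (int \<Rightarrow> 'w \<Rightarrow> ('c, 's) item) \<Rightarrow> ('w \<Rightarrow> (int \<times> int) set) \<Rightarrow>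
     int \<Rightarrow> 'c \<Rightarrow> nat \<Rightarrow> real" where
  "agent_delay_prob M z A m c d =
     \<P>(\<omega> in M. (\<exists>n. (m, n) \<in> A \<omega> \<and> n - m = int d) \<bar> z m \<omega> = Agent c)"

definition backlog :: "(int \<Rightarrow> ('c, 's) item) \<Rightarrow> (int \<times> int) set \<Rightarrow> int \<Rightarrow> int set" where
  "backlog z A N = {m. m \<le> N \<and> (\<exists>c. z m = Agent c) \<and> \<not> (\<exists>n\<le>N. (m, n) \<in> A)}"

text \<open>\<open>sorted_list_of_set\<close> is only meaningful on finite sets, hence the finiteness requirement
  in \<open>pi_Y\<close> below.\<close>

definition backlog_types ::
  "(int \<Rightarrow> ('c, 's) item) \<Rightarrow> (int \<times> int) set \<Rightarrow> int \<Rightarrow> 'c list" where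
  "backlog_types z A N = map (\<lambda>m. projl (z m)) (sorted_list_of_set (backlog z A N))"

text \<open>\<open>remdups\<close> keeps last occurrences; reversing twice keeps first occurrences.\<close>

definition first_appearances :: "'a list \<Rightarrow> 'a list" where
  "first_appearances xs = rev (remdups (rev xs))"

definition pi_Y ::
  "'w measure \<Rightarrow> (int \<Rightarrow> 'w \<Rightarrow> ('c, 's) item) \<Rightarrow> ('w \<Rightarrow> (int \<times> int) set) \<Rightarrow>
     int \<Rightarrow> 'c list \<Rightarrow> real" where
  "pi_Y M z A N Cs =
     \<P>(\<omega> in M. finite (backlog (\<lambda>i. z i \<omega>) (A \<omega>) N) \<and>
                first_appearances (backlog_types (\<lambda>i. z i \<omega>) (A \<omega>) N) = Cs)"

text \<open>\<open>net_rate lbar mbar \<alpha> \<beta> G Cs h\<close> is \<open>\<mu>\<^bsub>S({C\<^sub>1,\<dots>,C\<^sub>h})\<^esub> - \<lambda>\<^bsub>{C\<^sub>1,\<dots>,C\<^sub>h}\<^esub>\<close> for \<open>Cs = [C\<^sub>1,\<dots>,C\<^sub>k]\<close>.\<close>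

definition net_rate ::
  "real \<Rightarrow> real \<Rightarrow> 'c pmf \<Rightarrow> 's pmf \<Rightarrow> ('s \<times> 'c) set \<Rightarrow> 'c list \<Rightarrow> nat \<Rightarrow> real" where
  "net_rate lbar mbar \<alpha> \<beta> G Cs h =
     type_rate mbar \<beta> (compat_goods G (set (take h Cs))) - type_rate lbar \<alpha> (set (take h Cs))"

text \<open>The library's \<open>geometric_pmf\<close> lives on \<open>{0, 1, \<dots>}\<close>; here the support is \<open>{1, 2, \<dots>}\<close>.\<close>

definition geometric1_pmf :: "real \<Rightarrow> nat pmf" where
  "geometric1_pmf p = map_pmf Suc (geometric_pmf p)"

lemma pmf_geometric1:
  assumes "0 < p" "p \<le> 1" "m \<ge> 1"
  shows "pmf (geometric1_pmf p) m = p * (1 - p) ^ (m - 1)"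
proof -
  have "m = Suc (m - 1)" using assms by simp
  then have "pmf (geometric1_pmf p) m = pmf (map_pmf Suc (geometric_pmf p)) (Suc (m - 1))"
    unfolding geometric1_pmf_def by simp
  also have "\<dots> = pmf (geometric_pmf p) (m - 1)"
    by (rule pmf_map_inj') simp
  finally show ?thesis using assms by (simp add: mult.commute)
qed

text \<open>\<open>P(D\<^sub>l + \<dots> + D\<^sub>k = d)\<close> with independent \<open>D\<^sub>1, \<dots>, D\<^sub>k\<close>, where \<open>k = length Cs\<close>.\<close>

definition geometric_sum_prob ::
  "real \<Rightarrow> real \<Rightarrow> 'c pmf \<Rightarrow> 's pmf \<Rightarrow> ('s \<times> 'c) set \<Rightarrow> 'c list \<Rightarrow> nat \<Rightarrow> nat \<Rightarrow> real" where
  "geometric_sum_prob lbar mbar \<alpha> \<beta> G Cs l d =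
     measure_pmf.prob
       (Pi_pmf {1..length Cs} 0
          (\<lambda>h. geometric1_pmf (net_rate lbar mbar \<alpha> \<beta> G Cs h / (lbar + mbar))))
       {D. (\<Sum>h = l..length Cs. D h) = d}"

end

(* The backlog is encoded as a word that also records how many items arrived after each waiting
   agent. The items drive these words as a Markov chain with an invariant law of product form: a
   waiting agent of type c has weight lambda_c / Lambda, where Lambda = lbar + mbar, and any other
   item has weight 1 - mu_S(U) / Lambda, where U is the set of types waiting before it. Splitting a
   word at the first appearances C_1, ..., C_k of its types gives independent gaps D_1, ..., D_k,
   and D_h is geometric with parameter p_h. A good that takes the agent at the l-th first
   appearance therefore has delay D_l + ... + D_k.

   The matching need not be a function of the items, so the law of the backlog and its independence
   of later items need an argument. The run of the chain from the empty word over the last T items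
   coincides with the backlog with probability tending to 1 as T grows: stationarity makes the
   backlog tight, and from any finite set of words some sequence of goods leads to the empty word.
   Together with a maximal inequality this approximation also gives the strong law of large numbers
   that identifies the matching rates. *)

theory Submission
  imports Defs "HOL-Library.More_List"
begin

text \<open>Two obstacles shape the proof. First, the matching is given only as some stationary
  random set of pairs, so nothing says in advance that the backlog at \<open>N\<close> is
  independent of the items after \<open>N\<close>. Couplings therefore use union bounds over
  finitely many start words in place of conditioning, and independence is recovered in the limit.
  Second, the weight is not a transition law from older to newer entries, so its invariance cannot
  be read off. It rests on one identity: the flow into a word \<open>u\<close> by goods that remove
  a waiting agent of type \<open>c\<close> is \<open>weight u\<close> times lambda_c / Lambda.
  Summed over \<open>c\<close>, with the lost goods added, it is exactly the weight of the new
  non-agent entry. The parameter p_h has this origin: while U = {C_1, ..., C_h} are the types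
  present, an entry that leaves U unchanged is an agent of a type in U or a non-agent, of total
  weight lambda_U / Lambda + 1 - mu_S(U) / Lambda = 1 - p_h. Stability makes p_h positive, so the
  resulting geometric series converge. Delays and geometric convolutions are compared through a
  common recursion, since one more entry in front raises the delay by one.\<close>

section \<open>Synchronizing Markov chains driven by independent inputs\<close>

lemma pmf_replicate_pmf:
  "pmf (replicate_pmf n p) xs = (if length xs = n then (\<Prod>k<n. pmf p (xs ! k)) else 0)"
proof (induction n arbitrary: xs)
  case 0
  then show ?case by (auto simp: pmf_return)
next
  case (Suc n)
  have eq: "replicate_pmf (Suc n) p = map_pmf (\<lambda>(x, xs). x # xs) (pair_pmf p (replicate_pmf n p))"
    by (simp add: pair_pmf_def map_bind_pmf map_pmf_def[symmetric] bind_assoc_pmf bind_return_pmf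
        pmf.map_comp o_def)
  show ?case
  proof (cases xs)
    case Nil
    then show ?thesis by (auto simp: pmf_eq_0_set_pmf set_replicate_pmf)
  next
    case (Cons y ys)
    have "pmf (replicate_pmf (Suc n) p) xs = pmf (pair_pmf p (replicate_pmf n p)) (y, ys)"
      unfolding eq Cons
      using pmf_map_inj'[of "\<lambda>(x, xs). x # xs" "pair_pmf p (replicate_pmf n p)" "(y, ys)"]
      by (simp add: inj_on_def split_beta prod_eq_iff)
    then show ?thesis
      by (simp only: pmf_pair Suc.IH)
        (simp add: Cons prod.lessThan_Suc_shift del: prod.lessThan_Suc)
  qed
qed

lemma replicate_pmf_add:
  "replicate_pmf (m + n) p =
     map_pmf (\<lambda>(xs, ys). xs @ ys) (pair_pmf (replicate_pmf m p) (replicate_pmf n p))"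
  by (simp add: replicate_pmf_distrib pair_pmf_def map_bind_pmf)

lemma finite_to_nat_le: "finite {x::'a::countable. to_nat x \<le> n}"
proof (rule finite_subset)
  show "{x::'a. to_nat x \<le> n} \<subseteq> from_nat ` {..n}"
    by (metis (mono_tags, lifting) atMost_iff from_nat_to_nat imageI mem_Collect_eq subsetI)
qed simp

lemma pmf_tight:
  fixes p :: "'a::countable pmf"
  assumes "e > 0"
  obtains F where "finite F" "measure_pmf.prob p (- F) < e"
proof -
  define F where "F n = {x::'a. to_nat x \<le> n}" for n
  have "(\<lambda>n. measure_pmf.prob p (F n)) \<longlonglongrightarrow> measure_pmf.prob p (\<Union>n. F n)"
    by (rule measure_pmf.finite_Lim_measure_incseq) (auto simp: F_def incseq_def)
  moreover have "(\<Union>n. F n) = UNIV" by (auto simp: F_def)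
  ultimately have "(\<lambda>n. measure_pmf.prob p (F n)) \<longlonglongrightarrow> 1" by simp
  then have "\<forall>\<^sub>F n in sequentially. measure_pmf.prob p (F n) > 1 - e"
    by (rule order_tendstoD) (use assms in simp)
  then obtain n where n: "measure_pmf.prob p (F n) > 1 - e"
    by (auto simp: eventually_sequentially)
  have "finite (F n)" unfolding F_def by (rule finite_to_nat_le)
  moreover have "measure_pmf.prob p (- F n) = 1 - measure_pmf.prob p (F n)"
    using measure_pmf.prob_compl[of "F n" p] by (simp add: Compl_eq_Diff_UNIV)
  ultimately show ?thesis using n that by auto
qed

text \<open>\<open>reset\<close> plays the part of irreducibility and aperiodicity: one input word
  of positive probability merges all runs that start in a given finite set.\<close>

locale driven_chain =
  fixes step :: "'x::countable \<Rightarrow> 'i::countable \<Rightarrow> 'x"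
    and q :: "'i pmf" and p :: "'x pmf" and x0 :: 'x
  assumes invariant: "bind_pmf p (\<lambda>x. map_pmf (step x) q) = p"
    and x0: "x0 \<in> set_pmf p"
    and reset: "finite F \<Longrightarrow> \<exists>is. set is \<subseteq> set_pmf q \<and> (\<forall>x\<in>F. foldl step x is = x0)"
begin

lemma map_run_pair_pmf:
  "map_pmf (\<lambda>(x, is). foldl step x is) (pair_pmf p (replicate_pmf n q)) = p"
proof (induction n)
  case 0
  then show ?case by (simp add: pair_pmf_def map_bind_pmf bind_return_pmf bind_return_pmf')
next
  case (Suc n)
  have "map_pmf (\<lambda>(x, is). foldl step x is) (pair_pmf p (replicate_pmf (Suc n) q)) =
     bind_pmf (bind_pmf p (\<lambda>x. map_pmf (step x) q))
       (\<lambda>y. bind_pmf (replicate_pmf n q) (\<lambda>is. return_pmf (foldl step y is)))"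
    by (simp add: pair_pmf_def map_bind_pmf bind_assoc_pmf bind_return_pmf bind_map_pmf)
  also have "\<dots> = p"
    unfolding invariant using Suc.IH
    by (simp add: pair_pmf_def map_bind_pmf bind_assoc_pmf bind_return_pmf)
  finally show ?case .
qed

definition desync :: "nat \<Rightarrow> 'x \<Rightarrow> 'x \<Rightarrow> real" where
  "desync n x y = measure_pmf.prob (replicate_pmf n q) {is. foldl step x is \<noteq> foldl step y is}"

text \<open>A run started from the law \<open>p\<close> has law \<open>p\<close> at every time, and
  the start \<open>x\<close> carries the share \<open>pmf p x\<close> of it. The resulting bound on
  leaving \<open>F\<close> is uniform in \<open>n\<close>.\<close>

lemma escape_le:
  "pmf p x * measure_pmf.prob (replicate_pmf n q) {is. foldl step x is \<notin> F} \<le>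
     measure_pmf.prob p (- F)"
proof -
  let ?r = "replicate_pmf n q"
  have "pmf p x * measure_pmf.prob ?r {is. foldl step x is \<notin> F} =
      measure_pmf.prob (pair_pmf p ?r) ({x} \<times> {is. foldl step x is \<notin> F})"
    by (subst measure_pmf_prob_product) (auto simp: measure_pmf_single)
  also have "\<dots> \<le> measure_pmf.prob (pair_pmf p ?r) ((\<lambda>(x, is). foldl step x is) -` (- F))"
    by (rule measure_pmf.finite_measure_mono) auto
  also have "\<dots> = measure_pmf.prob (map_pmf (\<lambda>(x, is). foldl step x is) (pair_pmf p ?r)) (- F)"
    by (simp only: measure_map_pmf)
  finally show ?thesis by (simp only: map_run_pair_pmf)
qed

text \<open>Both runs read the same input, so once they agree they agree forever.\<close>

lemma desync_antimono: "desync (m + n) x y \<le> desync m x y"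
proof -
  let ?r = "\<lambda>n. replicate_pmf n q"
  have "desync (m + n) x y = measure_pmf.prob (pair_pmf (?r m) (?r n))
      {ab. foldl step x (fst ab @ snd ab) \<noteq> foldl step y (fst ab @ snd ab)}"
    by (simp add: desync_def replicate_pmf_add vimage_def split_beta)
  also have "\<dots> \<le> measure_pmf.prob (pair_pmf (?r m) (?r n))
      ({a. foldl step x a \<noteq> foldl step y a} \<times> UNIV)"
    by (rule measure_pmf.finite_measure_mono) auto
  also have "\<dots> = desync m x y"
    by (subst measure_pmf_prob_product) (auto simp: desync_def)
  finally show ?thesis .
qed

text \<open>Tightness: with probability close to one both runs are in a fixed finite set, from which a
  fixed input word of positive probability synchronizes them.\<close>

lemma desync_tendsto_0:
  assumes x: "x \<in> set_pmf p" and y: "y \<in> set_pmf p"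
  shows "(\<lambda>n. desync n x y) \<longlonglongrightarrow> 0"
proof -
  let ?r = "\<lambda>n. replicate_pmf n q"
  have dec: "decseq (\<lambda>n. desync n x y)"
    unfolding decseq_def using desync_antimono by (metis le_add_diff_inverse)
  have "desync n x y \<ge> 0" for n by (simp add: desync_def)
  then obtain a where a: "(\<lambda>n. desync n x y) \<longlonglongrightarrow> a"
    using decseq_convergent[OF dec, of 0] by blast
  have "a \<ge> 0"
    by (rule LIMSEQ_le_const[OF a]) (auto simp: desync_def)
  have "a \<le> 0 + e" if e: "e > 0" for e
  proof -
    have px: "pmf p x > 0" and py: "pmf p y > 0"
      using x y by (simp_all add: pmf_positive)
    \<comment> \<open>The factor \<open>min (pmf p x) (pmf p y)\<close> cancels the division by
      \<open>pmf p w\<close> in \<open>escape_le\<close>, leaving \<open>e / 2\<close> for each of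
      the two runs.\<close>
    obtain F where F: "finite F" "measure_pmf.prob p (- F) < e / 2 * min (pmf p x) (pmf p y)"
      using pmf_tight[of "e / 2 * min (pmf p x) (pmf p y)" p] px py e by auto
    have esc: "measure_pmf.prob (?r n) {is. foldl step w is \<notin> F} \<le> e / 2"
      if "w \<in> {x, y}" for w n
    proof -
      have w: "pmf p w > 0" "min (pmf p x) (pmf p y) \<le> pmf p w" using that px py by auto
      have "pmf p w * measure_pmf.prob (?r n) {is. foldl step w is \<notin> F} \<le> e / 2 *
          min (pmf p x) (pmf p y)"
        using escape_le[of w n F] F by simp
      also have "\<dots> \<le> e / 2 * pmf p w" using w e by (intro mult_left_mono) auto
      finally show ?thesis using w by (simp add: mult.commute)
    qed
    obtain js where js: "set js \<subseteq> set_pmf q" "\<forall>x\<in>F. foldl step x js = x0"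
      using reset[OF F(1)] by auto
    define c where "c = pmf (?r (length js)) js"
    have c: "c > 0" unfolding c_def using js(1)
      by (auto simp: pmf_replicate_pmf intro!: prod_pos pmf_positive)
    \<comment> \<open>Up to mass \<open>e\<close>, the runs that still differ are both in
      \<open>F\<close>, and from there the word \<open>js\<close> merges them with probability at
      least \<open>c\<close>.\<close>
    have step_le: "desync (n + length js) x y \<le> desync n x y - c * (desync n x y - e)" for n
    proof -
      define D where "D = {a. foldl step x a \<noteq> foldl step y a}"
      define E where "E = {a\<in>D. foldl step x a \<in> F \<and> foldl step y a \<in> F}"
      have "measure_pmf.prob (?r n) D \<le> measure_pmf.prob (?r n) (E \<union> ({is. foldl step x is \<notin> F} \<union>
          {is. foldl step y is \<notin> F}))"
        by (rule measure_pmf.finite_measure_mono) (auto simp: E_def)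
      also have "\<dots> \<le> measure_pmf.prob (?r n) E +
          (measure_pmf.prob (?r n) {is. foldl step x is \<notin> F} +
          measure_pmf.prob (?r n) {is. foldl step y is \<notin> F})"
        by (intro order_trans[OF measure_subadditive] add_left_mono measure_subadditive) auto
      also have "\<dots> \<le> measure_pmf.prob (?r n) E + e"
        using esc[of x n] esc[of y n] by simp
      finally have E: "measure_pmf.prob (?r n) E \<ge> desync n x y - e"
        by (simp add: desync_def D_def)
      have "desync (n + length js) x y = measure_pmf.prob (pair_pmf (?r n) (?r (length js)))
          {ab. foldl step x (fst ab @ snd ab) \<noteq> foldl step y (fst ab @ snd ab)}"
        by (simp add: desync_def replicate_pmf_add vimage_def split_beta)
      also have "\<dots> \<le> measure_pmf.prob (pair_pmf (?r n) (?r (length js))) (D \<times> UNIV - E \<times> {js})"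
        by (rule measure_pmf.finite_measure_mono) (use js in \<open>auto simp: D_def E_def\<close>)
      also have "\<dots> = measure_pmf.prob (pair_pmf (?r n) (?r (length js))) (D \<times> UNIV) -
          measure_pmf.prob (pair_pmf (?r n) (?r (length js))) (E \<times> {js})"
        by (rule measure_pmf.finite_measure_Diff) (auto simp: E_def)
      also have "\<dots> = desync n x y - c * measure_pmf.prob (?r n) E"
        by (simp add: measure_pmf_prob_product measure_pmf_single c_def desync_def D_def)
      also have "\<dots> \<le> desync n x y - c * (desync n x y - e)"
        using E c by simp
      finally show ?thesis .
    qed
    \<comment> \<open>The limit cannot exceed \<open>e\<close>, since otherwise
      \<open>length js\<close> further inputs would lower the limit itself.\<close>
    have "a \<le> a - c * (a - e)"
    proof (rule LIMSEQ_le)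
      show "(\<lambda>n. desync (n + length js) x y) \<longlonglongrightarrow> a"
        using a by (rule LIMSEQ_ignore_initial_segment)
      show "(\<lambda>n. desync n x y - c * (desync n x y - e)) \<longlonglongrightarrow> a - c * (a - e)"
        by (intro tendsto_intros a)
      show "\<exists>N. \<forall>n\<ge>N. desync (n + length js) x y \<le> desync n x y - c * (desync n x y - e)"
        using step_le by auto
    qed
    then have "c * (a - e) \<le> 0" by simp
    then show ?thesis using c by (simp add: mult_le_0_iff)
  qed
  then have "a \<le> 0" by (rule field_le_epsilon)
  with \<open>a \<ge> 0\<close> a show ?thesis by simp
qed

end

section \<open>Processes driven by independent inputs\<close>

lemma measurable_count_space_countable:
  fixes f :: "'w \<Rightarrow> 'a::countable"
  assumes "\<And>x. {\<omega> \<in> space M. f \<omega> = x} \<in> sets M"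
  shows "f \<in> M \<rightarrow>\<^sub>M count_space UNIV"
proof (rule iffD2[OF measurable_count_space_eq2_countable])
  show "f \<in> space M \<rightarrow> UNIV \<and> (\<forall>a\<in>UNIV. f -` {a} \<inter> space M \<in> sets M)"
    using assms by (auto simp: vimage_def Int_def conj_commute)
qed

text \<open>The state \<open>W\<close> need not be a function of the inputs; only the recursion ties
  it to them. \<open>W_support\<close> keeps it on the states to which
  \<open>desync_tendsto_0\<close> applies.\<close>

locale driven_process = driven_chain step q p x0 + prob_space M
  for step :: "'x::countable \<Rightarrow> 'i::countable \<Rightarrow> 'x" and q p x0 and M :: "'w measure" +
  fixes z :: "int \<Rightarrow> 'w \<Rightarrow> 'i" and W :: "int \<Rightarrow> 'w \<Rightarrow> 'x"
  assumes indep: "indep_vars (\<lambda>_. count_space UNIV) z UNIV"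
    and law: "\<P>(\<omega> in M. z n \<omega> = i) = pmf q i"
    and W_measurable [measurable]: "W N \<in> M \<rightarrow>\<^sub>M count_space UNIV"
    and W_step: "AE \<omega> in M. \<forall>N. W (N + 1) \<omega> = step (W N \<omega>) (z (N + 1) \<omega>)"
    and W_stationary: "\<P>(\<omega> in M. W N \<omega> = x) = \<P>(\<omega> in M. W N' \<omega> = x)"
    and W_support: "x \<notin> set_pmf p \<Longrightarrow> \<P>(\<omega> in M. W N \<omega> = x) = 0"
begin

lemma z_measurable [measurable]: "z n \<in> M \<rightarrow>\<^sub>M count_space UNIV"
  using indep by (auto simp: indep_vars_def)

text \<open>The block starts at \<open>a + 1\<close> because \<open>W a\<close> is the state after
  the input in position \<open>a\<close>.\<close>

definition blk :: "int \<Rightarrow> nat \<Rightarrow> 'w \<Rightarrow> 'i list" where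
  "blk a T \<omega> = map (\<lambda>k. z (a + 1 + int k) \<omega>) [0..<T]"

lemma length_blk [simp]: "length (blk a T \<omega>) = T"
  by (simp add: blk_def)

lemma nth_blk [simp]: "k < T \<Longrightarrow> blk a T \<omega> ! k = z (a + 1 + int k) \<omega>"
  by (simp add: blk_def)

lemma blk_eq_iff: "blk a T \<omega> = is \<longleftrightarrow> length is = T \<and> (\<forall>k<T. z (a + 1 + int k) \<omega> = is ! k)"
  by (auto simp: list_eq_iff_nth_eq)

lemma blk_add: "blk a (S + T) \<omega> = blk a S \<omega> @ blk (a + int S) T \<omega>"
  by (auto simp: list_eq_iff_nth_eq nth_append algebra_simps)

lemma blk_measurable [measurable]: "blk a T \<in> M \<rightarrow>\<^sub>M count_space UNIV"
  by (rule measurable_count_space_countable) (simp add: blk_eq_iff)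

lemma vimage_law: "prob (z n -` {i} \<inter> space M) = pmf q i"
  using law[of n i] by (simp add: vimage_def Int_def conj_commute)

lemma prob_blk_eq: "\<P>(\<omega> in M. blk a T \<omega> = is) = pmf (replicate_pmf T q) is"
\<comment> \<open>The product rule for independent variables is applied to a nonempty set of
  positions, so \<open>T = 0\<close> is split off.\<close>
proof (cases "length is = T \<and> T > 0")
  case True
  have "\<P>(\<omega> in M. blk a T \<omega> = is) =
     prob (\<Inter>n\<in>{a + 1..a + int T}. z n -` {is ! nat (n - a - 1)} \<inter> space M)"
  proof (intro arg_cong[of _ _ prob] set_eqI iffI)
    fix \<omega> assume "\<omega> \<in> {\<omega> \<in> space M. blk a T \<omega> = is}"
    then have \<omega>: "\<omega> \<in> space M" "\<And>k. k < T \<Longrightarrow> z (a + 1 + int k) \<omega> = is ! k"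
      by (auto simp: blk_eq_iff)
    show "\<omega> \<in> (\<Inter>n\<in>{a + 1..a + int T}. z n -` {is ! nat (n - a - 1)} \<inter> space M)"
    proof (rule INT_I)
      fix n assume "n \<in> {a + 1..a + int T}"
      then show "\<omega> \<in> z n -` {is ! nat (n - a - 1)} \<inter> space M"
        using \<omega>(1) \<omega>(2)[of "nat (n - a - 1)"] by (auto simp: nat_less_iff)
    qed
  next
    fix \<omega> assume \<omega>: "\<omega> \<in> (\<Inter>n\<in>{a + 1..a + int T}. z n -` {is ! nat (n - a - 1)} \<inter> space M)"
    have "\<omega> \<in> space M" using \<omega> True by auto
    moreover have "z (a + 1 + int k) \<omega> = is ! k" if "k < T" for k
    proof -
      have "a + 1 + int k \<in> {a + 1..a + int T}" using that by auto
      then have "\<omega> \<in> z (a + 1 + int k) -` {is ! nat (a + 1 + int k - a - 1)} \<inter> space M"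
        using \<omega> by blast
      then show ?thesis by simp
    qed
    ultimately show "\<omega> \<in> {\<omega> \<in> space M. blk a T \<omega> = is}"
      using True by (auto simp: blk_eq_iff)
  qed
  also have "\<dots> = (\<Prod>n\<in>{a + 1..a + int T}. prob (z n -` {is ! nat (n - a - 1)} \<inter> space M))"
    by (rule indep_varsD[OF indep]) (use True in auto)
  also have "\<dots> = (\<Prod>n\<in>{a + 1..a + int T}. pmf q (is ! nat (n - a - 1)))"
    by (intro prod.cong refl) (simp only: vimage_law)
  also have "\<dots> = (\<Prod>k<T. pmf q (is ! k))"
    by (rule prod.reindex_bij_witness[of _ "\<lambda>k. a + 1 + int k" "\<lambda>n. nat (n - a - 1)"])
      (auto simp: nat_less_iff)
  finally show ?thesis using True by (simp add: pmf_replicate_pmf)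
next
  case False
  then show ?thesis
    by (cases "length is = T") (auto simp: blk_eq_iff pmf_replicate_pmf prob_space)
qed

lemma distr_blk: "distr M (count_space UNIV) (blk a T) = measure_pmf (replicate_pmf T q)"
proof (rule measure_eqI_countable[of _ UNIV])
  fix js
  show "emeasure (distr M (count_space UNIV) (blk a T)) {js} =
      emeasure (measure_pmf (replicate_pmf T q)) {js}"
    using prob_blk_eq[of a T js]
    by (simp add: emeasure_distr emeasure_pmf_single vimage_def Int_def conj_commute
        emeasure_eq_measure)
qed auto

lemma prob_blk: "\<P>(\<omega> in M. P (blk a T \<omega>)) = measure_pmf.prob (replicate_pmf T q) {is. P is}"
proof -
  have "measure (distr M (count_space UNIV) (blk a T)) {is. P is} = \<P>(\<omega> in M. P (blk a T \<omega>))"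
    by (simp add: measure_distr vimage_def Int_def conj_commute)
  then show ?thesis by (simp only: distr_blk)
qed

lemma W_run: "AE \<omega> in M. \<forall>N T. W (N + int T) \<omega> = foldl step (W N \<omega>) (blk N T \<omega>)"
  using W_step
proof eventually_elim
  fix \<omega> assume st: "\<forall>N. W (N + 1) \<omega> = step (W N \<omega>) (z (N + 1) \<omega>)"
  have "W (N + int T) \<omega> = foldl step (W N \<omega>) (blk N T \<omega>)" for N T
  proof (induction T)
    case 0
    then show ?case by (simp add: blk_def)
  next
    case (Suc T)
    have "blk N (Suc T) \<omega> = blk N T \<omega> @ [z (N + int T + 1) \<omega>]"
      by (simp add: blk_def algebra_simps)
    moreover have "W (N + int (Suc T)) \<omega> = step (W (N + int T) \<omega>) (z (N + int T + 1) \<omega>)"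
      using st[rule_format, of "N + int T"] by (simp add: algebra_simps)
    ultimately show ?case using Suc.IH by simp
  qed
  then show "\<forall>N T. W (N + int T) \<omega> = foldl step (W N \<omega>) (blk N T \<omega>)" by blast
qed

text \<open>Up to a small probability \<open>W (N - int T)\<close> lies in a finite set, and the
  runs from all its points merge with the run from \<open>x0\<close>. The union bound over start
  values avoids any independence between \<open>W (N - int T)\<close> and the inputs after it, which
  is not known at this stage.\<close>

lemma prob_W_ne_run_tendsto_0:
  "(\<lambda>T. \<P>(\<omega> in M. W N \<omega> \<noteq> foldl step x0 (blk (N - int T) T \<omega>))) \<longlonglongrightarrow> 0"
proof (rule LIMSEQ_I)
  fix e :: real assume e: "e > 0"
  have "\<exists>F. finite F \<and> \<P>(\<omega> in M. W N \<omega> \<notin> F) < e / 2"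
  proof -
    define F where "F n = {x::'x. to_nat x \<le> n}" for n
    have finF: "finite (F n)" for n unfolding F_def by (rule finite_to_nat_le)
    have "(\<lambda>n. \<P>(\<omega> in M. W N \<omega> \<notin> F n)) \<longlonglongrightarrow> prob (\<Inter>n. {\<omega> \<in> space M. W N \<omega> \<notin> F n})"
      by (rule finite_Lim_measure_decseq) (auto simp: F_def decseq_def)
    moreover have "(\<Inter>n. {\<omega> \<in> space M. W N \<omega> \<notin> F n}) = {}" by (auto simp: F_def)
    ultimately have "(\<lambda>n. \<P>(\<omega> in M. W N \<omega> \<notin> F n)) \<longlonglongrightarrow> 0" by simp
    then have "\<forall>\<^sub>F n in sequentially. \<P>(\<omega> in M. W N \<omega> \<notin> F n) < e / 2"
      by (rule order_tendstoD) (use e in simp)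
    then show ?thesis using finF by (auto simp: eventually_sequentially)
  qed
  then obtain F where F: "finite F" "\<P>(\<omega> in M. W N \<omega> \<notin> F) < e / 2" by auto
  \<comment> \<open>By stationarity the same finite set serves all positions, in particular the
    start \<open>N - int T\<close>, which moves with \<open>T\<close>.\<close>
  have tight: "\<P>(\<omega> in M. W N' \<omega> \<notin> F) < e / 2" for N'
  proof -
    have "\<P>(\<omega> in M. W N' \<omega> \<in> F) = (\<Sum>x\<in>F. \<P>(\<omega> in M. W N' \<omega> = x))" for N'
    proof -
      have "{\<omega> \<in> space M. W N' \<omega> \<in> F} = (\<Union>x\<in>F. {\<omega> \<in> space M. W N' \<omega> = x})" by auto
      then show ?thesis
        using F(1) by (simp only:) (rule finite_measure_finite_Union; auto simp:
            disjoint_family_on_def)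
    qed
    then have "\<P>(\<omega> in M. W N' \<omega> \<in> F) = \<P>(\<omega> in M. W N \<omega> \<in> F)"
      using W_stationary by (metis (no_types, lifting) sum.cong)
    then show ?thesis using F(2) by (simp add: prob_neg)
  qed
  define F' where "F' = F \<inter> set_pmf p"
  have "(\<lambda>T. \<Sum>x\<in>F'. desync T x x0) \<longlonglongrightarrow> (\<Sum>x\<in>F'. 0)"
    by (intro tendsto_sum desync_tendsto_0 x0) (auto simp: F'_def)
  then have "\<forall>\<^sub>F T in sequentially. (\<Sum>x\<in>F'. desync T x x0) < e / 2"
    by (intro order_tendstoD(2)) (use e in auto)
  then obtain T0 where T0: "\<And>T. T \<ge> T0 \<Longrightarrow> (\<Sum>x\<in>F'. desync T x x0) < e / 2"
    by (auto simp: eventually_sequentially)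
  show "\<exists>T0. \<forall>T\<ge>T0. norm (\<P>(\<omega> in M. W N \<omega> \<noteq> foldl step x0 (blk (N - int T) T \<omega>)) - 0) < e"
  proof (intro exI allI impI)
    fix T assume T: "T \<ge> T0"
    let ?V = "W (N - int T)" let ?b = "blk (N - int T) T"
    have "\<P>(\<omega> in M. W N \<omega> \<noteq> foldl step x0 (?b \<omega>)) \<le>
       prob ({\<omega> \<in> space M. ?V \<omega> \<notin> F} \<union>
         ((\<Union>x\<in>F - set_pmf p. {\<omega> \<in> space M. ?V \<omega> = x}) \<union>
          (\<Union>x\<in>F'. {\<omega> \<in> space M. foldl step x (?b \<omega>) \<noteq> foldl step x0 (?b \<omega>)})))"
    proof (rule finite_measure_mono_AE)
      show "AE \<omega> in M. \<omega> \<in> {\<omega> \<in> space M. W N \<omega> \<noteq> foldl step x0 (?b \<omega>)} \<longrightarrow>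
         \<omega> \<in> {\<omega> \<in> space M. ?V \<omega> \<notin> F} \<union>
         ((\<Union>x\<in>F - set_pmf p. {\<omega> \<in> space M. ?V \<omega> = x}) \<union>
          (\<Union>x\<in>F'. {\<omega> \<in> space M. foldl step x (?b \<omega>) \<noteq> foldl step x0 (?b \<omega>)}))"
        using W_run
      proof eventually_elim
        case (elim \<omega>)
        then have "W N \<omega> = foldl step (?V \<omega>) (?b \<omega>)"
          using spec[OF spec[OF elim, of "N - int T"], of T] by simp
        then show ?case by (auto simp: F'_def)
      qed
    qed (use F(1) in \<open>auto simp: F'_def\<close>)
    also have "\<dots> \<le> \<P>(\<omega> in M. ?V \<omega> \<notin> F) +
         (prob (\<Union>x\<in>F - set_pmf p. {\<omega> \<in> space M. ?V \<omega> = x}) +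
          prob (\<Union>x\<in>F'. {\<omega> \<in> space M. foldl step x (?b \<omega>) \<noteq> foldl step x0 (?b \<omega>)}))"
      using F(1) by (intro order_trans[OF measure_subadditive] add_left_mono measure_subadditive)
        (auto simp: F'_def)
    also have "prob (\<Union>x\<in>F - set_pmf p. {\<omega> \<in> space M. ?V \<omega> = x}) \<le>
        (\<Sum>x\<in>F - set_pmf p. \<P>(\<omega> in M. ?V \<omega> = x))"
      using F(1) by (intro finite_measure_subadditive_finite) auto
    also have "\<dots> = 0" by (intro sum.neutral) (auto simp: W_support)
    also have "prob (\<Union>x\<in>F'. {\<omega> \<in> space M. foldl step x (?b \<omega>) \<noteq> foldl step x0 (?b \<omega>)}) \<le>
        (\<Sum>x\<in>F'. \<P>(\<omega> in M. foldl step x (?b \<omega>) \<noteq> foldl step x0 (?b \<omega>)))"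
      using F(1) by (intro finite_measure_subadditive_finite) (auto simp: F'_def)
    also have "\<dots> = (\<Sum>x\<in>F'. desync T x x0)"
      unfolding desync_def by (intro sum.cong refl prob_blk)
    finally show "norm (\<P>(\<omega> in M. W N \<omega> \<noteq> foldl step x0 (?b \<omega>)) - 0) < e"
      using tight[of "N - int T"] T0[OF T] by simp
  qed
qed

end

lemma (in finite_measure) abs_measure_diff_le:
  assumes [measurable]: "A \<in> sets M" "B \<in> sets M" "C \<in> sets M"
    and "AE \<omega> in M. \<omega> \<notin> C \<longrightarrow> (\<omega> \<in> A \<longleftrightarrow> \<omega> \<in> B)"
  shows "\<bar>measure M A - measure M B\<bar> \<le> measure M C"
proof -
  have "measure M A \<le> measure M (B \<union> C)"
    by (rule finite_measure_mono_AE) (use assms(4) in \<open>auto elim: eventually_mono\<close>)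
  moreover have "measure M B \<le> measure M (A \<union> C)"
    by (rule finite_measure_mono_AE) (use assms(4) in \<open>auto elim: eventually_mono\<close>)
  ultimately show ?thesis
    using measure_subadditive[of A M C] measure_subadditive[of B M C] by auto
qed

section \<open>The run from a fixed start compared with a stationary one\<close>

context driven_chain
begin

text \<open>The common error bound of all later approximations: for a driven process it is the
  probability that the state differs from the run of the last \<open>n\<close> inputs started at
  \<open>x0\<close>.\<close>

definition start_err :: "nat \<Rightarrow> real" where
  "start_err n = measure_pmf.prob (pair_pmf p (replicate_pmf n q))
     {(x, is). foldl step x is \<noteq> foldl step x0 is}"

lemma start_err_tendsto_0: "start_err \<longlonglongrightarrow> 0"
proof (rule LIMSEQ_I)
  fix e :: real assume e: "e > 0"
  obtain F where F: "finite F" "measure_pmf.prob p (- F) < e / 2"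
    using pmf_tight[of "e / 2" p] e by auto
  define F' where "F' = F \<inter> set_pmf p"
  have "(\<lambda>T. \<Sum>x\<in>F'. desync T x x0) \<longlonglongrightarrow> (\<Sum>x\<in>F'. 0)"
    by (intro tendsto_sum desync_tendsto_0 x0) (auto simp: F'_def)
  then have "\<forall>\<^sub>F T in sequentially. (\<Sum>x\<in>F'. desync T x x0) < e / 2"
    by (intro order_tendstoD(2)) (use e in auto)
  then obtain T0 where T0: "\<And>T. T \<ge> T0 \<Longrightarrow> (\<Sum>x\<in>F'. desync T x x0) < e / 2"
    by (auto simp: eventually_sequentially)
  show "\<exists>T0. \<forall>T\<ge>T0. norm (start_err T - 0) < e"
  proof (intro exI allI impI)
    fix T assume T: "T \<ge> T0"
    let ?P = "pair_pmf p (replicate_pmf T q)"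
    let ?D = "\<lambda>x. {is. foldl step x is \<noteq> foldl step x0 is}"
    have "start_err T \<le> measure_pmf.prob ?P ((- F) \<times> UNIV \<union> (\<Union>x\<in>F'. UNIV \<times> ?D x))"
      unfolding start_err_def
      by (rule measure_pmf.finite_measure_mono_AE)
        (auto simp: AE_measure_pmf_iff F'_def)
    also have "\<dots> \<le> measure_pmf.prob ?P ((- F) \<times> UNIV) + measure_pmf.prob ?P (\<Union>x\<in>F'. UNIV \<times> ?D x)"
      by (rule measure_subadditive) auto
    also have "measure_pmf.prob ?P (\<Union>x\<in>F'. UNIV \<times> ?D x) \<le>
        (\<Sum>x\<in>F'. measure_pmf.prob ?P (UNIV \<times> ?D x))"
      using F(1) by (intro measure_pmf.finite_measure_subadditive_finite) (auto simp: F'_def)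
    also have "\<dots> = (\<Sum>x\<in>F'. desync T x x0)"
      by (simp add: measure_pmf_prob_product desync_def)
    finally have "start_err T < e"
      using F(2) T0[OF T] by (simp add: measure_pmf_prob_product)
    then show "norm (start_err T - 0) < e" by (simp add: start_err_def)
  qed
qed

text \<open>Feeding the same inputs to a start drawn from \<open>p\<close> gives a state with law
  \<open>p\<close>, and the two runs differ with probability \<open>start_err n\<close>.\<close>

lemma abs_prob_run_diff_le:
  "\<bar>measure_pmf.prob (replicate_pmf n q) {is. foldl step x0 is = x} - pmf p x\<bar> \<le> start_err n"
proof -
  let ?P = "pair_pmf p (replicate_pmf n q)"
  have "measure_pmf.prob (replicate_pmf n q) {is. foldl step x0 is = x} =
      measure_pmf.prob ?P (UNIV \<times> {is. foldl step x0 is = x})"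
    by (simp add: measure_pmf_prob_product)
  moreover have "pmf p x = measure_pmf.prob ?P {(v, is). foldl step v is = x}"
    by (subst map_run_pair_pmf[of n, symmetric]) (simp add: pmf_map vimage_def case_prod_unfold)
  ultimately show ?thesis
    unfolding start_err_def
    by (simp only:) (rule measure_pmf.abs_measure_diff_le; auto)
qed

lemma prob_run_tendsto:
  "(\<lambda>n. measure_pmf.prob (replicate_pmf n q) {is. foldl step x0 is = x}) \<longlonglongrightarrow> pmf p x"
proof (rule LIM_zero_cancel, rule Lim_transform_bound[OF _ start_err_tendsto_0])
  show "\<forall>\<^sub>F n in sequentially. norm (measure_pmf.prob (replicate_pmf n q) {is. foldl step x0 is =
      x} - pmf p x) \<le> norm (start_err n)"
    by (intro always_eventually allI)
      (metis abs_prob_run_diff_le abs_ge_self order_trans real_norm_def)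
qed

end

section \<open>Independence of the state from later inputs\<close>

context driven_process
begin

text \<open>With \<open>W N\<close> replaced by the run over the \<open>T\<close> inputs up to
  \<open>N\<close>, the event concerns disjoint blocks of inputs and its probability factorizes. The
  replacement costs an error that vanishes as \<open>T\<close> grows.\<close>

lemma prob_W_blk_eq:
  "\<P>(\<omega> in M. W N \<omega> = x \<and> blk N K \<omega> = js) = pmf p x * pmf (replicate_pmf K q) js"
proof -
  define a where "a T = \<P>(\<omega> in M. foldl step x0 (blk (N - int T) T \<omega>) = x \<and> blk N K \<omega> = js)" for T
  define err where "err T = \<P>(\<omega> in M. W N \<omega> \<noteq> foldl step x0 (blk (N - int T) T \<omega>))" for T
  have "a T = measure_pmf.prob (replicate_pmf T q) {is. foldl step x0 is = x} *
      pmf (replicate_pmf K q) js" for T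
  proof (cases "length js = K")
    case True
    have "a T = \<P>(\<omega> in M. (\<lambda>is. foldl step x0 (take T is) = x \<and> drop T is =
        js) (blk (N - int T) (T + K) \<omega>))"
      unfolding a_def by (intro arg_cong[of _ _ prob]) (auto simp: blk_add)
    also have "\<dots> = measure_pmf.prob (replicate_pmf (T + K) q) {is. foldl step x0 (take T is) = x \<and>
        drop T is = js}"
      by (rule prob_blk)
    also have "\<dots> = measure_pmf.prob (pair_pmf (replicate_pmf T q) (replicate_pmf K q))
        ({is. foldl step x0 is = x} \<times> {js})"
      unfolding replicate_pmf_add measure_map_pmf
      by (rule measure_pmf.finite_measure_eq_AE)
        (auto simp: AE_measure_pmf_iff set_replicate_pmf)
    finally show ?thesis by (simp add: measure_pmf_prob_product measure_pmf_single)
  next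
    case False
    then have "blk N K \<omega> \<noteq> js" for \<omega> by auto
    then show ?thesis using False by (simp add: a_def pmf_replicate_pmf)
  qed
  then have a_eq: "a = (\<lambda>T. measure_pmf.prob (replicate_pmf T q) {is. foldl step x0 is = x} *
      pmf (replicate_pmf K q) js)"
    by (rule ext)
  have lim: "a \<longlonglongrightarrow> pmf p x * pmf (replicate_pmf K q) js"
    unfolding a_eq by (intro tendsto_intros prob_run_tendsto)
  have err: "err \<longlonglongrightarrow> 0"
    unfolding err_def by (rule prob_W_ne_run_tendsto_0)
  have diff: "\<bar>a T - \<P>(\<omega> in M. W N \<omega> = x \<and> blk N K \<omega> = js)\<bar> \<le> err T" for T
    unfolding a_def err_def by (rule abs_measure_diff_le) auto
  have "(\<lambda>T. a T - \<P>(\<omega> in M. W N \<omega> = x \<and> blk N K \<omega> = js)) \<longlonglongrightarrow> 0"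
  proof (rule Lim_transform_bound[OF _ err])
    show "\<forall>\<^sub>F T in sequentially. norm (a T - \<P>(\<omega> in M. W N \<omega> = x \<and> blk N K \<omega> = js)) \<le> norm (err T)"
      using diff by (intro always_eventually allI) (simp add: order_trans[OF _ abs_ge_self])
  qed
  then have "a \<longlonglongrightarrow> \<P>(\<omega> in M. W N \<omega> = x \<and> blk N K \<omega> = js)"
    by (rule LIM_zero_cancel)
  with lim show ?thesis by (blast intro: LIMSEQ_unique)
qed

lemma prob_W_blk:
  "\<P>(\<omega> in M. P (W N \<omega>) (blk N K \<omega>)) =
     measure_pmf.prob (pair_pmf p (replicate_pmf K q)) {(x, is). P x is}"
proof -
  let ?X = "\<lambda>\<omega>. (W N \<omega>, blk N K \<omega>)"
  have meas: "?X \<in> M \<rightarrow>\<^sub>M count_space UNIV"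
    by (rule measurable_count_space_countable) auto
  have "distr M (count_space UNIV) ?X = measure_pmf (pair_pmf p (replicate_pmf K q))"
  proof (rule measure_eqI_countable[of _ UNIV])
    fix y :: "'x \<times> 'i list"
    obtain x js where y: "y = (x, js)" by (cases y)
    have "?X -` {y} \<inter> space M = {\<omega> \<in> space M. W N \<omega> = x \<and> blk N K \<omega> = js}"
      by (auto simp: y)
    then show "emeasure (distr M (count_space UNIV) ?X) {y} =
        emeasure (measure_pmf (pair_pmf p (replicate_pmf K q))) {y}"
      using meas prob_W_blk_eq[of N x K js]
      by (simp add: emeasure_distr emeasure_pmf_single emeasure_eq_measure y pmf_pair)
  qed auto
  moreover have "measure (distr M (count_space UNIV) ?X) {(x, is). P x is} =
      \<P>(\<omega> in M. P (W N \<omega>) (blk N K \<omega>))"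
    using meas by (simp add: measure_distr vimage_def Int_def conj_commute)
  ultimately show ?thesis by simp
qed

lemma prob_W: "\<P>(\<omega> in M. P (W N \<omega>)) = measure_pmf.prob p {x. P x}"
proof -
  have "{(x, is). P x} = {x. P x} \<times> (UNIV :: 'i list set)" by auto
  then show ?thesis
    using prob_W_blk[of "\<lambda>x _. P x" N 0] by (simp add: measure_pmf_prob_product)
qed

lemma prob_W_z:
  "\<P>(\<omega> in M. P (W N \<omega>) (z (N + 1) \<omega>)) = measure_pmf.prob (pair_pmf p q) {(x, i). P x i}"
proof -
  have "\<P>(\<omega> in M. P (W N \<omega>) (z (N + 1) \<omega>)) =
      \<P>(\<omega> in M. (\<lambda>x is. P x (hd is)) (W N \<omega>) (blk N 1 \<omega>))"
    by (simp add: blk_def)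
  also have "\<dots> = measure_pmf.prob (pair_pmf p (replicate_pmf 1 q)) {(x, is). P x (hd is)}"
    by (rule prob_W_blk)
  also have "replicate_pmf 1 q = map_pmf (\<lambda>i. [i]) q"
    by (rule replicate_pmf_1)
  also have "pair_pmf p \<dots> = map_pmf (\<lambda>(x, i). (x, [i])) (pair_pmf p q)"
    by (simp add: pair_map_pmf2 apsnd_def map_prod_def)
  finally show ?thesis by (simp add: vimage_def case_prod_unfold)
qed

section \<open>The law of large numbers\<close>

lemma indep_vars_window:
  fixes H :: "'i list \<Rightarrow> bool"
  assumes disj: "disjoint_family_on (\<lambda>n. {a + int n + 1..a + int n + int S}) I"
  shows "indep_vars (\<lambda>_. borel) (\<lambda>n \<omega>. of_bool (H (blk (a + int n) S \<omega>)) :: real) I"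
proof -
  let ?K = "\<lambda>n. {a + int n + 1..a + int n + int S}"
  let ?Y = "\<lambda>n x. of_bool (H (map (\<lambda>k. x (a + int n + 1 + int k)) [0..<S])) :: real"
  have "indep_vars (\<lambda>n. PiM (?K n) (\<lambda>_. count_space UNIV)) (\<lambda>n \<omega>. restrict (\<lambda>i. z i \<omega>) (?K n)) I"
    by (rule indep_vars_restrict[OF indep _ disj]) auto
  then have "indep_vars (\<lambda>_. borel) (\<lambda>n \<omega>. ?Y n (restrict (\<lambda>i. z i \<omega>) (?K n))) I"
  proof (rule indep_vars_compose2)
    fix n assume "n \<in> I"
    let ?P = "PiM (?K n) (\<lambda>_. count_space UNIV) :: (int \<Rightarrow> 'i) measure"
    let ?m = "\<lambda>x. map (\<lambda>k. x (a + int n + 1 + int k)) [0..<S] :: 'i list"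
    have "?m \<in> ?P \<rightarrow>\<^sub>M count_space UNIV"
    proof (rule measurable_count_space_countable)
      fix js
      have comp: "{x \<in> space ?P. x (a + int n + 1 + int k) = js ! k} \<in> sets ?P" if "k < S" for k
      proof -
        have "(\<lambda>x. x (a + int n + 1 + int k)) \<in> ?P \<rightarrow>\<^sub>M count_space UNIV"
          by (rule measurable_component_singleton) (use that in auto)
        then show ?thesis by simp
      qed
      have "{x \<in> space ?P. ?m x = js} = {x \<in> space ?P. length js = S \<and>
          (\<forall>k\<in>{..<S}. x (a + int n + 1 + int k) = js ! k)}"
        by (auto simp: list_eq_iff_nth_eq)
      also have "\<dots> \<in> sets ?P"
        by (intro sets.sets_Collect_conj sets.sets_Collect_finite_All sets.sets_Collect_const)
            (auto intro: comp)
      finally show "{x \<in> space ?P. ?m x = js} \<in> sets ?P" .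
    qed
    then show "?Y n \<in> borel_measurable ?P"
      by (rule measurable_compose) simp
  qed
  moreover have "?Y n (restrict (\<lambda>i. z i \<omega>) (?K n)) = of_bool (H (blk (a + int n) S \<omega>))" for n \<omega>
  proof -
    have "map (\<lambda>k. restrict (\<lambda>i. z i \<omega>) (?K n) (a + int n + 1 + int k)) [0..<S] =
        blk (a + int n) S \<omega>"
      by (auto simp: blk_def)
    then show ?thesis by simp
  qed
  ultimately show ?thesis by simp
qed

text \<open>Overlapping windows are dependent, but windows whose starts are congruent modulo
  \<open>S\<close> are disjoint. Hoeffding's inequality applies to each of the \<open>S\<close>
  residue classes, and a total deviation of \<open>\<delta> * real N\<close> forces one class to
  deviate by a share \<open>1 / S\<close> of it.\<close>

lemma prob_window_deviation:
  fixes H :: "'i list \<Rightarrow> bool"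
  assumes S: "S > 0" and \<delta>: "\<delta> > 0" and N: "N > 0"
  defines "\<mu> \<equiv> measure_pmf.prob (replicate_pmf S q) {is. H is}"
  shows "\<P>(\<omega> in M. \<bar>(\<Sum>n<N. of_bool (H (blk (a + int n) S \<omega>)) - \<mu>)\<bar> \<ge> \<delta> * real N) \<le>
           real S * (2 * exp (- 2 * \<delta>\<^sup>2 * real N / (real S)\<^sup>2))"
proof -
  define I where "I r = {n. n < N \<and> n mod S = r}" for r
  define X where "X n \<omega> = (of_bool (H (blk (a + int n) S \<omega>)) :: real)" for n \<omega>
  have X [measurable]: "X n \<in> borel_measurable M" for n unfolding X_def by measurable
  have fin: "finite (I r)" for r by (simp add: I_def)
  have E: "expectation (X n) = \<mu>" for n
  proof -
    have "X n \<omega> = indicator {\<omega> \<in> space M. H (blk (a + int n) S \<omega>)} \<omega>" if "\<omega> \<in> space M" for \<omega>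
      using that by (simp add: X_def indicator_def)
    then have "expectation (X n) = \<P>(\<omega> in M. H (blk (a + int n) S \<omega>))"
      by (subst Bochner_Integration.integral_cong[OF refl, of M _ "indicator {\<omega> \<in> space M. H
          (blk (a + int n) S \<omega>)}"]) auto
    then show ?thesis by (simp only: prob_blk \<mu>_def)
  qed
  define B where "B r = {\<omega> \<in> space M. \<bar>(\<Sum>n\<in>I r. X n \<omega>) - (\<Sum>n\<in>I r. \<mu>)\<bar> \<ge> \<delta> * real N / real S}" for r
  have B [measurable]: "B r \<in> sets M" for r unfolding B_def by measurable
  have prob_B: "prob (B r) \<le> 2 * exp (- 2 * \<delta>\<^sup>2 * real N / (real S)\<^sup>2)" if r: "r < S" for r
  proof (cases "I r = {}")
    case True
    moreover have "\<delta> * real N / real S > 0" using \<delta> N S by simp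
    ultimately have "B r = {}" by (auto simp: B_def)
    then show ?thesis by simp
  next
    case False
    have ind: "indep_vars (\<lambda>_. borel) X (I r)"
      unfolding X_def
    proof (rule indep_vars_window)
      show "disjoint_family_on (\<lambda>n. {a + int n + 1..a + int n + int S}) (I r)"
        unfolding disjoint_family_on_def
      proof (intro ballI impI)
        fix m n assume mn: "m \<in> I r" "n \<in> I r" "m \<noteq> n"
        \<comment> \<open>Distinct members of one residue class are at least \<open>S\<close> apart,
          which is the length of a window.\<close>
        have "\<bar>int m - int n\<bar> \<ge> int S"
        proof -
          have "int S dvd (int m - int n)"
            using mn by (simp add: I_def mod_eq_dvd_iff[symmetric] zmod_int[symmetric])
          then show ?thesis using mn(3) dvd_imp_le_int[of "int m - int n" "int S"] by auto
        qed
        then show "{a + int m + 1..a + int m + int S} \<inter> {a + int n + 1..a + int n + int S} = {}"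
          by auto
      qed
    qed
    interpret H: Hoeffding_ineq M "I r" X "\<lambda>_. 0" "\<lambda>_. 1" "\<Sum>n\<in>I r. expectation (X n)"
      by unfold_locales (use fin ind in \<open>auto simp: X_def\<close>)
    have card: "card (I r) > 0" "card (I r) \<le> N"
      using False fin[of r] card_mono[of "{..<N}" "I r"] by (auto simp: I_def card_gt_0_iff)
    have "prob (B r) \<le> 2 * exp (- 2 * (\<delta> * real N / real S)\<^sup>2 / real (card (I r)))"
      using H.Hoeffding_ineq_abs_ge[of "\<delta> * real N / real S"] card \<delta>
      by (simp add: B_def E)
    also have "\<dots> \<le> 2 * exp (- 2 * (\<delta> * real N / real S)\<^sup>2 / real N)"
    proof -
      have "(\<delta> * real N / real S)\<^sup>2 / real N \<le> (\<delta> * real N / real S)\<^sup>2 / real (card (I r))"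
        using card N by (intro divide_left_mono) auto
      then show ?thesis by simp
    qed
    also have "- 2 * (\<delta> * real N / real S)\<^sup>2 / real N = - 2 * \<delta>\<^sup>2 * real N / (real S)\<^sup>2"
      using N by (simp add: power2_eq_square field_simps)
    finally show ?thesis .
  qed
  have "\<P>(\<omega> in M. \<bar>(\<Sum>n<N. X n \<omega> - \<mu>)\<bar> \<ge> \<delta> * real N) \<le> prob (\<Union>r\<in>{..<S}. B r)"
  proof (rule finite_measure_mono)
    show "{\<omega> \<in> space M. \<bar>(\<Sum>n<N. X n \<omega> - \<mu>)\<bar> \<ge> \<delta> * real N} \<subseteq> (\<Union>r\<in>{..<S}. B r)"
    proof (rule subsetI, rule ccontr)
      fix \<omega> assume \<omega>: "\<omega> \<in> {\<omega> \<in> space M. \<bar>(\<Sum>n<N. X n \<omega> - \<mu>)\<bar> \<ge> \<delta> * real N}"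
        and "\<omega> \<notin> (\<Union>r\<in>{..<S}. B r)"
      then have small: "\<bar>(\<Sum>n\<in>I r. X n \<omega> - \<mu>)\<bar> < \<delta> * real N / real S" if "r < S" for r
        using that by (auto simp: B_def not_le sum_subtractf)
      have "{..<N} = (\<Union>r\<in>{..<S}. I r)" using S by (auto simp: I_def)
      then have "(\<Sum>n<N. X n \<omega> - \<mu>) = (\<Sum>r<S. \<Sum>n\<in>I r. X n \<omega> - \<mu>)"
        by (simp only:) (rule sum.UNION_disjoint; auto simp: I_def)
      then have "\<bar>(\<Sum>n<N. X n \<omega> - \<mu>)\<bar> \<le> (\<Sum>r<S. \<bar>\<Sum>n\<in>I r. X n \<omega> - \<mu>\<bar>)"
        by (simp add: sum_abs)
      also have "\<dots> < (\<Sum>r<S. \<delta> * real N / real S)"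
        using S small by (intro sum_strict_mono) auto
      also have "\<dots> = \<delta> * real N" using S by simp
      finally show False using \<omega> by simp
    qed
  qed auto
  also have "\<dots> \<le> (\<Sum>r<S. prob (B r))"
    by (rule finite_measure_subadditive_finite) auto
  also have "\<dots> \<le> (\<Sum>r<S. 2 * exp (- 2 * \<delta>\<^sup>2 * real N / (real S)\<^sup>2))"
    by (intro sum_mono prob_B) auto
  finally show ?thesis by (simp add: X_def)
qed

text \<open>The deviation bound is exponential in \<open>N\<close>, hence summable, and the
  Borel-Cantelli lemma gives the almost sure statement.\<close>

lemma window_averages:
  fixes H :: "'i list \<Rightarrow> bool"
  assumes S: "S > 0" and \<delta>: "\<delta> > 0"
  defines "\<mu> \<equiv> measure_pmf.prob (replicate_pmf S q) {is. H is}"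
  shows "AE \<omega> in M. \<forall>\<^sub>F N in sequentially.
           \<bar>(\<Sum>n<N. of_bool (H (blk (a + int n) S \<omega>)) - \<mu>)\<bar> < \<delta> * real N"
proof -
  define A where "A N = {\<omega> \<in> space M. \<bar>(\<Sum>n<N. of_bool (H (blk (a + int n) S \<omega>)) - \<mu>)\<bar> \<ge> \<delta> *
      real N}" for N
  define c where "c = exp (- 2 * \<delta>\<^sup>2 / (real S)\<^sup>2)"
  have c: "0 \<le> c" "c < 1" using S \<delta> by (auto simp: c_def)
  have bound: "prob (A N) \<le> real S * 2 * c ^ N" if "N \<ge> 1" for N
  proof -
    have "c ^ N = exp (- 2 * \<delta>\<^sup>2 * real N / (real S)\<^sup>2)"
      by (simp add: c_def exp_of_nat_mult[symmetric] field_simps)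
    then show ?thesis
      using prob_window_deviation[OF S \<delta>, of N H a] that by (simp add: A_def \<mu>_def)
  qed
  have "summable (\<lambda>N. prob (A N))"
    by (rule summable_comparison_test'[of "\<lambda>N. real S * 2 * c ^ N" 1])
      (use c bound in \<open>auto intro!: summable_mult summable_geometric\<close>)
  then have "AE \<omega> in M. \<forall>\<^sub>F N in sequentially. \<omega> \<in> space M - A N"
    by (intro borel_cantelli_AE1) (auto simp: A_def emeasure_eq_measure)
  then show ?thesis
  proof eventually_elim
    case (elim \<omega>)
    then show ?case by eventually_elim (auto simp: A_def)
  qed
qed

end

text \<open>Greedy covering: starting from the left, either skip a good position or jump over a window
  with a large average.\<close>

lemma card_large_averages_le:
  fixes e :: "nat \<Rightarrow> real" and \<delta> :: real
  assumes nonneg: "\<And>n. e n \<ge> 0"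
  shows "\<delta> * card {n\<in>{m..<N}. \<exists>k\<in>{1..K}. (\<Sum>i<k. e (n + i)) > \<delta> * k} \<le> (\<Sum>i\<in>{m..<N + K}. e i)"
proof (induction "N - m" arbitrary: m rule: less_induct)
  case less
  let ?bad = "\<lambda>n. \<exists>k\<in>{1..K}. (\<Sum>i<k. e (n + i)) > \<delta> * k"
  consider "m \<ge> N" | "m < N" "\<delta> \<le> 0" | "m < N" "\<not> ?bad m" | k where "m < N" "\<delta> > 0" "k \<in> {1..K}"
      "(\<Sum>i<k. e (m + i)) > \<delta> * k"
    by fastforce
  then show ?case
  proof cases
    case 1
    then have none: "{n\<in>{m..<N}. ?bad n} = {}" by auto
    show ?thesis unfolding none by (simp add: sum_nonneg nonneg)
  next
    case 2
    have "\<delta> * card {n\<in>{m..<N}. ?bad n} \<le> 0" using 2 by (simp add: mult_nonpos_nonneg)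
    also have "\<dots> \<le> (\<Sum>i\<in>{m..<N + K}. e i)" by (intro sum_nonneg nonneg)
    finally show ?thesis .
  next
    case 3
    have eq: "{n\<in>{m..<N}. ?bad n} = {n\<in>{Suc m..<N}. ?bad n}"
    proof (intro set_eqI iffI)
      fix n assume "n \<in> {n\<in>{m..<N}. ?bad n}"
      moreover from this 3 have "n \<noteq> m" by blast
      ultimately show "n \<in> {n\<in>{Suc m..<N}. ?bad n}" by auto
    qed auto
    have "\<delta> * card {n\<in>{m..<N}. ?bad n} \<le> (\<Sum>i\<in>{Suc m..<N + K}. e i)"
      unfolding eq by (rule less) (use 3 in auto)
    also have "\<dots> \<le> (\<Sum>i\<in>{m..<N + K}. e i)"
      by (rule sum_mono2) (auto simp: nonneg)
    finally show ?thesis .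
  next
    case 4
    have "card {n\<in>{m..<N}. ?bad n} \<le> card ({m..<m + k} \<union> {n\<in>{m + k..<N}. ?bad n})"
      by (rule card_mono) auto
    also have "\<dots> \<le> card {m..<m + k} + card {n\<in>{m + k..<N}. ?bad n}"
      by (rule card_Un_le)
    finally have "real (card {n\<in>{m..<N}. ?bad n}) \<le> k + card {n\<in>{m + k..<N}. ?bad n}"
      by simp
    then have "\<delta> * card {n\<in>{m..<N}. ?bad n} \<le> \<delta> * (k + card {n\<in>{m + k..<N}. ?bad n})"
      using 4 by (intro mult_left_mono) auto
    also have "\<dots> = \<delta> * k + \<delta> * card {n\<in>{m + k..<N}. ?bad n}" by (simp add: algebra_simps)
    also have "\<dots> \<le> (\<Sum>i<k. e (m + i)) + (\<Sum>i\<in>{m + k..<N + K}. e i)"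
      using 4 by (intro add_mono less) auto
    also have "(\<Sum>i<k. e (m + i)) = (\<Sum>i\<in>{m..<m + k}. e i)"
      by (rule sum.reindex_bij_witness[of _ "\<lambda>i. i - m" "\<lambda>i. m + i"]) auto
    also have "(\<Sum>i\<in>{m..<m + k}. e i) + (\<Sum>i\<in>{m + k..<N + K}. e i) = (\<Sum>i\<in>{m..<N + K}. e i)"
      using 4 by (intro sum.atLeastLessThan_concat) auto
    finally show ?thesis .
  qed
qed

text \<open>Stationarity enters only through the two constancy assumptions.\<close>

lemma (in prob_space) maximal_inequality:
  fixes e :: "nat \<Rightarrow> 'a \<Rightarrow> bool"
  assumes [measurable]: "\<And>n. Measurable.pred M (e n)"
    and e: "\<And>n. \<P>(\<omega> in M. e n \<omega>) = \<eta>"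
    and bad: "\<And>n K. \<P>(\<omega> in M. \<exists>k\<in>{1..K}. (\<Sum>i<k. of_bool (e (n + i) \<omega>)) > \<delta> * real k) =
      \<P>(\<omega> in M. \<exists>k\<in>{1..K}. (\<Sum>i<k. of_bool (e i \<omega>)) > \<delta> * real k)"
  shows "\<delta> * \<P>(\<omega> in M. \<exists>k\<ge>1. (\<Sum>i<k. of_bool (e i \<omega>)) > \<delta> * real k) \<le> \<eta>"
proof -
  define B where "B n K = {\<omega> \<in> space M. \<exists>k\<in>{1..K}. (\<Sum>i<k. of_bool (e (n + i) \<omega>)) > \<delta> * real k}"
      for n K
  have [measurable]: "B n K \<in> sets M" for n K unfolding B_def by measurable
  have finite_le: "\<delta> * prob (B 0 K) \<le> \<eta>" for K
  proof -
    \<comment> \<open>This is the greedy covering, integrated. The \<open>K\<close> extra terms come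
      from windows that reach beyond \<open>N\<close>; they disappear after division by
      \<open>N\<close>.\<close>
    have N: "real N * (\<delta> * prob (B 0 K)) \<le> real (N + K) * \<eta>" for N
    proof -
      have "\<delta> * (\<Sum>n<N. indicator (B n K) \<omega>) \<le> (\<Sum>n<N + K. indicator {\<omega> \<in> space M. e n \<omega>} \<omega>)"
        if "\<omega> \<in> space M" for \<omega>
      proof -
        have "(\<Sum>n<N. indicator (B n K) \<omega> :: real) =
            card {n\<in>{0..<N}. \<exists>k\<in>{1..K}. (\<Sum>i<k. of_bool (e (n + i) \<omega>)) > \<delta> * real k}"
          using that by (simp add: B_def indicator_def sum.If_cases atLeast0LessThan Int_def)
        moreover have "(\<Sum>n<N + K. indicator {\<omega> \<in> space M. e n \<omega>} \<omega> :: real) =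
            (\<Sum>n\<in>{0..<N + K}. of_bool (e n \<omega>))"
          using that by (intro sum.cong) (auto simp: indicator_def)
        ultimately show ?thesis
          using card_large_averages_le[of "\<lambda>n. of_bool (e n \<omega>)" \<delta> 0 N K] by simp
      qed
      then have "expectation (\<lambda>\<omega>. \<delta> * (\<Sum>n<N. indicator (B n K) \<omega>)) \<le>
          expectation (\<lambda>\<omega>. \<Sum>n<N + K. indicator {\<omega> \<in> space M. e n \<omega>} \<omega>)"
        by (intro integral_mono) (auto intro!: integrable_real_indicator simp: emeasure_eq_measure)
      also have "expectation (\<lambda>\<omega>. \<delta> * (\<Sum>n<N. indicator (B n K) \<omega>)) = \<delta> * (\<Sum>n<N. prob (B n K))"
        by (subst integral_mult_right_zero, subst Bochner_Integration.integral_sum)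
          (auto intro!: integrable_real_indicator simp: emeasure_eq_measure)
      also have "(\<Sum>n<N. prob (B n K)) = (\<Sum>n<N. prob (B 0 K))"
        using bad by (intro sum.cong) (simp_all add: B_def)
      also have "expectation (\<lambda>\<omega>. \<Sum>n<N + K. indicator {\<omega> \<in> space M. e n \<omega>} \<omega>) =
          (\<Sum>n<N + K. \<P>(\<omega> in M. e n \<omega>))"
        by (subst Bochner_Integration.integral_sum)
          (auto intro!: integrable_real_indicator simp: emeasure_eq_measure)
      also have "\<dots> = real (N + K) * \<eta>" by (simp add: e)
      finally show ?thesis by (simp add: mult_ac)
    qed
    have "(\<lambda>N. \<eta> + real K * \<eta> / real N) \<longlonglongrightarrow> \<eta> + 0"
      by (intro tendsto_intros lim_const_over_n)
    moreover have "\<delta> * prob (B 0 K) \<le> \<eta> + real K * \<eta> / real N" if "N \<ge> 1" for N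
      using N[of N] that by (simp add: field_simps)
    ultimately show ?thesis
      by (intro LIMSEQ_le_const[where X = "\<lambda>N. \<eta> + real K * \<eta> / real N"]) auto
  qed
  have "(\<lambda>K. prob (B 0 K)) \<longlonglongrightarrow> prob (\<Union>K. B 0 K)"
    by (rule finite_Lim_measure_incseq) (auto simp: B_def incseq_def)
  also have "(\<Union>K. B 0 K) = {\<omega> \<in> space M. \<exists>k\<ge>1. (\<Sum>i<k. of_bool (e i \<omega>)) > \<delta> * real k}"
    by (simp add: B_def set_eq_iff Bex_def) (metis order_refl)
  finally have "(\<lambda>K. \<delta> * prob (B 0 K)) \<longlonglongrightarrow> \<delta> * \<P>(\<omega> in M. \<exists>k\<ge>1. (\<Sum>i<k. of_bool (e i \<omega>)) > \<delta> * real k)"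
    by (intro tendsto_intros)
  then show ?thesis
    by (rule LIMSEQ_le_const2) (use finite_le in auto)
qed

context driven_process
begin

text \<open>Finite windows of the input satisfy a law of large numbers by independence; the error made by
  replacing the state with the run over a window is controlled by the maximal inequality.\<close>

theorem law_of_large_numbers:
  fixes g :: "'x \<Rightarrow> 'i \<Rightarrow> bool"
  defines "\<mu> \<equiv> measure_pmf.prob (pair_pmf p q) {(x, i). g x i}"
  shows "AE \<omega> in M. (\<lambda>N. (\<Sum>n<N. of_bool (g (W (int n) \<omega>) (z (int n + 1) \<omega>))) / real N) \<longlonglongrightarrow> \<mu>"
proof -
  define f where "f n \<omega> = (of_bool (g (W (int n) \<omega>) (z (int n + 1) \<omega>)) :: real)" for n \<omega>
  define e where "e T n \<omega> \<longleftrightarrow> W (int n) \<omega> \<noteq> foldl step x0 (blk (int n - int T) T \<omega>)" for T n \<omega>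
  define H where "H js \<longleftrightarrow> g (foldl step x0 (butlast js)) (last js)" for js
  \<comment> \<open>The window has \<open>Suc T\<close> inputs: \<open>T\<close> of them to rebuild
    the state at position \<open>n\<close> and one more as the second argument of
    \<open>g\<close>.\<close>
  define h where "h T n \<omega> = (of_bool (H (blk (- int T + int n) (Suc T) \<omega>)) :: real)" for T n \<omega>
  define \<mu>' where "\<mu>' T = measure_pmf.prob (replicate_pmf (Suc T) q) {is. H is}" for T
  have [measurable]: "Measurable.pred M (e T n)" for T n unfolding e_def by measurable
  have fh: "\<bar>f n \<omega> - h T n \<omega>\<bar> \<le> of_bool (e T n \<omega>)" for n T \<omega>
  proof -
    have "blk (- int T + int n) (Suc T) \<omega> = blk (int n - int T) T \<omega> @ [z (int n + 1) \<omega>]"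
      by (simp add: blk_def algebra_simps)
    then show ?thesis by (auto simp: f_def h_def e_def H_def)
  qed
  have pe: "\<P>(\<omega> in M. e T n \<omega>) = start_err T" for T n
  proof -
    have "\<P>(\<omega> in M. e T n \<omega>) =
       \<P>(\<omega> in M. (\<lambda>x is. foldl step x is \<noteq> foldl step x0 is) (W (int n - int T) \<omega>) (blk (int n -
           int T) T \<omega>))"
    proof (rule prob_eq_AE)
      show "AE \<omega> in M. e T n \<omega> \<longleftrightarrow> (\<lambda>x is. foldl step x is \<noteq> foldl step x0 is)
          (W (int n - int T) \<omega>) (blk (int n - int T) T \<omega>)"
        using W_run
      proof eventually_elim
        case (elim \<omega>)
        show ?case
          using spec[OF spec[OF elim, of "int n - int T"], of T] by (auto simp: e_def)
      qed
    qed auto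
    also have "\<dots> = start_err T" unfolding start_err_def by (rule prob_W_blk)
    finally show ?thesis .
  qed
  have mean: "\<bar>\<mu> - \<mu>' T\<bar> \<le> start_err T" for T
  proof -
    have "\<mu> = \<P>(\<omega> in M. g (W 0 \<omega>) (z (0 + 1) \<omega>))"
      unfolding \<mu>_def by (rule prob_W_z[symmetric])
    moreover have "\<mu>' T = \<P>(\<omega> in M. H (blk (- int T + int 0) (Suc T) \<omega>))"
      unfolding \<mu>'_def by (rule prob_blk[symmetric])
    moreover have "\<bar>\<P>(\<omega> in M. g (W 0 \<omega>) (z (0 + 1) \<omega>)) -
        \<P>(\<omega> in M. H (blk (- int T + int 0) (Suc T) \<omega>))\<bar> \<le>
       \<P>(\<omega> in M. e T 0 \<omega>)"
    proof (rule abs_measure_diff_le)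
      have "g (W 0 \<omega>) (z (0 + 1) \<omega>) = H (blk (- int T + int 0) (Suc T) \<omega>)" if "\<not> e T 0 \<omega>" for \<omega>
        using fh[of 0 \<omega> T] that by (simp add: f_def h_def of_bool_def split: if_splits)
      then show "AE \<omega> in M. \<omega> \<notin> {\<omega> \<in> space M. e T 0 \<omega>} \<longrightarrow>
          (\<omega> \<in> {\<omega> \<in> space M. g (W 0 \<omega>) (z (0 + 1) \<omega>)}) =
              (\<omega> \<in> {\<omega> \<in> space M. H (blk (- int T + int 0) (Suc T) \<omega>)})"
        by (intro AE_I2) auto
    qed auto
    ultimately show ?thesis by (simp only: pe)
  qed
  have maximal: "\<delta> * \<P>(\<omega> in M. \<exists>k\<ge>1. (\<Sum>i<k. of_bool (e T i \<omega>)) > \<delta> * real k) \<le> start_err T" for \<delta> T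
  proof (rule maximal_inequality)
    fix n K
    \<comment> \<open>All errors at \<open>n, ..., n + K - 1\<close> are functions of the state at
      \<open>n - T\<close> and of the next \<open>T + K\<close> inputs. The joint law of these does
      not depend on \<open>n\<close>, which is the shift invariance that the maximal inequality asks
      for.\<close>
    define Q where "Q x js \<longleftrightarrow> (\<exists>k\<in>{1..K}. (\<Sum>i<k. of_bool (foldl step x (take (T + i) js) \<noteq>
        foldl step x0 (take T (drop i js)))) > \<delta> * real k)" for x js
    have "\<P>(\<omega> in M. \<exists>k\<in>{1..K}. (\<Sum>i<k. of_bool (e T (n + i) \<omega>)) > \<delta> * real k) =
        measure_pmf.prob (pair_pmf p (replicate_pmf (T + K) q)) {(x, js). Q x js}" for n
    proof -
      have "\<P>(\<omega> in M. \<exists>k\<in>{1..K}. (\<Sum>i<k. of_bool (e T (n + i) \<omega>)) > \<delta> * real k) =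
          \<P>(\<omega> in M. Q (W (int n - int T) \<omega>) (blk (int n - int T) (T + K) \<omega>))"
      proof (rule prob_eq_AE)
        show "AE \<omega> in M. (\<exists>k\<in>{1..K}. (\<Sum>i<k. of_bool (e T (n + i) \<omega>)) > \<delta> * real k) \<longleftrightarrow>
            Q (W (int n - int T) \<omega>) (blk (int n - int T) (T + K) \<omega>)"
          using W_run
        proof eventually_elim
          case (elim \<omega>)
          let ?b = "blk (int n - int T) (T + K) \<omega>"
          have "e T (n + i) \<omega> \<longleftrightarrow> foldl step (W (int n - int T) \<omega>) (take (T + i) ?b) \<noteq>
              foldl step x0 (take T (drop i ?b))" if "i < K" for i
          proof -
            have "take (T + i) ?b = blk (int n - int T) (T + i) \<omega>"
              using that by (auto simp: list_eq_iff_nth_eq)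
            moreover have "take T (drop i ?b) = blk (int (n + i) - int T) T \<omega>"
              using that by (auto simp: list_eq_iff_nth_eq algebra_simps)
            ultimately show ?thesis
              using spec[OF spec[OF elim, of "int n - int T"], of "T + i"] by (simp add: e_def)
          qed
          then have "(\<Sum>i<k. of_bool (e T (n + i) \<omega>) :: real) =
              (\<Sum>i<k. of_bool (foldl step (W (int n - int T) \<omega>) (take (T + i) ?b) \<noteq>
              foldl step x0 (take T (drop i ?b))))" if "k \<in> {1..K}" for k
            using that by (intro sum.cong) auto
          then show ?case by (auto simp: Q_def)
        qed
      qed auto
      then show ?thesis by (simp only: prob_W_blk)
    qed
    from this[of n] this[of 0] show "\<P>(\<omega> in M. \<exists>k\<in>{1..K}. (\<Sum>i<k. of_bool (e T (n + i) \<omega>)) > \<delta> *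
        real k) =
        \<P>(\<omega> in M. \<exists>k\<in>{1..K}. (\<Sum>i<k. of_bool (e T i \<omega>)) > \<delta> * real k)"
      by simp
  qed (auto simp: pe)
  \<comment> \<open>The three shares of \<open>\<delta>\<close> pay for replacing \<open>f\<close>
    by \<open>h\<close>, for the fluctuation of the window averages, and for the difference of the
    two means.\<close>
  have close: "AE \<omega> in M. \<forall>\<^sub>F N in sequentially. \<bar>(\<Sum>n<N. f n \<omega>) - real N * \<mu>\<bar> < 3 * \<delta> * real N"
      if \<delta>: "\<delta> > 0" for \<delta>
  proof -
    define Bad where "Bad T = {\<omega> \<in> space M. \<exists>k\<ge>1. (\<Sum>i<k. of_bool (e T i \<omega>)) > \<delta> * real k}" for T
    have [measurable]: "Bad T \<in> sets M" for T unfolding Bad_def by measurable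
    have "AE \<omega> in M. \<forall>T. \<forall>\<^sub>F N in sequentially. \<bar>(\<Sum>n<N. h T n \<omega> - \<mu>' T)\<bar> < \<delta> * real N"
      unfolding AE_all_countable h_def \<mu>'_def using window_averages[OF _ \<delta>] by blast
    \<comment> \<open>The window length is chosen separately for each point. The maximal inequality
      bounds \<open>prob (Bad T)\<close> by \<open>start_err T / \<delta>\<close>, which becomes
      arbitrarily small, so almost every point escapes \<open>Bad T\<close> for some admissible
      \<open>T\<close>; the averages converge for all \<open>T\<close> at once.\<close>
    moreover have "AE \<omega> in M. \<omega> \<notin> (\<Inter>T\<in>{T. start_err T \<le> \<delta>}. Bad T)"
    proof -
      have small: "\<exists>T. start_err T \<le> \<delta> \<and> start_err T \<le> \<delta> * \<epsilon>" if "\<epsilon> > 0" for \<epsilon>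
      proof -
        have "\<forall>\<^sub>F T in sequentially. start_err T < min \<delta> (\<delta> * \<epsilon>)"
          by (rule order_tendstoD(2)[OF start_err_tendsto_0]) (use \<delta> that in auto)
        then show ?thesis by (auto simp: eventually_sequentially intro: less_imp_le)
      qed
      define I where "I = (\<Inter>T\<in>{T. start_err T \<le> \<delta>}. Bad T)"
      obtain T1 where "start_err T1 \<le> \<delta>" using small[of 1] by auto
      then have [measurable]: "I \<in> sets M"
        unfolding I_def by (intro sets.countable_INT') auto
      have "prob I \<le> 0 + \<epsilon>" if "\<epsilon> > 0" for \<epsilon>
      proof -
        obtain T where T: "start_err T \<le> \<delta>" "start_err T \<le> \<delta> * \<epsilon>" using small[OF \<open>\<epsilon> > 0\<close>] by auto
        have "prob I \<le> prob (Bad T)"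
          by (rule finite_measure_mono) (use T in \<open>auto simp: I_def\<close>)
        also have "\<delta> * prob (Bad T) \<le> \<delta> * \<epsilon>"
          using maximal[of \<delta> T] T(2) by (simp add: Bad_def)
        then have "prob (Bad T) \<le> \<epsilon>" using \<delta> by simp
        finally show ?thesis by simp
      qed
      then have "prob I \<le> 0" by (rule field_le_epsilon)
      then have "I \<in> null_sets M"
        by (simp add: null_sets_def emeasure_eq_measure antisym)
      then show ?thesis unfolding I_def by (rule AE_not_in)
    qed
    ultimately show ?thesis using AE_space
    proof eventually_elim
      case (elim \<omega>)
      then obtain T where T: "start_err T \<le> \<delta>" "\<omega> \<notin> Bad T" by auto
      have "\<forall>\<^sub>F N in sequentially. \<bar>(\<Sum>n<N. h T n \<omega> - \<mu>' T)\<bar> < \<delta> * real N" using elim(1) by blast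
      then show ?case using eventually_ge_at_top[of 1]
      proof eventually_elim
        case (elim N)
        have "\<bar>(\<Sum>n<N. f n \<omega> - h T n \<omega>)\<bar> \<le> (\<Sum>n<N. \<bar>f n \<omega> - h T n \<omega>\<bar>)" by (rule sum_abs)
        also have "\<dots> \<le> (\<Sum>n<N. of_bool (e T n \<omega>))" by (intro sum_mono fh)
        also have "\<dots> \<le> \<delta> * real N"
          using T(2) elim(2) \<open>\<omega> \<in> space M\<close> by (auto simp: Bad_def not_less)
        finally have "\<bar>(\<Sum>n<N. f n \<omega> - h T n \<omega>)\<bar> \<le> \<delta> * real N" .
        moreover have "\<bar>real N * \<mu>' T - real N * \<mu>\<bar> \<le> \<delta> * real N"
        proof -
          have "\<bar>real N * \<mu>' T - real N * \<mu>\<bar> = real N * \<bar>\<mu> - \<mu>' T\<bar>"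
            by (simp add: abs_mult right_diff_distrib[symmetric] abs_minus_commute)
          also have "\<dots> \<le> real N * \<delta>" using mean[of T] T(1) by (intro mult_left_mono) auto
          finally show ?thesis by (simp add: mult.commute)
        qed
        ultimately show ?case using elim(1) by (simp add: sum_subtractf)
      qed
    qed
  qed
  have "AE \<omega> in M. \<forall>j. \<forall>\<^sub>F N in sequentially. \<bar>(\<Sum>n<N. f n \<omega>) - real N * \<mu>\<bar> < 3 *
      (1 / real (Suc j)) * real N"
    unfolding AE_all_countable by (intro allI close) simp
  then show ?thesis
  proof eventually_elim
    case (elim \<omega>)
    have "(\<lambda>N. (\<Sum>n<N. f n \<omega>) / real N) \<longlonglongrightarrow> \<mu>"
    proof (rule tendstoI)
      fix \<epsilon> :: real assume "\<epsilon> > 0"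
      then obtain j where "1 / real (Suc j) < \<epsilon> / 3"
        using nat_approx_posE[of "\<epsilon> / 3"] by auto
      then have j: "3 * (1 / real (Suc j)) < \<epsilon>" by simp
      show "\<forall>\<^sub>F N in sequentially. dist ((\<Sum>n<N. f n \<omega>) / real N) \<mu> < \<epsilon>"
        using spec[OF elim, of j] eventually_ge_at_top[of 1]
      proof eventually_elim
        case (elim N)
        have "\<bar>(\<Sum>n<N. f n \<omega>) / real N - \<mu>\<bar> = \<bar>(\<Sum>n<N. f n \<omega>) - real N * \<mu>\<bar> / real N"
          using elim(2) by (simp add: field_simps)
        also have "\<dots> < 3 * (1 / real (Suc j))"
          using elim by (simp add: field_simps)
        finally show ?case using j by (simp add: dist_real_def)
      qed
    qed
    then show ?case by (simp add: f_def)
  qed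
qed

end

section \<open>Words and their invariant law\<close>

text \<open>A word describes the past of a position, newest item first: \<open>Some c\<close> is an agent of
  type \<open>c\<close> that is still waiting, \<open>None\<close> is any other item. Canonical words end with the oldest
  waiting agent. The function \<open>delay\<close> is \<open>0\<close> if no compatible agent is waiting.\<close>

primrec push :: "'a option \<Rightarrow> 'a option list \<Rightarrow> 'a option list" where
  "push None w = (if w = [] then [] else None # w)"
| "push (Some a) w = Some a # w"

primrec canonical :: "'a option list \<Rightarrow> bool" where
  "canonical [] \<longleftrightarrow> True"
| "canonical (x # w) \<longleftrightarrow> canonical w \<and> (x = None \<longrightarrow> w \<noteq> [])"

text \<open>The tail of a word is older than its head, so the last entry is the type of the oldest
  waiting agent and \<open>rev (types w)\<close> lists the types by first appearance.\<close>

primrec types :: "'c option list \<Rightarrow> 'c list" where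
  "types [] = []"
| "types (x # w) = (case x of None \<Rightarrow> types w | Some c \<Rightarrow> if c \<in> set (types w) then types w else c #
    types w)"

primrec oldest :: "('s \<times> 'c) set \<Rightarrow> 's \<Rightarrow> 'c option list \<Rightarrow> 'c option" where
  "oldest G s [] = None"
| "oldest G s (x # w) = (if oldest G s w = None then
      (case x of None \<Rightarrow> None | Some c \<Rightarrow> if (s, c) \<in> G then Some c else None) else oldest G s w)"

primrec delay :: "('s \<times> 'c) set \<Rightarrow> 's \<Rightarrow> 'c option list \<Rightarrow> nat" where
  "delay G s [] = 0"
| "delay G s (x # w) = (if oldest G s w = None then of_bool (oldest G s [x] \<noteq> None) else Suc
    (delay G s w))"

text \<open>Rebuilding with \<open>push\<close> strips the trailing \<open>None\<close> entries that
  arise when the oldest waiting agent of all is removed.\<close>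

primrec serve :: "('s \<times> 'c) set \<Rightarrow> 's \<Rightarrow> 'c option list \<Rightarrow> 'c option list" where
  "serve G s [] = []"
| "serve G s (x # w) =
     push (if oldest G s w = None \<and> oldest G s [x] \<noteq> None then None else x) (serve G s w)"

text \<open>A good adds an entry of its own, whether or not it finds an agent, so that entries keep
  counting positions.\<close>

primrec arrive :: "('s \<times> 'c) set \<Rightarrow> 'c option list \<Rightarrow> ('c, 's) item \<Rightarrow> 'c option list" where
  "arrive G w (Inl c) = Some c # w"
| "arrive G w (Inr s) = push None (serve G s w)"

lemma push_eq_Nil_iff [simp]: "push x w = [] \<longleftrightarrow> x = None \<and> w = []"
  by (cases x) auto

lemma push_eq_Some_Cons [simp]: "push x w = Some c # u \<longleftrightarrow> x = Some c \<and> w = u"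
  by (cases x) auto

lemma push_eq_None_Cons [simp]: "push x w = None # u \<longleftrightarrow> x = None \<and> w = u \<and> u \<noteq> []"
  by (cases x) auto

lemma canonical_push [simp]: "canonical (push x w) \<longleftrightarrow> canonical w"
  by (cases x) auto

lemma canonical_serve [simp]: "canonical (serve G s w)"
  by (induction w) auto

lemma canonical_arrive: "canonical w \<Longrightarrow> canonical (arrive G w i)"
  by (cases i) auto

lemma set_types [simp]: "c \<in> set (types w) \<longleftrightarrow> Some c \<in> set w"
  by (induction w) (auto split: option.splits)

lemma distinct_types [simp]: "distinct (types w)"
  by (induction w) (auto split: option.splits)

lemma types_eq_Nil_iff: "canonical w \<Longrightarrow> types w = [] \<longleftrightarrow> w = []"
  by (induction w) (auto split: option.splits if_splits)

lemma oldest_in: "oldest G s w = Some c \<Longrightarrow> Some c \<in> set w \<and> (s, c) \<in> G"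
  by (induction w) (auto split: option.splits if_splits)

lemma oldest_eq_None_iff: "oldest G s w = None \<longleftrightarrow> s \<notin> compat_goods G (set (types w))"
proof (induction w)
  case (Cons x w)
  then show ?case by (cases x) (auto simp: compat_goods_def split: if_splits)
qed (simp add: compat_goods_def)

lemma delay_eq_0_iff: "delay G s w = 0 \<longleftrightarrow> oldest G s w = None"
  by (induction w) (auto split: option.splits if_splits)

lemma serve_unmatched: "canonical w \<Longrightarrow> oldest G s w = None \<Longrightarrow> serve G s w = w"
proof (induction w)
  case (Cons x w)
  then show ?case by (cases x) (auto split: if_splits)
qed simp

text \<open>The types before a removal are thereby determined by the word after it and the type
  removed. This makes weights of predecessors computable from the result.\<close>

lemma set_types_serve:
  "oldest G s w = Some c \<Longrightarrow> set (types w) = insert c (set (types (serve G s w)))"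
proof (induction w)
  case (Cons x w)
  show ?case
  proof (cases "oldest G s w")
    case None
    then have w: "Some d \<in> set w \<longleftrightarrow> Some d \<in> set (serve G s w)" for d
    proof (induction w)
      case (Cons y w)
      then show ?case by (cases y) (auto split: if_splits)
    qed simp
    from None Cons.prems have "x = Some c" "oldest G s [x] \<noteq> None"
      by (auto split: option.splits if_splits)
    then show ?thesis using None w by (auto simp: set_eq_iff)
  next
    case (Some d)
    then have IH: "Some e \<in> set w \<longleftrightarrow> e = c \<or> Some e \<in> set (serve G s w)" for e
      using Cons by (auto simp: set_eq_iff)
    show ?thesis using Some IH by (cases x) (auto simp: set_eq_iff)
  qed
qed simp

text \<open>Serving a type that is present lowers the number of waiting agents by one, which is the
  induction measure.\<close>

lemma ex_serve_all: "\<exists>ss. set ss \<subseteq> Inr ` T \<and> foldl (arrive G) w ss = []"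
  if T: "\<And>c. \<exists>s\<in>T. (s, c) \<in> G" "T \<noteq> {}"
proof (induction "length (filter (\<lambda>x. x \<noteq> None) w)" arbitrary: w rule: less_induct)
  case less
  have len: "length (filter (\<lambda>x. x \<noteq> None) (serve G s w)) =
      length (filter (\<lambda>x. x \<noteq> None) w) - of_bool (oldest G s w \<noteq> None)" for s w
  proof (induction w)
    case (Cons x w)
    have "oldest G s w \<noteq> None \<Longrightarrow> length (filter (\<lambda>x. x \<noteq> None) w) > 0"
      using oldest_in[of G s w] by (auto simp: filter_empty_conv)
    then show ?case using Cons by (cases x) (auto split: if_splits)
  qed simp
  show ?case
  proof (cases "\<exists>c. Some c \<in> set w")
    case True
    then obtain c where c: "Some c \<in> set w" by auto
    obtain s where s: "s \<in> T" "(s, c) \<in> G" using T(1) by blast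
    have old: "oldest G s w \<noteq> None"
      using c s by (auto simp: oldest_eq_None_iff compat_goods_def)
    have pos: "length (filter (\<lambda>x. x \<noteq> None) w) > 0"
      using c by (auto simp: filter_empty_conv)
    have "length (filter (\<lambda>x. x \<noteq> None) (push None (serve G s w))) <
        length (filter (\<lambda>x. x \<noteq> None) w)"
      using len[of s w] old pos by simp
    from less[OF this] obtain ss where "set ss \<subseteq> Inr ` T"
        "foldl (arrive G) (push None (serve G s w)) ss = []"
      by blast
    then show ?thesis using s by (intro exI[of _ "Inr s # ss"]) auto
  next
    case False
    \<comment> \<open>The word may be a nonempty list of \<open>None\<close> here; rebuilding it
      with \<open>push\<close> leaves nothing, so a single good of any type empties it.\<close>
    have nil: "serve G s w = []" for s
      using False
    proof (induction w)
      case (Cons x w)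
      then show ?case by (cases x) auto
    qed simp
    obtain s where "s \<in> T" using T(2) by blast
    then show ?thesis by (intro exI[of _ "[Inr s]"]) (auto simp: nil)
  qed
qed

section \<open>Integrals over words and sums over orderings\<close>

lemma nn_integral_count_space_list:
  fixes f :: "'a::finite list \<Rightarrow> ennreal"
  shows "(\<integral>\<^sup>+ w. f w \<partial>count_space UNIV) = f [] + (\<Sum>x\<in>UNIV. \<integral>\<^sup>+ w. f (x # w) \<partial>count_space UNIV)"
proof -
  let ?C = "case_prod Cons :: 'a \<times> 'a list \<Rightarrow> 'a list"
  have split: "f w = f w * indicator {[]} w + f w * indicator (range ?C) w" for w
    by (cases w) (auto simp: indicator_def)
  have "(\<integral>\<^sup>+ w. f w \<partial>count_space UNIV) =
      (\<integral>\<^sup>+ w. f w * indicator {[]} w \<partial>count_space UNIV) +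
          (\<integral>\<^sup>+ w. f w * indicator (range ?C) w \<partial>count_space UNIV)"
    by (subst split) (rule nn_integral_add; simp)
  also have "(\<integral>\<^sup>+ w. f w * indicator {[]} w \<partial>count_space UNIV) = f []"
    by (subst nn_integral_count_space_indicator[symmetric])
        (auto simp: nn_integral_count_space_finite)
  also have "(\<integral>\<^sup>+ w. f w * indicator (range ?C) w \<partial>count_space UNIV) =
      (\<integral>\<^sup>+ w. f w \<partial>count_space (range ?C))"
    by (subst nn_integral_count_space_indicator) auto
  also have "\<dots> = (\<integral>\<^sup>+ xw. f (?C xw) \<partial>count_space UNIV)"
    by (rule nn_integral_bij_count_space[symmetric]) (auto simp: bij_betw_def inj_on_def)
  also have "\<dots> = (\<integral>\<^sup>+ x. \<integral>\<^sup>+ w. f (?C (x, w)) \<partial>count_space UNIV \<partial>count_space UNIV)"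
    by (rule nn_integral_fst_count_space[symmetric])
  also have "\<dots> = (\<Sum>x\<in>UNIV. \<integral>\<^sup>+ w. f (x # w) \<partial>count_space UNIV)"
    by (subst nn_integral_count_space_finite) auto
  finally show ?thesis .
qed

text \<open>For \<open>a > 0\<close> infinity solves the equation too, so finiteness has to be
  established beforehand.\<close>

lemma ennreal_affine_fixpoint:
  assumes x: "x = ennreal a * x + ennreal b" and fin: "x < \<infinity>" and "0 \<le> a" "a < 1" "0 \<le> b"
  shows "x = ennreal (b / (1 - a))"
proof -
  obtain r where r: "x = ennreal r" "r \<ge> 0" using fin by (cases x) auto
  then have "ennreal r = ennreal (a * r + b)"
    using x assms by (simp add: ennreal_mult[symmetric] ennreal_plus[symmetric] del: ennreal_plus)
  then have "r = a * r + b" using r assms by (subst (asm) ennreal_inj) auto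
  then have "r = b / (1 - a)" using assms by (simp add: field_simps)
  then show ?thesis using r by simp
qed

lemma sum_mult_of_bool_eq:
  "(\<Sum>d\<in>UNIV. f d * (of_bool (d = b) * y)) = f b * (y :: ennreal)" for b :: "'a::finite"
proof -
  have "(\<Sum>d\<in>UNIV. f d * (of_bool (d = b) * y)) = (\<Sum>d\<in>{b}. f d * y)"
    by (rule sum.mono_neutral_cong_right) auto
  then show ?thesis by simp
qed

lemma finite_distinct: "finite {R :: 'c::finite list. distinct R}"
proof (rule finite_subset)
  show "{R :: 'c list. distinct R} \<subseteq> {R. set R \<subseteq> UNIV \<and> length R \<le> CARD('c)}"
    by (auto simp flip: distinct_card intro!: card_mono)
  show "finite {R. set R \<subseteq> (UNIV :: 'c set) \<and> length R \<le> CARD('c)}"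
    by (rule finite_lists_length_le) simp
qed

lemma sum_distinct_by_set:
  fixes F :: "'c::finite list \<Rightarrow> real"
  shows "(\<Sum>Cs | distinct Cs. F Cs) = (\<Sum>C\<in>UNIV. \<Sum>Cs\<in>permutations_of_set C. F Cs)"
proof -
  have "{Cs :: 'c list. distinct Cs} = (\<Union>C\<in>UNIV. permutations_of_set C)"
    by (auto simp: permutations_of_set_def)
  moreover have "(\<Sum>Cs\<in>(\<Union>C\<in>UNIV. permutations_of_set C). F Cs) =
      (\<Sum>C\<in>UNIV. \<Sum>Cs\<in>permutations_of_set C. F Cs)"
  proof (rule sum.UNION_disjoint)
    show "\<forall>C\<in>UNIV. \<forall>C'\<in>UNIV. C \<noteq> C' \<longrightarrow> permutations_of_set C \<inter> permutations_of_set C' =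
        ({} :: 'c list set)"
      unfolding permutations_of_set_def by blast
  qed simp_all
  ultimately show ?thesis by (simp only:)
qed

lemma sum_rev_distinct: "(\<Sum>R | distinct R. F (rev R)) = (\<Sum>Cs | distinct Cs. F Cs)"
  by (rule sum.reindex_bij_witness[of _ rev rev]) auto

lemma sum_distinct_by_length:
  fixes F :: "'c::finite list \<Rightarrow> real"
  assumes "F [] = 0"
  shows "(\<Sum>Cs | distinct Cs. F Cs) = (\<Sum>k = 1..CARD('c). \<Sum>C | card C =
      k. \<Sum>Cs \<in> permutations_of_set C. F Cs)"
proof -
  let ?f = "\<lambda>C. \<Sum>Cs\<in>permutations_of_set C. F Cs"
  have "(\<Sum>Cs | distinct Cs. F Cs) = (\<Sum>C\<in>UNIV. ?f C)" by (rule sum_distinct_by_set)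
  also have "\<dots> = (\<Sum>k\<in>{0..CARD('c)}. \<Sum>C\<in>{C\<in>UNIV. card C = k}. ?f C)"
    by (rule sum.group[symmetric]) (auto intro!: card_mono)
  also have "\<dots> = (\<Sum>k = 1..CARD('c). \<Sum>C | card C = k. ?f C)"
  proof -
    have "(\<Sum>C | card C = (0::nat). ?f C) = 0"
      by (intro sum.neutral) (auto simp: assms)
    then show ?thesis by (simp add: sum.atLeast_Suc_atMost)
  qed
  finally show ?thesis .
qed

section \<open>Rates and product-form weights of words\<close>

locale fcfs_rates =
  fixes lbar mbar :: real and \<alpha> :: "'c::finite pmf" and \<beta> :: "'s::finite pmf"
    and G :: "('s \<times> 'c) set"
  assumes lbar_pos: "lbar > 0" and mbar_pos: "mbar > 0"
    and stable: "stability_condition lbar mbar \<alpha> \<beta> G"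
begin

abbreviation "\<Lambda> \<equiv> lbar + mbar"
abbreviation "la C \<equiv> type_rate lbar \<alpha> C"
abbreviation "mu C \<equiv> type_rate mbar \<beta> (compat_goods G C)"

lemma \<Lambda>_pos: "\<Lambda> > 0"
  using lbar_pos mbar_pos by simp

lemma type_rate_nonneg: "la C \<ge> 0" "type_rate mbar \<beta> S \<ge> 0"
  using lbar_pos mbar_pos by (auto simp: type_rate_def intro!: sum_nonneg)

lemma type_rate_UNIV: "la UNIV = lbar" "type_rate mbar \<beta> UNIV = mbar"
  by (simp_all add: type_rate_def sum_distrib_left[symmetric] sum_pmf_eq_1)

lemma type_rate_mono: "S \<subseteq> T \<Longrightarrow> type_rate mbar \<beta> S \<le> type_rate mbar \<beta> T"
  using mbar_pos by (auto simp: type_rate_def intro!: sum_mono2)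

lemma mu_le: "mu C \<le> mbar"
  using type_rate_mono[of "compat_goods G C" UNIV] type_rate_UNIV by simp

lemma la_less_mu: "C \<noteq> {} \<Longrightarrow> la C < mu C"
  using stable by (simp add: stability_condition_def)

lemma mu_empty [simp]: "mu {} = 0"
  by (simp add: type_rate_def compat_goods_def)

definition item_pmf :: "('c, 's) item pmf" where
  "item_pmf = bind_pmf (bernoulli_pmf (lbar / \<Lambda>))
     (\<lambda>b. if b then map_pmf Inl \<alpha> else map_pmf Inr \<beta>)"

lemma pmf_item_Inl: "pmf item_pmf (Inl c) = la {c} / \<Lambda>"
proof -
  have "pmf (map_pmf Inr \<beta>) (Inl c) = 0" by (auto simp: pmf_eq_0_set_pmf)
  moreover have "0 \<le> lbar / \<Lambda>" "lbar / \<Lambda> \<le> 1" using lbar_pos mbar_pos by auto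
  ultimately show ?thesis
    unfolding item_pmf_def pmf_bind
    by (subst integral_bernoulli_pmf) (auto simp: pmf_map_inj' type_rate_def)
qed

lemma pmf_item_Inr: "pmf item_pmf (Inr s) = type_rate mbar \<beta> {s} / \<Lambda>"
proof -
  have "pmf (map_pmf Inl \<alpha>) (Inr s) = 0" by (auto simp: pmf_eq_0_set_pmf)
  moreover have "0 \<le> lbar / \<Lambda>" "lbar / \<Lambda> \<le> 1" using lbar_pos mbar_pos by auto
  moreover have "1 - lbar / \<Lambda> = mbar / \<Lambda>" using \<Lambda>_pos by (simp add: field_simps)
  ultimately show ?thesis
    unfolding item_pmf_def pmf_bind
    by (subst integral_bernoulli_pmf) (auto simp: pmf_map_inj' type_rate_def)
qed

text \<open>With U the types of \<open>w\<close>, the weights of all letters add up to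
  \<open>1 + (lbar - mu U) / \<Lambda>\<close>, so this is no transition kernel. Before the empty
  word \<open>None\<close> weighs 1.\<close>

definition letter_weight :: "'c option \<Rightarrow> 'c option list \<Rightarrow> real" where
  "letter_weight x w = (case x of None \<Rightarrow> (\<Lambda> - mu (set (types w))) / \<Lambda> | Some c \<Rightarrow> la {c} / \<Lambda>)"

primrec weight :: "'c option list \<Rightarrow> real" where
  "weight [] = 1"
| "weight (x # w) = letter_weight x w * weight w"

lemma letter_weight_nonneg: "letter_weight x w \<ge> 0"
  using \<Lambda>_pos type_rate_nonneg mu_le[of "set (types w)"] lbar_pos
  by (auto simp: letter_weight_def split: option.splits)

lemma weight_nonneg: "weight w \<ge> 0"
  by (induction w) (auto simp: letter_weight_nonneg)

text \<open>\<open>None\<close> weighs at least \<open>lbar / \<Lambda>\<close>, so only an agent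
  type of rate zero can annihilate a word. Such agents almost surely never arrive, which settles the
  support condition for the backlog.\<close>

lemma weight_eq_0D: "weight w = 0 \<Longrightarrow> \<exists>c. Some c \<in> set w \<and> la {c} = 0"
proof (induction w)
  case (Cons x w)
  show ?case
  proof (cases x)
    case None
    have "letter_weight x w > 0"
      using mu_le[of "set (types w)"] lbar_pos \<Lambda>_pos by (simp add: letter_weight_def None)
    then show ?thesis using Cons by auto
  next
    case (Some c)
    then show ?thesis using Cons \<Lambda>_pos by (auto simp: letter_weight_def)
  qed
qed simp

text \<open>The invariant measure of the chain driven by \<open>arrive G\<close>, not yet normalized.\<close>

definition word_measure :: "'c option list measure" where
  "word_measure = density (count_space UNIV) (\<lambda>w. if canonical w then ennreal (weight w) else 0)"

lemma sets_word_measure [simp]: "sets word_measure = UNIV"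
  and space_word_measure [simp]: "space word_measure = UNIV"
  by (auto simp: word_measure_def)

lemma measurable_word_measure [simp]: "f \<in> borel_measurable word_measure"
  by (auto simp: measurable_def)

lemma nn_integral_word_measure:
  "(\<integral>\<^sup>+ w. f w \<partial>word_measure) = (\<integral>\<^sup>+ w. (if canonical w then ennreal (weight w) else 0) *
      f w \<partial>count_space UNIV)"
  unfolding word_measure_def by (subst nn_integral_density) auto

text \<open>The newest letter is split off; the computations of masses, flows and delays all start
  from this recursion. The word \<open>[None]\<close> drops out because it is not canonical.\<close>

lemma nn_integral_word_measure_rec:
  "(\<integral>\<^sup>+ w. f w \<partial>word_measure) = f [] +
     ((\<Sum>c\<in>UNIV. ennreal (la {c} / \<Lambda>) * (\<integral>\<^sup>+ w. f (Some c # w) \<partial>word_measure)) +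
      (\<integral>\<^sup>+ w. ennreal (letter_weight None w) * (if w = [] then 0 else f (None # w)) \<partial>word_measure))"
proof -
  let ?g = "\<lambda>w. (if canonical w then ennreal (weight w) else 0)"
  have some: "(\<integral>\<^sup>+ w. ?g (Some c # w) * f (Some c # w) \<partial>count_space UNIV) =
      ennreal (la {c} / \<Lambda>) * (\<integral>\<^sup>+ w. f (Some c # w) \<partial>word_measure)" for c
  proof -
    define a where "a = la {c} / \<Lambda>"
    have a: "0 \<le> a" using type_rate_nonneg \<Lambda>_pos by (simp add: a_def)
    have "weight (Some c # w) = a * weight w" for w by (simp add: a_def letter_weight_def)
    then have "?g (Some c # w) * f (Some c # w) = ennreal a * (?g w * f (Some c # w))" for w
      using a by (simp add: weight_nonneg ennreal_mult mult_ac del: weight.simps)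
    then have "?g (Some c # w) * f (Some c # w) = ennreal (la {c} / \<Lambda>) * (?g w * f (Some c # w))"
        for w
      by (simp only: a_def)
    then show ?thesis
      unfolding nn_integral_word_measure by (simp only:) (rule nn_integral_cmult, simp)
  qed
  have "(\<integral>\<^sup>+ w. f w \<partial>word_measure) = f [] + (\<Sum>x\<in>UNIV. \<integral>\<^sup>+ w. ?g (x # w) *
      f (x # w) \<partial>count_space UNIV)"
    unfolding nn_integral_word_measure by (subst nn_integral_count_space_list) simp
  also have "(\<Sum>x\<in>UNIV. \<integral>\<^sup>+ w. ?g (x # w) * f (x # w) \<partial>count_space UNIV) =
      (\<integral>\<^sup>+ w. ?g (None # w) * f (None # w) \<partial>count_space UNIV) +
      (\<Sum>c\<in>UNIV. \<integral>\<^sup>+ w. ?g (Some c # w) * f (Some c # w) \<partial>count_space UNIV)"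
    by (simp add: UNIV_option_conv sum.reindex)
  also have "(\<integral>\<^sup>+ w. ?g (None # w) * f (None # w) \<partial>count_space UNIV) =
      (\<integral>\<^sup>+ w. ennreal (letter_weight None w) * (if w = [] then 0 else f (None # w)) \<partial>word_measure)"
    unfolding nn_integral_word_measure
    by (rule nn_integral_cong)
      (auto simp: letter_weight_nonneg weight_nonneg ennreal_mult mult_ac)
  finally show ?thesis unfolding some by (simp add: add_ac)
qed

lemma nn_integral_word_measure_single:
  "canonical u \<Longrightarrow> (\<integral>\<^sup>+ w. of_bool (w = u) * f w \<partial>word_measure) = ennreal (weight u) * f u"
proof -
  assume u: "canonical u"
  have "(\<integral>\<^sup>+ w. of_bool (w = u) * f w \<partial>word_measure) = (\<integral>\<^sup>+ w. (ennreal (weight u) * f u) *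
      indicator {u} w \<partial>count_space UNIV)"
    unfolding nn_integral_word_measure
    by (rule nn_integral_cong) (auto simp: u indicator_def)
  also have "\<dots> = ennreal (weight u) * f u"
    by (subst nn_integral_cmult_indicator) (auto simp: emeasure_count_space_finite)
  finally show ?thesis .
qed

text \<open>The parameter p_h for the set of the first h types. Its complement to 1 is the weight of
  all letters that keep this set unchanged.\<close>

definition gap_rate :: "'c set \<Rightarrow> real" where
  "gap_rate C = (mu C - la C) / \<Lambda>"

lemma gap_rate_pos: "C \<noteq> {} \<Longrightarrow> gap_rate C > 0"
  using la_less_mu \<Lambda>_pos by (simp add: gap_rate_def)

lemma gap_rate_le_1: "gap_rate C \<le> 1"
  using mu_le[of C] type_rate_nonneg(1)[of C] \<Lambda>_pos lbar_pos by (simp add: gap_rate_def)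

text \<open>The total weight of the words with types \<open>R\<close>: the oldest agent of type
  \<open>c\<close> contributes \<open>la {c} / \<Lambda>\<close>, and the newer letters that leave
  \<open>c # R\<close> unchanged sum to the geometric series
  \<open>1 / gap_rate (set (c # R))\<close>.\<close>

primrec mass :: "'c list \<Rightarrow> real" where
  "mass [] = 1"
| "mass (c # R) = la {c} / \<Lambda> / gap_rate (set (c # R)) * mass R"

lemma mass_nonneg: "mass R \<ge> 0"
proof (induction R)
  case (Cons c R)
  then show ?case using type_rate_nonneg \<Lambda>_pos gap_rate_pos[of "set (c # R)"] by simp
qed simp

lemma mass_Cons_rec: "mass (c # R) = (1 - gap_rate (set (c # R))) * mass (c # R) + la {c} / \<Lambda> *
    mass R"
proof -
  have "gap_rate (set (c # R)) * mass (c # R) = la {c} / \<Lambda> * mass R"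
    using gap_rate_pos[of "set (c # R)"] by simp
  then show ?thesis by (simp only: left_diff_distrib mult_1 diff_add_cancel)
qed

text \<open>A word with types \<open>c # R\<close> arises either from one with the same types by putting
  an old type or no agent in front, or from one with types \<open>R\<close> by putting \<open>c\<close> in front.\<close>

lemma nn_integral_types_rec:
  fixes Q Q' :: "'c option list \<Rightarrow> bool"
  assumes R: "distinct (c # R)"
    and Q: "\<And>w x. types w = c # R \<Longrightarrow> x \<in> insert None (Some ` set (c # R)) \<Longrightarrow> Q (x # w) \<longleftrightarrow> Q' w"
  shows "(\<integral>\<^sup>+ w. of_bool (types w = c # R \<and> Q w) \<partial>word_measure) =
     ennreal (1 - gap_rate (set (c # R))) * (\<integral>\<^sup>+ w. of_bool (types w = c # R \<and>
         Q' w) \<partial>word_measure) +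
     ennreal (la {c} / \<Lambda>) * (\<integral>\<^sup>+ w. of_bool (types w = R \<and> Q (Some c # w)) \<partial>word_measure)"
proof -
  let ?I = "\<lambda>P. \<integral>\<^sup>+ w. of_bool (P w) \<partial>word_measure"
  let ?U = "set (c # R)"
  have la_nn: "0 \<le> la {d} / \<Lambda>" for d using type_rate_nonneg \<Lambda>_pos by simp
  have some: "?I (\<lambda>w. types (Some d # w) = c # R \<and> Q (Some d # w)) =
      of_bool (d \<in> ?U) * ?I (\<lambda>w. types w = c # R \<and> Q' w) +
      of_bool (d = c) * ?I (\<lambda>w. types w = R \<and> Q (Some c # w))" for d
  proof -
    \<comment> \<open>For \<open>d = c\<close> both coefficients are 1, but the summands concern
      different tails: one already contains \<open>c\<close>, the other does not.\<close>
    have "of_bool (types (Some d # w) = c # R \<and> Q (Some d # w)) =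
        (of_bool (d \<in> ?U) * of_bool (types w = c # R \<and> Q' w) +
         of_bool (d = c) * of_bool (types w = R \<and> Q (Some c # w)) :: ennreal)" for w
    proof (cases "d \<in> set (types w)")
      case True
      show ?thesis
      proof (cases "types w = c # R")
        case True': True
        then have dU: "d \<in> ?U" using True by metis
        then have "Q (Some d # w) \<longleftrightarrow> Q' w" using Q[OF True', of "Some d"] by blast
        then show ?thesis using True True' dU R by (simp del: set_types)
      next
        case False
        then show ?thesis using True R by (auto simp del: set_types)
      qed
    next
      case False
      then have "types w = c # R \<Longrightarrow> d \<notin> ?U" by metis
      then show ?thesis using False by (auto simp del: set_types)
    qed
    then have "?I (\<lambda>w. types (Some d # w) = c # R \<and> Q (Some d # w)) = (\<integral>\<^sup>+ w. of_bool (d \<in> ?U) *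
        of_bool (types w = c # R \<and> Q' w) +
         of_bool (d = c) * of_bool (types w = R \<and> Q (Some c # w)) \<partial>word_measure)"
      by (simp only:)
    then show ?thesis by (simp add: nn_integral_add nn_integral_cmult)
  qed
  have "(\<Sum>d\<in>UNIV. ennreal (la {d} / \<Lambda>) * ?I (\<lambda>w. types (Some d # w) = c # R \<and> Q (Some d # w))) =
      (\<Sum>d\<in>UNIV. ennreal (la {d} / \<Lambda>) * of_bool (d \<in> ?U)) * ?I (\<lambda>w. types w = c # R \<and> Q' w) +
      (\<Sum>d\<in>UNIV. ennreal (la {d} / \<Lambda>) * of_bool (d = c)) * ?I (\<lambda>w. types w = R \<and> Q (Some c # w))"
    unfolding some by (simp only: distrib_left sum.distrib sum_distrib_right mult.assoc)
  also have "(\<Sum>d\<in>UNIV. ennreal (la {d} / \<Lambda>) * of_bool (d \<in> ?U)) = (\<Sum>d\<in>?U. ennreal (la {d} / \<Lambda>))"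
    by (rule sum.mono_neutral_cong_right) auto
  also have "\<dots> = ennreal (la ?U / \<Lambda>)"
    using la_nn by (simp add: sum_ennreal sum_divide_distrib[symmetric] type_rate_def del:
        set_simps)
  also have "(\<Sum>d\<in>UNIV. ennreal (la {d} / \<Lambda>) * of_bool (d = c)) = ennreal (la {c} / \<Lambda>)"
    by (simp add: of_bool_def if_distrib sum.delta cong: if_cong)
  finally have somes: "(\<Sum>d\<in>UNIV. ennreal (la {d} / \<Lambda>) * ?I (\<lambda>w. types (Some d # w) = c # R \<and>
      Q (Some d # w))) =
      ennreal (la ?U / \<Lambda>) * ?I (\<lambda>w. types w = c # R \<and> Q' w) +
      ennreal (la {c} / \<Lambda>) * ?I (\<lambda>w. types w = R \<and> Q (Some c # w))" .
  have "ennreal (letter_weight None w) * (if w = [] then 0 else of_bool (types (None # w) =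
      c # R \<and> Q (None # w))) =
      ennreal ((\<Lambda> - mu ?U) / \<Lambda>) * of_bool (types w = c # R \<and> Q' w)" for w
  proof (cases "types w = c # R")
    case True
    then have "w \<noteq> []" by auto
    then show ?thesis using True Q[OF True, of None] by (simp add: letter_weight_def)
  qed auto
  then have none: "(\<integral>\<^sup>+ w. ennreal (letter_weight None w) *
      (if w = [] then 0 else of_bool (types (None # w) = c # R \<and> Q (None # w))) \<partial>word_measure) =
      ennreal ((\<Lambda> - mu ?U) / \<Lambda>) * ?I (\<lambda>w. types w = c # R \<and> Q' w)"
    by (simp only:) (rule nn_integral_cmult, simp)
  have "?I (\<lambda>w. types w = c # R \<and> Q w) =
      ennreal (la ?U / \<Lambda>) * ?I (\<lambda>w. types w = c # R \<and> Q' w) +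
      ennreal (la {c} / \<Lambda>) * ?I (\<lambda>w. types w = R \<and> Q (Some c # w)) +
      ennreal ((\<Lambda> - mu ?U) / \<Lambda>) * ?I (\<lambda>w. types w = c # R \<and> Q' w)"
    by (subst nn_integral_word_measure_rec) (simp only: somes none, simp)
  also have "\<dots> = (ennreal (la ?U / \<Lambda>) + ennreal ((\<Lambda> - mu ?U) / \<Lambda>)) * ?I (\<lambda>w. types w = c # R \<and>
      Q' w) +
      ennreal (la {c} / \<Lambda>) * ?I (\<lambda>w. types w = R \<and> Q (Some c # w))"
    by (simp add: distrib_right add_ac)
  also have "ennreal (la ?U / \<Lambda>) + ennreal ((\<Lambda> - mu ?U) / \<Lambda>) = ennreal (1 - gap_rate ?U)"
  proof -
    have "0 \<le> la ?U / \<Lambda>" "0 \<le> (\<Lambda> - mu ?U) / \<Lambda>"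
      using type_rate_nonneg(1)[of ?U] mu_le[of ?U] \<Lambda>_pos lbar_pos by (auto simp del: set_simps)
    moreover have "1 - gap_rate ?U = la ?U / \<Lambda> + (\<Lambda> - mu ?U) / \<Lambda>"
      using \<Lambda>_pos by (simp only: gap_rate_def diff_divide_distrib) simp
    ultimately show ?thesis by (simp add: ennreal_plus)
  qed
  finally show ?thesis .
qed

section \<open>Total weight of the words with given types\<close>

lemma types_Nil_integral:
  "(\<integral>\<^sup>+ w. of_bool (types w = [] \<and> Q w) \<partial>word_measure) = of_bool (Q [])"
proof -
  have "(\<integral>\<^sup>+ w. of_bool (types w = [] \<and> Q w) \<partial>word_measure) = (\<integral>\<^sup>+ w. of_bool (w = []) *
      of_bool (Q w) \<partial>word_measure)"
    unfolding nn_integral_word_measure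
    by (rule nn_integral_cong) (auto simp: types_eq_Nil_iff)
  then show ?thesis by (simp add: nn_integral_word_measure_single)
qed

text \<open>Truncation by length permits an induction on \<open>n\<close> before the integral is
  known to be finite. Since \<open>mass\<close> solves the recursion, the bound reproduces
  itself.\<close>

lemma word_measure_types_length_le:
  assumes "distinct R"
  shows "(\<integral>\<^sup>+ w. of_bool (types w = R \<and> length w \<le> n) \<partial>word_measure) \<le> ennreal (mass R)"
  using assms
proof (induction R arbitrary: n)
  case Nil
  then show ?case by (simp add: types_Nil_integral)
next
  case (Cons c R)
  show ?case
  proof (induction n)
    case 0
    have "(\<integral>\<^sup>+ w. of_bool (types w = c # R \<and> length w \<le> 0) \<partial>word_measure) =
        (\<integral>\<^sup>+ w. 0 \<partial>word_measure)"
      by (rule nn_integral_cong) auto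
    then show ?case by simp
  next
    case (Suc n)
    have nn: "0 \<le> 1 - gap_rate (set (c # R))" "0 \<le> la {c} / \<Lambda>"
      using gap_rate_le_1 type_rate_nonneg \<Lambda>_pos by auto
    have "(\<integral>\<^sup>+ w. of_bool (types w = c # R \<and> length w \<le> Suc n) \<partial>word_measure) =
        ennreal (1 - gap_rate (set (c # R))) * (\<integral>\<^sup>+ w. of_bool (types w = c # R \<and> length w \<le>
            n) \<partial>word_measure) +
        ennreal (la {c} / \<Lambda>) * (\<integral>\<^sup>+ w. of_bool (types w = R \<and> length (Some c # w) \<le>
            Suc n) \<partial>word_measure)"
      by (rule nn_integral_types_rec[OF Cons.prems]) auto
    also have "\<dots> \<le> ennreal (1 - gap_rate (set (c # R))) * ennreal (mass (c # R)) +
        ennreal (la {c} / \<Lambda>) * ennreal (mass R)"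
      using Cons.IH[of n] Cons.prems Suc.IH by (intro add_mono mult_left_mono) auto
    also have "\<dots> = ennreal ((1 - gap_rate (set (c # R))) * mass (c # R) + la {c} / \<Lambda> * mass R)"
      using nn mass_nonneg by (simp only: ennreal_mult[symmetric] ennreal_plus[symmetric]
          mult_nonneg_nonneg)
    also have "\<dots> = ennreal (mass (c # R))" by (simp only: mass_Cons_rec[symmetric])
    finally show ?case .
  qed
qed

lemma word_measure_types_le:
  assumes "distinct R"
  shows "(\<integral>\<^sup>+ w. of_bool (types w = R) \<partial>word_measure) \<le> ennreal (mass R)"
proof -
  have "(\<integral>\<^sup>+ w. of_bool (types w = R) \<partial>word_measure) =
      (\<integral>\<^sup>+ w. (SUP n. of_bool (types w = R \<and> length w \<le> n)) \<partial>word_measure)"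
  proof (rule nn_integral_cong)
    fix w :: "'c option list"
    show "of_bool (types w = R) = (SUP n. of_bool (types w = R \<and> length w \<le> n) :: ennreal)"
      by (rule antisym) (auto intro!: SUP_upper2[of "length w"] SUP_least)
  qed
  also have "\<dots> = (SUP n. \<integral>\<^sup>+ w. of_bool (types w = R \<and> length w \<le> n) \<partial>word_measure)"
    by (rule nn_integral_monotone_convergence_SUP) (auto simp: incseq_def le_fun_def)
  also have "\<dots> \<le> ennreal (mass R)"
    by (rule SUP_least) (rule word_measure_types_length_le[OF assms])
  finally show ?thesis .
qed

text \<open>With finiteness known, splitting off the newest letter gives an affine equation with a
  single finite solution.\<close>

lemma word_measure_types:
  assumes "distinct R"
  shows "(\<integral>\<^sup>+ w. of_bool (types w = R) \<partial>word_measure) = ennreal (mass R)"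
  using assms
proof (induction R)
  case Nil
  then show ?case using types_Nil_integral[of "\<lambda>_. True"] by simp
next
  case (Cons c R)
  let ?x = "\<integral>\<^sup>+ w. of_bool (types w = c # R) \<partial>word_measure"
  let ?g = "gap_rate (set (c # R))"
  have nn: "0 \<le> 1 - ?g" "0 \<le> la {c} / \<Lambda>" "?g > 0"
    using gap_rate_le_1 type_rate_nonneg \<Lambda>_pos gap_rate_pos[of "set (c # R)"] by auto
  have "?x = ennreal (1 - ?g) * ?x + ennreal (la {c} / \<Lambda>) *
      (\<integral>\<^sup>+ w. of_bool (types w = R) \<partial>word_measure)"
    using nn_integral_types_rec[OF Cons.prems, of "\<lambda>_. True" "\<lambda>_. True"] by simp
  also have "(\<integral>\<^sup>+ w. of_bool (types w = R) \<partial>word_measure) = ennreal (mass R)"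
    using Cons by simp
  also have "ennreal (la {c} / \<Lambda>) * ennreal (mass R) = ennreal (la {c} / \<Lambda> * mass R)"
    using nn mass_nonneg by (simp only: ennreal_mult[symmetric])
  finally have "?x = ennreal ((la {c} / \<Lambda> * mass R) / (1 - (1 - ?g)))"
  proof (intro ennreal_affine_fixpoint)
    show "?x < \<infinity>"
      using word_measure_types_le[OF Cons.prems] by (simp add: order_le_less_trans)
    show "0 \<le> la {c} / \<Lambda> * mass R" using nn(2) mass_nonneg by (rule mult_nonneg_nonneg)
  qed (use nn in auto)
  also have "(la {c} / \<Lambda> * mass R) / (1 - (1 - ?g)) = mass (c # R)" by simp
  finally show ?case .
qed

definition total_mass :: real where
  "total_mass = (\<Sum>R | distinct R. mass R)"

lemma total_mass_ge_1: "total_mass \<ge> 1"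
proof -
  have "mass [] \<le> total_mass" unfolding total_mass_def
    by (rule member_le_sum) (auto simp: finite_distinct mass_nonneg)
  then show ?thesis by simp
qed

lemma emeasure_word_measure_UNIV: "emeasure word_measure UNIV = ennreal total_mass"
proof -
  have "emeasure word_measure UNIV = (\<integral>\<^sup>+ w. (\<Sum>R | distinct R. of_bool (types w =
      R)) \<partial>word_measure)"
  proof -
    have "(\<Sum>R | distinct R. of_bool (types w = R)) = (1 :: ennreal)" for w :: "'c option list"
    proof -
      have "(\<Sum>R | distinct R. of_bool (types w = R)) = (\<Sum>R\<in>{types w}. 1 :: ennreal)"
        by (rule sum.mono_neutral_cong_right) (auto simp: finite_distinct)
      then show ?thesis by simp
    qed
    then show ?thesis by simp
  qed
  also have "\<dots> = (\<Sum>R | distinct R. ennreal (mass R))"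
    by (subst nn_integral_sum) (auto simp: word_measure_types)
  also have "\<dots> = ennreal total_mass"
    unfolding total_mass_def by (rule sum_ennreal) (auto simp: mass_nonneg)
  finally show ?thesis .
qed

lemma nn_integral_word_measure_cong:
  "(\<And>w. canonical w \<Longrightarrow> f w = g w) \<Longrightarrow> (\<integral>\<^sup>+ w. f w \<partial>word_measure) = (\<integral>\<^sup>+ w. g w \<partial>word_measure)"
  unfolding nn_integral_word_measure by (rule nn_integral_cong) auto

section \<open>Invariance of the word measure\<close>

abbreviation good_prob :: "'s \<Rightarrow> ennreal" where
  "good_prob s \<equiv> ennreal (type_rate mbar \<beta> {s} / \<Lambda>)"

lemma sum_good_prob: "(\<Sum>s\<in>UNIV. good_prob s * of_bool (P s)) =
    ennreal (type_rate mbar \<beta> {s. P s} / \<Lambda>)"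
proof -
  have "(\<Sum>s\<in>UNIV. good_prob s * of_bool (P s)) = (\<Sum>s | P s. good_prob s)"
    by (rule sum.mono_neutral_cong_right) auto
  also have "\<dots> = ennreal (\<Sum>s | P s. type_rate mbar \<beta> {s} / \<Lambda>)"
    using type_rate_nonneg(2) \<Lambda>_pos by (intro sum_ennreal) auto
  also have "(\<Sum>s | P s. type_rate mbar \<beta> {s} / \<Lambda>) = type_rate mbar \<beta> {s. P s} / \<Lambda>"
    by (simp add: sum_divide_distrib[symmetric] type_rate_def)
  finally show ?thesis .
qed

lemma type_rate_Diff: "S \<subseteq> T \<Longrightarrow> type_rate mbar \<beta> (T - S) = type_rate mbar \<beta> T - type_rate mbar \<beta> S"
  unfolding type_rate_def by (rule sum_diff) auto

abbreviation loss_prob :: "'c \<Rightarrow> 'c option list \<Rightarrow> 'c option list \<Rightarrow> ennreal" where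
  "loss_prob c u v \<equiv> \<Sum>s\<in>UNIV. good_prob s * of_bool (serve G s v = u \<and> oldest G s v = Some c)"

text \<open>The entry of the good itself is not yet pushed. The taken agent may have stood anywhere
  in the word, and the two recursions that follow move along its position.\<close>

definition inflow :: "'c \<Rightarrow> 'c option list \<Rightarrow> ennreal" where
  "inflow c u = (\<integral>\<^sup>+ v. loss_prob c u v \<partial>word_measure)"

text \<open>A taken agent leaves \<open>None\<close> behind, so an agent in front of the result was
  in front before and the removal happened further back.\<close>

lemma inflow_Some: "inflow c (Some b # u) = ennreal (la {b} / \<Lambda>) * inflow c u"
proof -
  have some: "loss_prob c (Some b # u) (Some d # v) = of_bool (d = b) * loss_prob c u v" for d v
  proof -
    have "of_bool (serve G s (Some d # v) = Some b # u \<and> oldest G s (Some d # v) = Some c) =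
        (of_bool (d = b) * of_bool (serve G s v = u \<and> oldest G s v = Some c) :: ennreal)" for s
      by auto
    then show ?thesis by (simp add: sum_distrib_left mult.left_commute del: serve.simps
        oldest.simps)
  qed
  have none: "loss_prob c (Some b # u) (None # v) = 0" for v by simp
  have nil: "loss_prob c (Some b # u) [] = 0" by simp
  have "inflow c (Some b # u) = (\<Sum>d\<in>UNIV. ennreal (la {d} / \<Lambda>) * (of_bool (d = b) * inflow c u))"
    unfolding inflow_def
    by (subst nn_integral_word_measure_rec) (simp only: some none nil, simp add: nn_integral_cmult)
  then show ?thesis by (simp only: sum_mult_of_bool_eq)
qed

text \<open>The front entry was either \<open>None\<close> before, with the removal further back, or
  it was the agent taken. In the second case the tail is \<open>u\<close> itself and the good is
  compatible with \<open>c\<close> but with no type in \<open>u\<close>, whence the difference of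
  the two service rates. Using \<open>push\<close> covers \<open>u = []\<close> as well, where no
  entry remains.\<close>

lemma inflow_None:
  assumes u: "canonical u"
  shows "inflow c (push None u) =
    ennreal ((\<Lambda> - mu (insert c (set (types u)))) / \<Lambda>) * inflow c u +
    ennreal (la {c} / \<Lambda> * weight u * ((mu (insert c (set (types u))) - mu (set (types u))) / \<Lambda>))"
proof -
  let ?U = "set (types u)"
  define x where "x = (mu (insert c ?U) - mu ?U) / \<Lambda>"
  have x_eq: "(\<Sum>s\<in>UNIV. good_prob s * of_bool (oldest G s u = None \<and> (s, c) \<in> G)) = ennreal x"
  proof -
    have "{s. oldest G s u = None \<and> (s, c) \<in> G} = compat_goods G (insert c ?U) - compat_goods G ?U"
      by (auto simp: oldest_eq_None_iff compat_goods_def)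
    then show ?thesis
      unfolding sum_good_prob x_def by (subst type_rate_Diff[symmetric])
          (auto simp: compat_goods_def)
  qed
  have "x \<ge> 0"
  proof -
    have "mu ?U \<le> mu (insert c ?U)" by (rule type_rate_mono) (auto simp: compat_goods_def)
    then show ?thesis using \<Lambda>_pos by (simp add: x_def)
  qed
  have some: "loss_prob c (push None u) (Some d # v) = of_bool (d = c) * (of_bool (v = u) *
      ennreal x)"
    if v: "canonical v" for d v
  proof -
    have "of_bool (serve G s (Some d # v) = push None u \<and> oldest G s (Some d # v) = Some c) =
        (of_bool (d = c) * (of_bool (v = u) * of_bool (oldest G s u = None \<and>
            (s, c) \<in> G)) :: ennreal)" for s
    proof (cases "oldest G s v = None")
      case True
      then have "serve G s v = v" using v by (rule serve_unmatched[rotated])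
      then show ?thesis using True by (cases u) auto
    next
      case False
      then show ?thesis by (cases u) auto
    qed
    then have "loss_prob c (push None u) (Some d # v) = of_bool (d = c) * (of_bool (v = u) *
        (\<Sum>s\<in>UNIV. good_prob s * of_bool (oldest G s u = None \<and> (s, c) \<in> G)))"
      by (simp add: sum_distrib_left mult.left_commute del: serve.simps oldest.simps)
    then show ?thesis by (simp only: x_eq)
  qed
  have none: "ennreal (letter_weight None v) *
      (if v = [] then 0 else loss_prob c (push None u) (None # v)) =
      ennreal ((\<Lambda> - mu (insert c ?U)) / \<Lambda>) * loss_prob c u v" if v: "canonical v" for v
  proof -
    have each: "ennreal (letter_weight None v) * (if v = [] then 0 else good_prob s *
        of_bool (serve G s (None # v) = push None u \<and> oldest G s (None # v) = Some c)) =
       ennreal ((\<Lambda> - mu (insert c ?U)) / \<Lambda>) * (good_prob s * of_bool (serve G s v = u \<and>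
           oldest G s v = Some c))" for s
    proof (cases "serve G s v = u \<and> oldest G s v = Some c")
      case True
      then have "v \<noteq> []" by auto
      \<comment> \<open>The front \<open>None\<close> is weighted by the types before the removal,
        when \<open>c\<close> was certainly among them.\<close>
      moreover have "set (types v) = insert c ?U" using set_types_serve[of G s v c] True by simp
      ultimately show ?thesis using True by (simp add: letter_weight_def)
    next
      case False
      then show ?thesis by (cases u) auto
    qed
    have "ennreal (letter_weight None v) * (if v =
        [] then 0 else loss_prob c (push None u) (None # v)) =
       (\<Sum>s\<in>UNIV. ennreal (letter_weight None v) * (if v = [] then 0 else good_prob s *
           of_bool (serve G s (None # v) = push None u \<and> oldest G s (None # v) = Some c)))"
    proof (cases "v = []")
      case False
      then show ?thesis by (simp only: if_False sum_distrib_left)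
    qed simp
    then show ?thesis by (simp only: each sum_distrib_left)
  qed
  have nil: "loss_prob c (push None u) [] = 0" by simp
  have "inflow c (push None u) = (\<Sum>d\<in>UNIV. ennreal (la {d} / \<Lambda>) * (of_bool (d = c) *
      (ennreal (weight u) * ennreal x))) +
      ennreal ((\<Lambda> - mu (insert c ?U)) / \<Lambda>) * inflow c u"
  proof -
    have "(\<integral>\<^sup>+ v. loss_prob c (push None u) (Some d # v) \<partial>word_measure) = of_bool (d = c) *
        (ennreal (weight u) * ennreal x)" for d
    proof -
      have "(\<integral>\<^sup>+ v. loss_prob c (push None u) (Some d # v) \<partial>word_measure) =
          (\<integral>\<^sup>+ v. of_bool (d = c) * (of_bool (v = u) * ennreal x) \<partial>word_measure)"
        by (rule nn_integral_word_measure_cong) (rule some)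
      then show ?thesis by (simp add: nn_integral_cmult nn_integral_word_measure_single u)
    qed
    moreover have "(\<integral>\<^sup>+ v. ennreal (letter_weight None v) *
        (if v = [] then 0 else loss_prob c (push None u) (None # v)) \<partial>word_measure) =
        ennreal ((\<Lambda> - mu (insert c ?U)) / \<Lambda>) * inflow c u"
    proof -
      have "(\<integral>\<^sup>+ v. ennreal (letter_weight None v) *
          (if v = [] then 0 else loss_prob c (push None u) (None # v)) \<partial>word_measure) =
        (\<integral>\<^sup>+ v. ennreal ((\<Lambda> - mu (insert c ?U)) / \<Lambda>) * loss_prob c u v \<partial>word_measure)"
        by (rule nn_integral_word_measure_cong) (rule none)
      then show ?thesis by (simp add: nn_integral_cmult inflow_def)
    qed
    ultimately show ?thesis
      unfolding inflow_def[of c "push None u"]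
      by (subst nn_integral_word_measure_rec) (simp only: nil, simp)
  qed
  also have "(\<Sum>d\<in>UNIV. ennreal (la {d} / \<Lambda>) * (of_bool (d = c) * (ennreal (weight u) *
      ennreal x))) =
      ennreal (la {c} / \<Lambda>) * (ennreal (weight u) * ennreal x)"
    by (rule sum_mult_of_bool_eq)
  also have "\<dots> = ennreal (la {c} / \<Lambda> * weight u * x)"
  proof -
    have "0 \<le> la {c} / \<Lambda>" using type_rate_nonneg \<Lambda>_pos by simp
    then show ?thesis using \<open>x \<ge> 0\<close> weight_nonneg[of u] by (simp only: ennreal_mult
        mult_nonneg_nonneg mult.assoc)
  qed
  finally show ?thesis by (simp add: x_def add.commute)
qed

lemma sum_good_prob_le_1: "(\<Sum>s\<in>UNIV. good_prob s * of_bool (P s)) \<le> 1"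
proof -
  have "type_rate mbar \<beta> {s. P s} \<le> type_rate mbar \<beta> UNIV" by (rule type_rate_mono) simp
  then have "type_rate mbar \<beta> {s. P s} / \<Lambda> \<le> 1"
    using type_rate_UNIV lbar_pos mbar_pos by simp
  then show ?thesis by (simp only: sum_good_prob ennreal_le_1)
qed

lemma inflow_finite: "inflow c u < \<infinity>"
proof -
  have "inflow c u \<le> (\<integral>\<^sup>+ v. 1 \<partial>word_measure)"
    unfolding inflow_def by (intro nn_integral_mono sum_good_prob_le_1)
  also have "\<dots> = ennreal total_mass" by (simp add: emeasure_word_measure_UNIV)
  finally show ?thesis by (simp add: order_le_less_trans)
qed

text \<open>Summing over the position of the lost agent telescopes, because
  \<open>\<mu>\<^bsub>S(U \<union> {c})\<^esub> - \<mu>\<^bsub>S(U)\<^esub>\<close> is the difference of the weights of \<open>None\<close> before and after.\<close>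

lemma inflow_eq: "canonical u \<Longrightarrow> inflow c u = ennreal (weight u * (la {c} / \<Lambda>))"
proof (induction u)
  case Nil
  let ?m = "mu {c}"
  have m: "?m > 0" "?m \<le> mbar" using la_less_mu[of "{c}"] type_rate_nonneg(1)[of "{c}"]
      mu_le[of "{c}"] by auto
  have l: "0 \<le> la {c} / \<Lambda>" using type_rate_nonneg \<Lambda>_pos by simp
  \<comment> \<open>Because \<open>push None [] = []\<close>, the recursion turns into a fixed-point
    equation for the empty word.\<close>
  have "inflow c [] = ennreal ((\<Lambda> - ?m) / \<Lambda>) * inflow c [] + ennreal (la {c} / \<Lambda> * (?m / \<Lambda>))"
    using inflow_None[of "[]" c] by simp
  then have "inflow c [] = ennreal (la {c} / \<Lambda> * (?m / \<Lambda>) / (1 - (\<Lambda> - ?m) / \<Lambda>))"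
  proof (rule ennreal_affine_fixpoint[OF _ inflow_finite])
    show "0 \<le> la {c} / \<Lambda> * (?m / \<Lambda>)" using l m(1) \<Lambda>_pos by (intro mult_nonneg_nonneg) auto
  qed (use m lbar_pos mbar_pos in auto)
  also have "1 - (\<Lambda> - ?m) / \<Lambda> = ?m / \<Lambda>" using \<Lambda>_pos by (simp add: diff_divide_distrib)
  also have "la {c} / \<Lambda> * (?m / \<Lambda>) / (?m / \<Lambda>) = la {c} / \<Lambda>" using m \<Lambda>_pos by simp
  finally show ?case by simp
next
  case (Cons y u)
  have l: "0 \<le> la {d} / \<Lambda>" for d using type_rate_nonneg \<Lambda>_pos by simp
  have IH: "inflow c u = ennreal (weight u * (la {c} / \<Lambda>))" using Cons by simp
  show ?case
  proof (cases y)
    case (Some b)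
    have "inflow c (y # u) = ennreal (la {b} / \<Lambda>) * ennreal (weight u * (la {c} / \<Lambda>))"
      unfolding Some inflow_Some IH ..
    also have "\<dots> = ennreal (la {b} / \<Lambda> * (weight u * (la {c} / \<Lambda>)))"
      using l weight_nonneg[of u] by (simp only: ennreal_mult mult_nonneg_nonneg)
    also have "la {b} / \<Lambda> * (weight u * (la {c} / \<Lambda>)) = weight (y # u) * (la {c} / \<Lambda>)"
      by (simp add: Some letter_weight_def)
    finally show ?thesis .
  next
    case None
    let ?m = "mu (set (types u))" and ?m' = "mu (insert c (set (types u)))"
    have m: "?m \<le> ?m'" "?m' \<le> mbar"
      by (rule type_rate_mono, auto simp: compat_goods_def)[1] (rule mu_le)
    have cu: "canonical u" using Cons.prems by simp
    have yu: "y # u = push None u" using None Cons.prems by simp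
    have "inflow c (y # u) = ennreal ((\<Lambda> - ?m') / \<Lambda>) * ennreal (weight u * (la {c} / \<Lambda>)) +
        ennreal (la {c} / \<Lambda> * weight u * ((?m' - ?m) / \<Lambda>))"
      unfolding yu inflow_None[OF cu] IH ..
    also have "\<dots> = ennreal ((\<Lambda> - ?m') / \<Lambda> * (weight u * (la {c} / \<Lambda>)) + la {c} / \<Lambda> * weight u *
        ((?m' - ?m) / \<Lambda>))"
    proof -
      have "0 \<le> (\<Lambda> - ?m') / \<Lambda>" "0 \<le> (?m' - ?m) / \<Lambda>" using m lbar_pos \<Lambda>_pos by auto
      then show ?thesis using l weight_nonneg[of u]
        by (simp only: ennreal_mult[symmetric] ennreal_plus[symmetric] mult_nonneg_nonneg)
    qed
    also have "(\<Lambda> - ?m') / \<Lambda> * (weight u * (la {c} / \<Lambda>)) + la {c} / \<Lambda> * weight u *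
        ((?m' - ?m) / \<Lambda>) =
        ((\<Lambda> - ?m') / \<Lambda> + (?m' - ?m) / \<Lambda>) * weight u * (la {c} / \<Lambda>)"
      by (simp only: distrib_right distrib_left mult_ac)
    also have "(\<Lambda> - ?m') / \<Lambda> + (?m' - ?m) / \<Lambda> = (\<Lambda> - ?m) / \<Lambda>"
      by (simp add: diff_divide_distrib)
    also have "(\<Lambda> - ?m) / \<Lambda> * weight u = weight (y # u)"
      by (simp add: None letter_weight_def)
    finally show ?thesis .
  qed
qed

text \<open>Either the good is lost and \<open>v = u\<close>, with probability
  \<open>(mbar - mu U) / \<Lambda>\<close> for the types U of \<open>u\<close>, or it takes an agent
  of some type. By \<open>inflow_eq\<close> the latter contributes \<open>lbar / \<Lambda>\<close>
  times the weight of \<open>u\<close>, and the two factors add up to the weight of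
  \<open>None\<close> in front of \<open>u\<close>.\<close>

lemma serve_inflow:
  assumes u: "canonical u"
  shows "(\<integral>\<^sup>+ v. (\<Sum>s\<in>UNIV. good_prob s * of_bool (serve G s v = u)) \<partial>word_measure) =
    ennreal (weight (None # u))"
proof -
  let ?U = "set (types u)"
  have l: "0 \<le> la {d} / \<Lambda>" for d using type_rate_nonneg \<Lambda>_pos by simp
  have un: "(\<Sum>s\<in>UNIV. good_prob s * of_bool (oldest G s u = None)) = ennreal ((mbar - mu ?U) / \<Lambda>)"
  proof -
    have "{s. oldest G s u = None} = UNIV - compat_goods G ?U" by (auto simp: oldest_eq_None_iff)
    moreover have "type_rate mbar \<beta> (UNIV - compat_goods G ?U) = mbar - mu ?U"
      by (subst type_rate_Diff) (auto simp: type_rate_UNIV)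
    ultimately show ?thesis by (simp only: sum_good_prob)
  qed
  have split: "(\<Sum>s\<in>UNIV. good_prob s * of_bool (serve G s v = u)) =
      of_bool (v = u) * (\<Sum>s\<in>UNIV. good_prob s * of_bool (oldest G s u = None)) +
      (\<Sum>c\<in>UNIV. loss_prob c u v)" if v: "canonical v" for v
  proof -
    have "good_prob s * of_bool (serve G s v = u) = of_bool (v = u) *
        (good_prob s * of_bool (oldest G s u = None)) +
       (\<Sum>c\<in>UNIV. good_prob s * of_bool (serve G s v = u \<and> oldest G s v = Some c))" for s
    proof (cases "oldest G s v")
      case None
      then show ?thesis using serve_unmatched[OF v None] by auto
    next
      case (Some c)
      have "(\<Sum>c\<in>UNIV. good_prob s * of_bool (serve G s v = u \<and> oldest G s v = Some c)) =
          (\<Sum>d\<in>{c}. good_prob s * of_bool (serve G s v = u))"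
        by (rule sum.mono_neutral_cong_right) (auto simp: Some)
      then show ?thesis using Some by auto
    qed
    then have "(\<Sum>s\<in>UNIV. good_prob s * of_bool (serve G s v = u)) = (\<Sum>s\<in>UNIV. of_bool (v = u) *
        (good_prob s * of_bool (oldest G s u = None)) +
       (\<Sum>c\<in>UNIV. good_prob s * of_bool (serve G s v = u \<and> oldest G s v = Some c)))"
      by (intro sum.cong) auto
    also have "\<dots> = of_bool (v = u) * (\<Sum>s\<in>UNIV. good_prob s * of_bool (oldest G s u = None)) +
      (\<Sum>s\<in>UNIV. \<Sum>c\<in>UNIV. good_prob s * of_bool (serve G s v = u \<and> oldest G s v = Some c))"
      by (simp only: sum.distrib sum_distrib_left)
    also have "(\<Sum>s\<in>UNIV. \<Sum>c\<in>UNIV. good_prob s * of_bool (serve G s v = u \<and> oldest G s v = Some c)) =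
        (\<Sum>c\<in>UNIV. loss_prob c u v)"
      by (rule sum.swap)
    finally show ?thesis .
  qed
  have "(\<integral>\<^sup>+ v. (\<Sum>s\<in>UNIV. good_prob s * of_bool (serve G s v = u)) \<partial>word_measure) =
      (\<integral>\<^sup>+ v. of_bool (v = u) * ennreal ((mbar - mu ?U) / \<Lambda>) +
        (\<Sum>c\<in>UNIV. loss_prob c u v) \<partial>word_measure)"
    by (rule nn_integral_word_measure_cong) (simp only: split un)
  also have "\<dots> = ennreal (weight u) * ennreal ((mbar - mu ?U) / \<Lambda>) + (\<Sum>c\<in>UNIV. inflow c u)"
    unfolding inflow_def by (simp add: nn_integral_add nn_integral_sum
        nn_integral_word_measure_single[OF u])
  also have "(\<Sum>c\<in>UNIV. inflow c u) = (\<Sum>c\<in>UNIV. ennreal (weight u * (la {c} / \<Lambda>)))"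
    by (simp only: inflow_eq[OF u])
  also have "\<dots> = ennreal (\<Sum>c\<in>UNIV. weight u * (la {c} / \<Lambda>))"
    using l weight_nonneg[of u] by (intro sum_ennreal) (simp only: mult_nonneg_nonneg)
  also have "(\<Sum>c\<in>UNIV. weight u * (la {c} / \<Lambda>)) = weight u * (lbar / \<Lambda>)"
    using type_rate_UNIV(1) by (simp add: sum_distrib_left[symmetric]
        sum_divide_distrib[symmetric] type_rate_def)
  also have "ennreal (weight u) * ennreal ((mbar - mu ?U) / \<Lambda>) + ennreal (weight u * (lbar / \<Lambda>)) =
      ennreal (weight u * ((mbar - mu ?U) / \<Lambda>) + weight u * (lbar / \<Lambda>))"
  proof -
    have "0 \<le> (mbar - mu ?U) / \<Lambda>" "0 \<le> lbar / \<Lambda>" using mu_le[of ?U] \<Lambda>_pos lbar_pos by auto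
    then show ?thesis using weight_nonneg[of u]
      by (simp only: ennreal_mult[symmetric] ennreal_plus[symmetric] mult_nonneg_nonneg)
  qed
  also have "weight u * ((mbar - mu ?U) / \<Lambda>) + weight u * (lbar / \<Lambda>) = weight (None # u)"
    by (simp add: letter_weight_def distrib_left[symmetric] add_divide_distrib[symmetric]
        algebra_simps)
  finally show ?thesis .
qed

text \<open>A word with an agent in front can only be reached from its tail, by the arrival of that
  agent. Every other canonical word, the empty one included, has the form \<open>push None u\<close>
  and is reached through a good, so \<open>serve_inflow\<close> applies.\<close>

lemma word_measure_invariant:
  "(\<integral>\<^sup>+ v. (\<Sum>i\<in>UNIV. ennreal (pmf item_pmf i) * of_bool (arrive G v i = w)) \<partial>word_measure) =
     (if canonical w then ennreal (weight w) else 0)"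
proof (cases "canonical w")
  case False
  have "(\<integral>\<^sup>+ v. (\<Sum>i\<in>UNIV. ennreal (pmf item_pmf i) * of_bool (arrive G v i = w)) \<partial>word_measure) =
      (\<integral>\<^sup>+ v. 0 \<partial>word_measure)"
  proof (rule nn_integral_word_measure_cong)
    fix v :: "'c option list" assume "canonical v"
    then have "arrive G v i \<noteq> w" for i :: "('c, 's) item" using canonical_arrive False by blast
    then show "(\<Sum>i\<in>UNIV. ennreal (pmf item_pmf i) * of_bool (arrive G v i = w)) = 0" by simp
  qed
  then show ?thesis using False by simp
next
  case True
  have split: "(\<Sum>i\<in>UNIV. ennreal (pmf item_pmf i) * of_bool (arrive G v i = w)) =
      (\<Sum>c\<in>UNIV. ennreal (la {c} / \<Lambda>) * of_bool (Some c # v = w)) +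
      (\<Sum>s\<in>UNIV. good_prob s * of_bool (push None (serve G s v) = w))" for v
    unfolding UNIV_Plus_UNIV[symmetric]
    by (subst sum.Plus) (auto simp: pmf_item_Inl pmf_item_Inr)
  show ?thesis
  proof (cases "\<exists>b u. w = Some b # u")
    case True': True
    then obtain b u where w: "w = Some b # u" by auto
    have u: "canonical u" using True w by simp
    have "(\<Sum>c\<in>UNIV. ennreal (la {c} / \<Lambda>) * of_bool (Some c # v = w)) + (\<Sum>s\<in>UNIV. good_prob s *
        of_bool (push None (serve G s v) = w)) =
        of_bool (v = u) * ennreal (la {b} / \<Lambda>)" for v
    proof -
      have "(\<Sum>c\<in>UNIV. ennreal (la {c} / \<Lambda>) * of_bool (Some c # v = w)) =
          (\<Sum>c\<in>{b}. ennreal (la {c} / \<Lambda>) * of_bool (v = u))"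
        by (rule sum.mono_neutral_cong_right) (auto simp: w)
      then show ?thesis by (auto simp: w)
    qed
    then have "(\<integral>\<^sup>+ v. (\<Sum>i\<in>UNIV. ennreal (pmf item_pmf i) * of_bool (arrive G v i =
        w)) \<partial>word_measure) = ennreal (weight u) * ennreal (la {b} / \<Lambda>)"
      by (simp only: split nn_integral_word_measure_single[OF u])
    also have "\<dots> = ennreal (la {b} / \<Lambda> * weight u)"
      using weight_nonneg[of u] type_rate_nonneg(1)[of "{b}"] \<Lambda>_pos
      by (subst ennreal_mult[symmetric]) (auto simp: mult.commute)
    finally show ?thesis using True w by (simp add: letter_weight_def)
  next
    case False
    then obtain u where w: "w = push None u" and u: "canonical u"
    proof (cases w)
      case (Cons y u)
      then have "y = None" using False by (cases y) auto
      then show ?thesis using that[of u] Cons True by simp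
    qed (use that[of "[]"] in simp)
    have "(\<Sum>c\<in>UNIV. ennreal (la {c} / \<Lambda>) * of_bool (Some c # v = w)) = 0" for v
      using False by auto
    moreover have "push None x = w \<longleftrightarrow> x = u" for x
      by (auto simp: w)
    ultimately have "(\<integral>\<^sup>+ v. (\<Sum>i\<in>UNIV. ennreal (pmf item_pmf i) * of_bool (arrive G v i =
        w)) \<partial>word_measure) = ennreal (weight (None # u))"
      by (simp only: split serve_inflow[OF u] add_0)
    \<comment> \<open>For \<open>u = []\<close> the two words differ, but their weights agree
      because \<open>mu {} = 0\<close> gives \<open>None\<close> the weight 1.\<close>
    moreover have "weight (None # u) = weight w"
      using w \<Lambda>_pos by (auto simp: letter_weight_def)
    ultimately show ?thesis using True by simp
  qed
qed

section \<open>The normalized invariant law and its reset words\<close>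

definition word_pmf :: "'c option list pmf" where
  "word_pmf = embed_pmf (\<lambda>w. if canonical w then weight w / total_mass else 0)"

lemma pmf_word: "pmf word_pmf w = (if canonical w then weight w / total_mass else 0)"
  unfolding word_pmf_def
proof (rule pmf_embed_pmf)
  show "0 \<le> (if canonical w then weight w / total_mass else 0)" for w :: "'c option list"
    using weight_nonneg[of w] total_mass_ge_1 by simp
  have "(\<integral>\<^sup>+ w. ennreal (if canonical w then weight w / total_mass else 0) \<partial>count_space UNIV) =
      (\<integral>\<^sup>+ w. ennreal (1 / total_mass) \<partial>word_measure)"
    unfolding nn_integral_word_measure
    using total_mass_ge_1 by (intro nn_integral_cong) (auto simp: weight_nonneg
        ennreal_mult[symmetric])
  also have "\<dots> = 1"
    using total_mass_ge_1 by (simp add: emeasure_word_measure_UNIV ennreal_mult[symmetric])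
  finally show "(\<integral>\<^sup>+ w. ennreal (if canonical w then weight w / total_mass else 0) \<partial>count_space
      UNIV) = 1" .
qed

lemma nn_integral_word_pmf:
  "(\<integral>\<^sup>+ w. f w \<partial>word_pmf) = ennreal (1 / total_mass) * (\<integral>\<^sup>+ w. f w \<partial>word_measure)"
proof -
  have "(\<integral>\<^sup>+ w. f w \<partial>word_pmf) = (\<integral>\<^sup>+ w. ennreal (1 / total_mass) * f w \<partial>word_measure)"
    unfolding nn_integral_word_measure nn_integral_measure_pmf
    using total_mass_ge_1
    by (intro nn_integral_cong) (auto simp: pmf_word weight_nonneg ennreal_mult[symmetric]
        mult.assoc[symmetric])
  then show ?thesis by (simp add: nn_integral_cmult)
qed

lemma prob_word_pmf:
  assumes "(\<integral>\<^sup>+ w. of_bool (P w) \<partial>word_measure) = ennreal r" "r \<ge> 0"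
  shows "measure_pmf.prob word_pmf {w. P w} = r / total_mass"
proof -
  have "ennreal (measure_pmf.prob word_pmf {w. P w}) = (\<integral>\<^sup>+ w. indicator {w. P w} w \<partial>word_pmf)"
    by (simp add: measure_pmf.emeasure_eq_measure)
  also have "\<dots> = ennreal (1 / total_mass) * ennreal r"
  proof -
    have ind: "indicator {w. P w} = (\<lambda>w. of_bool (P w) :: ennreal)" by (auto simp: fun_eq_iff)
    show ?thesis unfolding nn_integral_word_pmf assms(1)[symmetric] ind ..
  qed
  also have "\<dots> = ennreal (r / total_mass)"
    using total_mass_ge_1 assms(2) by (simp add: ennreal_mult[symmetric])
  finally show ?thesis using total_mass_ge_1 assms(2) by simp
qed

sublocale chain: driven_chain "arrive G" item_pmf word_pmf "[]"
proof
  show "bind_pmf word_pmf (\<lambda>x. map_pmf (arrive G x) item_pmf) = word_pmf"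
  proof (rule pmf_eqI)
    fix w
    have "pmf (map_pmf (arrive G v) item_pmf) w = (\<Sum>i\<in>UNIV. pmf item_pmf i *
        of_bool (arrive G v i = w))" for v
    proof -
      have "pmf (map_pmf (arrive G v) item_pmf) w = measure_pmf.prob item_pmf {i. arrive G v i = w}"
        by (simp add: pmf_map vimage_def)
      also have "\<dots> = (\<Sum>i | arrive G v i = w. pmf item_pmf i)"
        by (rule measure_measure_pmf_finite) simp
      also have "\<dots> = (\<Sum>i\<in>UNIV. pmf item_pmf i * of_bool (arrive G v i = w))"
        by (rule sum.mono_neutral_cong_left) auto
      finally show ?thesis .
    qed
    then have "ennreal (pmf (map_pmf (arrive G v) item_pmf) w) =
        (\<Sum>i\<in>UNIV. ennreal (pmf item_pmf i) * of_bool (arrive G v i = w))" for v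
    proof -
      have "ennreal (pmf item_pmf i) * of_bool (arrive G v i = w) = ennreal (pmf item_pmf i *
          of_bool (arrive G v i = w))" for i
        by (cases "arrive G v i = w") auto
      then show ?thesis using \<open>\<And>v. pmf (map_pmf (arrive G v) item_pmf) w = _\<close>
        by (simp only:) (rule sum_ennreal[symmetric], simp)
    qed
    then have "ennreal (pmf (bind_pmf word_pmf (\<lambda>x. map_pmf (arrive G x) item_pmf)) w) =
        ennreal (1 / total_mass) * (if canonical w then ennreal (weight w) else 0)"
      by (simp only: ennreal_pmf_bind nn_integral_word_pmf word_measure_invariant)
    also have "\<dots> = ennreal (pmf word_pmf w)"
      using total_mass_ge_1 by (simp add: pmf_word weight_nonneg ennreal_mult[symmetric])
    finally show "pmf (bind_pmf word_pmf (\<lambda>x. map_pmf (arrive G x) item_pmf)) w = pmf word_pmf w"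
      by simp
  qed
  show "[] \<in> set_pmf word_pmf"
    using total_mass_ge_1 by (simp add: set_pmf_iff pmf_word)
  fix F :: "'c option list set" assume "finite F"
  define T where "T = {s. pmf \<beta> s > 0}"
  \<comment> \<open>Stability for the singleton \<open>{c}\<close> forces a compatible good type of
    positive rate.\<close>
  have T: "\<exists>s\<in>T. (s, c) \<in> G" for c
  proof (rule ccontr)
    assume "\<not> (\<exists>s\<in>T. (s, c) \<in> G)"
    then have "mu {c} = 0"
      unfolding type_rate_def by (intro sum.neutral) (auto simp: compat_goods_def T_def pmf_nonneg
          antisym_conv2 not_less intro: antisym)
    then show False using la_less_mu[of "{c}"] type_rate_nonneg(1)[of "{c}"] by simp
  qed
  have T': "Inr ` T \<subseteq> set_pmf item_pmf"
    using mbar_pos \<Lambda>_pos by (auto simp: T_def set_pmf_iff pmf_item_Inr type_rate_def)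
  have goods: "foldl (arrive G) [] ss = []" if "set ss \<subseteq> Inr ` T" for ss
    using that by (induction ss) auto
  \<comment> \<open>Words that empty the individual states are concatenated; a state emptied earlier
    stays empty under further goods.\<close>
  from \<open>finite F\<close> have "\<exists>is. set is \<subseteq> Inr ` T \<and> (\<forall>x\<in>F. foldl (arrive G) x is = [])"
  proof induction
    case empty
    show ?case by (intro exI[of _ "[]"]) simp
  next
    case (insert x F)
    then obtain ss where ss: "set ss \<subseteq> Inr ` T" "\<forall>x\<in>F. foldl (arrive G) x ss = []" by auto
    obtain ss' where ss': "set ss' \<subseteq> Inr ` T" "foldl (arrive G) (foldl (arrive G) x ss) ss' = []"
      using ex_serve_all[of T G "foldl (arrive G) x ss"] T by blast
    show ?case
      by (rule exI[of _ "ss @ ss'"]) (use ss ss' goods[OF ss'(1)] in auto)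
  qed
  then show "\<exists>is. set is \<subseteq> set_pmf item_pmf \<and> (\<forall>x\<in>F. foldl (arrive G) x is = [])"
    using T' by (meson order_trans)
qed

end

section \<open>Sums of geometric gaps\<close>

lemma geometric1_pmf_unfold:
  assumes "0 < r" "r \<le> 1"
  shows "geometric1_pmf r =
    bind_pmf (bernoulli_pmf r) (\<lambda>b. if b then return_pmf 1 else map_pmf Suc (geometric1_pmf r))"
proof -
  have "geometric1_pmf r = map_pmf Suc (bind_pmf (bernoulli_pmf r)
      (\<lambda>b. if b then return_pmf 0 else map_pmf Suc (geometric_pmf r)))"
    unfolding geometric1_pmf_def by (subst geometric_bind_pmf_unfold) (use assms in auto)
  also have "\<dots> = bind_pmf (bernoulli_pmf r) (\<lambda>b. if b then return_pmf 1 else map_pmf Suc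
      (geometric1_pmf r))"
    unfolding map_bind_pmf by (intro bind_pmf_cong) (auto simp: geometric1_pmf_def)
  finally show ?thesis .
qed

definition add_geometric :: "real \<Rightarrow> nat pmf \<Rightarrow> nat pmf" where
  "add_geometric r N = bind_pmf (geometric1_pmf r) (\<lambda>y. map_pmf ((+) y) N)"

lemma add_geometric_unfold:
  assumes "0 < r" "r \<le> 1"
  shows "add_geometric r N = bind_pmf (bernoulli_pmf r)
    (\<lambda>b. if b then map_pmf Suc N else map_pmf Suc (add_geometric r N))"
proof -
  let ?X = "\<lambda>M. bind_pmf M (\<lambda>y. map_pmf ((+) y) N)"
  have eq: "?X (if b then return_pmf 1 else map_pmf Suc (geometric1_pmf r)) =
      (if b then map_pmf Suc N else map_pmf Suc (?X (geometric1_pmf r)))" for b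
  proof (cases b)
    case True
    have "(+) 1 = Suc" by auto
    then show ?thesis using True by (simp add: bind_return_pmf)
  next
    case False
    have "(+) (Suc y) = Suc \<circ> (+) y" for y by auto
    then have "map_pmf ((+) (Suc y)) N = map_pmf Suc (map_pmf ((+) y) N)" for y
      by (simp only: pmf.map_comp)
    then show ?thesis using False by (simp add: map_bind_pmf bind_map_pmf)
  qed
  have "?X (geometric1_pmf r) = ?X (bind_pmf (bernoulli_pmf r) (\<lambda>b. if b then return_pmf 1 else
      map_pmf Suc (geometric1_pmf r)))"
    by (rule arg_cong[of _ _ ?X], rule geometric1_pmf_unfold[OF assms])
  then show ?thesis
    unfolding add_geometric_def by (simp only: bind_assoc_pmf eq)
qed

lemma pmf_map_Suc: "pmf (map_pmf Suc N) (Suc d) = pmf N d" "pmf (map_pmf Suc N) 0 = 0"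
proof -
  show "pmf (map_pmf Suc N) (Suc d) = pmf N d" by (rule pmf_map_inj') simp
  show "pmf (map_pmf Suc N) 0 = 0" by (auto simp: pmf_eq_0_set_pmf)
qed

text \<open>Conditioning on the first trial gives a one-step recursion in \<open>d\<close>.
  Prepending a letter to a word has the same form, with success meaning that the letter begins the
  current gap.\<close>

lemma pmf_add_geometric:
  assumes "0 < r" "r \<le> 1"
  shows "pmf (add_geometric r N) (Suc d) = (1 - r) * pmf (add_geometric r N) d + r * pmf N d"
    and "pmf (add_geometric r N) 0 = 0"
proof -
  have r: "0 \<le> r" "r \<le> 1" using assms by auto
  show "pmf (add_geometric r N) (Suc d) = (1 - r) * pmf (add_geometric r N) d + r * pmf N d"
    by (subst add_geometric_unfold[OF assms], subst pmf_bind, subst integral_bernoulli_pmf)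
      (use r in \<open>auto simp: pmf_map_Suc\<close>)
  show "pmf (add_geometric r N) 0 = 0"
    by (subst add_geometric_unfold[OF assms], subst pmf_bind, subst integral_bernoulli_pmf)
      (use r in \<open>auto simp: pmf_map_Suc\<close>)
qed

section \<open>The delay given the types in the backlog\<close>

context fcfs_rates
begin

abbreviation geo :: "'c list \<Rightarrow> nat \<Rightarrow> nat \<Rightarrow> real" where
  "geo \<equiv> geometric_sum_prob lbar mbar \<alpha> \<beta> G"

definition geo_pmf :: "'c list \<Rightarrow> nat \<Rightarrow> nat pmf" where
  "geo_pmf Cs l = map_pmf (\<lambda>D. \<Sum>h = l..length Cs. D h)
     (Pi_pmf {1..length Cs} 0 (\<lambda>h. geometric1_pmf (net_rate lbar mbar \<alpha> \<beta> G Cs h / \<Lambda>)))"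

lemma geo_eq: "geo Cs l d = pmf (geo_pmf Cs l) d"
  by (simp add: geometric_sum_prob_def geo_pmf_def pmf_map vimage_def)

text \<open>The parameter of the gap \<open>h\<close> depends on the first \<open>h\<close> types
  only, so a new last type keeps the earlier gaps and adds one independent gap. The bound on
  \<open>l\<close> admits the empty sum over \<open>Cs\<close>.\<close>

lemma geo_pmf_snoc:
  assumes l: "l \<le> Suc (length Cs)"
  shows "geo_pmf (Cs @ [c]) l = add_geometric (gap_rate (insert c (set Cs))) (geo_pmf Cs l)"
proof -
  let ?k = "length Cs"
  let ?p = "\<lambda>h. geometric1_pmf (net_rate lbar mbar \<alpha> \<beta> G Cs h / \<Lambda>)"
  let ?p' = "\<lambda>h. geometric1_pmf (net_rate lbar mbar \<alpha> \<beta> G (Cs @ [c]) h / \<Lambda>)"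
  have last: "?p' (Suc ?k) = geometric1_pmf (gap_rate (insert c (set Cs)))"
    by (simp add: net_rate_def gap_rate_def)
  have "Pi_pmf {1..Suc ?k} 0 ?p' = Pi_pmf (insert (Suc ?k) {1..?k}) 0 ?p'"
    by (simp add: atLeastAtMostSuc_conv)
  also have "\<dots> = map_pmf (\<lambda>(y, D). D(Suc ?k := y)) (pair_pmf (?p' (Suc ?k)) (Pi_pmf {1..?k} 0 ?p'))"
    by (rule Pi_pmf_insert) auto
  also have "Pi_pmf {1..?k} 0 ?p' = Pi_pmf {1..?k} 0 ?p"
    by (rule Pi_pmf_cong) (auto simp: net_rate_def)
  finally have Pi: "Pi_pmf {1..Suc ?k} 0 ?p' =
      map_pmf (\<lambda>(y, D). D(Suc ?k := y)) (pair_pmf (?p' (Suc ?k)) (Pi_pmf {1..?k} 0 ?p))" .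
  have sum: "(\<Sum>h = l..Suc ?k. (D(Suc ?k := y)) h) = y + (\<Sum>h = l..?k. D h)" for D :: "nat \<Rightarrow> nat"
      and y
  proof -
    have "(\<Sum>h = l..?k. (D(Suc ?k := y)) h) = (\<Sum>h = l..?k. D h)" by (rule sum.cong) auto
    then show ?thesis using l by (simp add: add.commute)
  qed
  have comp: "(\<lambda>D. \<Sum>h = l..Suc ?k. D h) \<circ> (\<lambda>(y, D). D(Suc ?k := y)) =
      (\<lambda>(y, D). y + (\<Sum>h = l..?k. D h :: nat))"
    by (rule ext) (simp only: o_def split_beta sum)
  have "geo_pmf (Cs @ [c]) l = map_pmf (\<lambda>(y, D). y +
      (\<Sum>h = l..?k. D h)) (pair_pmf (?p' (Suc ?k)) (Pi_pmf {1..?k} 0 ?p))"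
    unfolding geo_pmf_def
    by (simp only: length_append list.size add_0 add_Suc_right add_0_right Pi pmf.map_comp comp)
  then show ?thesis
    unfolding last add_geometric_def geo_pmf_def pair_pmf_def
    by (simp add: map_bind_pmf bind_map_pmf pmf.map_comp o_def map_pmf_def[symmetric])
qed

lemma geo_snoc:
  assumes l: "l \<le> Suc (length Cs)"
  shows "geo (Cs @ [c]) l (Suc d) =
      (1 - gap_rate (insert c (set Cs))) * geo (Cs @ [c]) l d + gap_rate (insert c (set Cs)) *
          geo Cs l d"
    and "geo (Cs @ [c]) l 0 = 0"
  using gap_rate_pos[of "insert c (set Cs)"] gap_rate_le_1[of "insert c (set Cs)"]
  by (simp_all add: geo_eq geo_pmf_snoc[OF l] pmf_add_geometric)

lemma geo_beyond: "geo Cs (Suc (length Cs)) d = of_bool (d = 0)"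
  by (simp add: geo_eq geo_pmf_def map_pmf_const pmf_return indicator_def)

text \<open>For compatible \<open>s\<close> and \<open>c\<close>, this is the conditional
  probability, given first appearances \<open>Cs\<close>, that a good of type \<open>s\<close> takes
  an agent of type \<open>c\<close> with delay \<open>d\<close>. When \<open>Cs\<close> is distinct,
  at most one \<open>l\<close> contributes.\<close>

definition delay_prob :: "'s \<Rightarrow> 'c \<Rightarrow> 'c list \<Rightarrow> nat \<Rightarrow> real" where
  "delay_prob s c Cs d = (\<Sum>l = 1..length Cs.
     of_bool (Cs ! (l - 1) = c \<and> s \<notin> compat_goods G (set (take (l - 1) Cs))) * geo Cs l d)"

lemma delay_prob_nonneg: "delay_prob s c Cs d \<ge> 0"
  unfolding delay_prob_def geometric_sum_prob_def by (intro sum_nonneg mult_nonneg_nonneg) auto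

text \<open>The extra indicator is the summand \<open>l = length Cs + 1\<close>: the agent taken has
  the new type \<open>b\<close>, and the sum of older gaps is empty, which explains
  \<open>d = 0\<close>.\<close>

lemma delay_prob_snoc:
  "delay_prob s c (Cs @ [b]) (Suc d) =
     (1 - gap_rate (insert b (set Cs))) * delay_prob s c (Cs @ [b]) d +
     gap_rate (insert b (set Cs)) *
       (delay_prob s c Cs d + of_bool (b = c \<and> s \<notin> compat_goods G (set Cs) \<and> d = 0))"
proof -
  let ?g = "gap_rate (insert b (set Cs))" and ?k = "length Cs"
  let ?b = "\<lambda>l. of_bool ((Cs @ [b]) ! (l - 1) = c \<and>
      s \<notin> compat_goods G (set (take (l - 1) (Cs @ [b])))) :: real"
  have "delay_prob s c (Cs @ [b]) (Suc d) =
      (\<Sum>l = 1..Suc ?k. (1 - ?g) * (?b l * geo (Cs @ [b]) l d) + ?g * (?b l * geo Cs l d))"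
    unfolding delay_prob_def by (intro sum.cong) (auto simp: geo_snoc algebra_simps)
  also have "\<dots> = (1 - ?g) * delay_prob s c (Cs @ [b]) d + ?g * (\<Sum>l = 1..Suc ?k. ?b l * geo Cs l d)"
    by (simp only: sum.distrib sum_distrib_left delay_prob_def length_append list.size add_0
        add_Suc_right add_0_right)
  also have "(\<Sum>l = 1..Suc ?k. ?b l * geo Cs l d) = (\<Sum>l = 1..?k. ?b l * geo Cs l d) + ?b (Suc ?k) *
      geo Cs (Suc ?k) d"
    by simp
  also have "(\<Sum>l = 1..?k. ?b l * geo Cs l d) = delay_prob s c Cs d"
    unfolding delay_prob_def by (intro sum.cong) (auto simp: nth_append)
  also have "?b (Suc ?k) * geo Cs (Suc ?k) d = of_bool (b = c \<and> s \<notin> compat_goods G (set Cs) \<and> d =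
      0)"
    by (simp add: geo_beyond)
  finally show ?thesis .
qed

lemma delay_prob_0: "delay_prob s c Cs 0 = 0"
proof (cases Cs rule: rev_cases)
  case (snoc Cs b)
  then show ?thesis unfolding delay_prob_def by (intro sum.neutral) (auto simp: geo_snoc)
qed (simp add: delay_prob_def)

lemma delay_prob_incompatible:
  assumes "(s, c) \<in> G" "s \<notin> compat_goods G (set Cs)"
  shows "delay_prob s c Cs d = 0"
  unfolding delay_prob_def
proof (intro sum.neutral ballI)
  fix l assume "l \<in> {1..length Cs}"
  then have "Cs ! (l - 1) \<in> set Cs" by auto
  then have "Cs ! (l - 1) \<noteq> c" using assms by (auto simp: compat_goods_def)
  then show "of_bool (Cs ! (l - 1) = c \<and> s \<notin> compat_goods G (set (take (l - 1) Cs))) *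
      geo Cs l d = 0"
    by simp
qed

text \<open>A letter in front raises the delay by one, and it can be the agent taken only if nothing
  behind it is compatible. So both sides obey the same recursion, in the delay and in the list of
  types.\<close>

lemma word_measure_delay:
  assumes sc: "(s, c) \<in> G" and R: "distinct R"
  shows "(\<integral>\<^sup>+ w. of_bool (types w = R \<and> oldest G s w = Some c \<and> delay G s w = d) \<partial>word_measure) =
     ennreal (mass R * delay_prob s c (rev R) d)"
  using R
proof (induction R arbitrary: d)
  case Nil
  then show ?case by (simp add: types_Nil_integral delay_prob_def)
next
  case (Cons b R)
  let ?g = "gap_rate (set (b # R))"
  have nn: "0 \<le> 1 - ?g" "0 \<le> la {b} / \<Lambda>"
    using gap_rate_le_1 type_rate_nonneg \<Lambda>_pos by auto
  have R: "distinct R" using Cons.prems by simp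
  show ?case
  proof (induction d)
    case 0
    have "(\<integral>\<^sup>+ w. of_bool (types w = b # R \<and> oldest G s w = Some c \<and> delay G s w =
        0) \<partial>word_measure) = (\<integral>\<^sup>+ w. 0 \<partial>word_measure)"
      by (rule nn_integral_cong) (auto simp: delay_eq_0_iff)
    then show ?case by (simp add: delay_prob_0)
  next
    case (Suc d)
    let ?D = "\<lambda>R d. \<integral>\<^sup>+ w. of_bool (types w = R \<and> oldest G s w = Some c \<and> delay G s w =
        d) \<partial>word_measure"
    have old: "oldest G s w = None \<longleftrightarrow> s \<notin> compat_goods G (set S)" if "types w = S" for w S
      using oldest_eq_None_iff[of G s w] that by simp
    have rec: "?D (b # R) (Suc d) = ennreal (1 - ?g) * ?D (b # R) d +
        ennreal (la {b} / \<Lambda>) * (\<integral>\<^sup>+ w. of_bool (types w = R \<and> oldest G s (Some b # w) = Some c \<and>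
            delay G s (Some b # w) = Suc d) \<partial>word_measure)"
    proof (rule nn_integral_types_rec[OF Cons.prems])
      fix w x assume w: "types w = b # R" and x: "x \<in> insert None (Some ` set (b # R))"
      show "(oldest G s (x # w) = Some c \<and> delay G s (x # w) = Suc d) \<longleftrightarrow> (oldest G s w = Some c \<and>
          delay G s w = d)"
      proof (cases "oldest G s w = None")
        case True
        \<comment> \<open>If no waiting type is compatible, neither is a new letter of one of these
          types, so the good stays unmatched on both sides.\<close>
        then have "s \<notin> compat_goods G (set (b # R))" using old[OF w] by simp
        then have "oldest G s [x] = None" using x by (auto simp: compat_goods_def)
        then show ?thesis using True by auto
      qed auto
    qed
    have new: "(\<integral>\<^sup>+ w. of_bool (types w = R \<and> oldest G s (Some b # w) = Some c \<and>
        delay G s (Some b # w) = Suc d) \<partial>word_measure) =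
        ennreal (mass R * (delay_prob s c (rev R) d + of_bool (b = c \<and>
            s \<notin> compat_goods G (set R) \<and> d = 0)))"
    proof (cases "s \<in> compat_goods G (set R)")
      case True
      have "(\<integral>\<^sup>+ w. of_bool (types w = R \<and> oldest G s (Some b # w) = Some c \<and>
          delay G s (Some b # w) = Suc d) \<partial>word_measure) = ?D R d"
        using True old by (intro nn_integral_cong) auto
      then show ?thesis using True Cons.IH[OF R] by simp
    next
      \<comment> \<open>No type of \<open>R\<close> is compatible, so only the new agent
        \<open>b\<close> can be taken; it stands in front, its delay is 1 and
        \<open>d = 0\<close>.\<close>
      case False
      have "(\<integral>\<^sup>+ w. of_bool (types w = R \<and> oldest G s (Some b # w) = Some c \<and>
          delay G s (Some b # w) = Suc d) \<partial>word_measure) =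
          (\<integral>\<^sup>+ w. of_bool (b = c \<and> d = 0) * of_bool (types w = R) \<partial>word_measure)"
        using False old sc by (intro nn_integral_cong) auto
      also have "\<dots> = of_bool (b = c \<and> d = 0) * ennreal (mass R)"
        by (simp add: nn_integral_cmult word_measure_types[OF R] del: of_bool_conj)
      finally show ?thesis using False delay_prob_incompatible[OF sc, of "rev R"] by auto
    qed
    let ?E = "delay_prob s c (rev (b # R)) d" and ?E' = "delay_prob s c (rev R) d +
        of_bool (b = c \<and> s \<notin> compat_goods G (set R) \<and> d = 0)"
    have E': "?E' \<ge> 0" using delay_prob_nonneg by simp
    have "?D (b # R) (Suc d) = ennreal (1 - ?g) * ennreal (mass (b # R) * ?E) +
        ennreal (la {b} / \<Lambda>) * ennreal (mass R * ?E')"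
      unfolding rec new Suc.IH ..
    also have "\<dots> = ennreal ((1 - ?g) * (mass (b # R) * ?E) + la {b} / \<Lambda> * (mass R * ?E'))"
      using nn mass_nonneg delay_prob_nonneg E'
      by (simp only: ennreal_mult[symmetric] ennreal_plus[symmetric] mult_nonneg_nonneg)
    also have "(1 - ?g) * (mass (b # R) * ?E) + la {b} / \<Lambda> * (mass R * ?E') =
        mass (b # R) * ((1 - ?g) * ?E + ?g * ?E')"
    proof -
      have "?g * mass (b # R) = la {b} / \<Lambda> * mass R"
        using gap_rate_pos[of "set (b # R)"] by simp
      then have "la {b} / \<Lambda> * (mass R * ?E') = mass (b # R) * (?g * ?E')"
        by (simp only: mult.assoc[symmetric]) (simp only: mult_ac)
      then show ?thesis by (simp only: distrib_left mult.left_commute)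
    qed
    also have "(1 - ?g) * ?E + ?g * ?E' = delay_prob s c (rev (b # R)) (Suc d)"
      by (simp add: delay_prob_snoc)
    finally show ?case .
  qed
qed

end

section \<open>From matchings to words\<close>

lemma canonical_iff_no_trailing: "canonical w \<longleftrightarrow> no_trailing ((=) None) w"
proof (induction w)
  case (Cons x w)
  then show ?case by (cases w; cases x) auto
qed simp

text \<open>\<open>nth_default None\<close> pads a word to an infinite sequence of entries, and
  canonical words are the representatives without trailing padding.\<close>

lemma canonical_eqI:
  assumes "canonical v" "canonical w" "\<And>i. nth_default None v i = nth_default None w i"
  shows "v = w"
proof -
  have "strip_while ((=) None) v = strip_while ((=) None) w"
    using assms(3) by (subst nth_default_eq_iff[symmetric]) auto
  then show ?thesis
    using assms(1,2) by (simp add: canonical_iff_no_trailing strip_while_idem_iff)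
qed

lemma nth_default_push: "nth_default None (push x w) i =
    (case i of 0 \<Rightarrow> x | Suc j \<Rightarrow> nth_default None w j)"
  by (cases x) (auto split: nat.split)

lemma oldest_eq_None_nth:
  "oldest G s w = None \<longleftrightarrow> (\<forall>j c. nth_default None w j = Some c \<longrightarrow> (s, c) \<notin> G)"
proof -
  have "Some c \<in> set w \<longleftrightarrow> (\<exists>j. nth_default None w j = Some c)" for c
    by (auto simp: in_set_conv_nth nth_default_def split: if_splits)
  then show ?thesis by (auto simp: oldest_eq_None_iff compat_goods_def)
qed

text \<open>The FCFS rule speaks of positions and not of recursion over words; this is the form that
  can be compared with it.\<close>

lemma delay_eq_Suc_iff:
  "delay G s w = Suc i \<and> oldest G s w = Some c \<longleftrightarrow>
     nth_default None w i = Some c \<and> (s, c) \<in> G \<and>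
     (\<forall>j>i. \<forall>c'. nth_default None w j = Some c' \<longrightarrow> (s, c') \<notin> G)"
proof (induction w arbitrary: i)
  case (Cons x w)
  show ?case
  proof (cases "oldest G s w = None")
    case True
    then have no: "nth_default None w j = Some c \<Longrightarrow> (s, c) \<notin> G" for j c
      by (simp add: oldest_eq_None_nth)
    show ?thesis
    proof (cases i)
      case 0
      have "(\<forall>j>0. \<forall>c'. nth_default None (x # w) j = Some c' \<longrightarrow> (s, c') \<notin> G)"
        using no by (metis gr0_conv_Suc nth_default_Cons_Suc)
      then show ?thesis using True 0 by (cases x) auto
    next
      case (Suc k)
      then show ?thesis using True no by (cases x) auto
    qed
  next
    case False
    then obtain j d where jd: "nth_default None w j = Some d" "(s, d) \<in> G"
      by (auto simp: oldest_eq_None_nth)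
    show ?thesis
    proof (cases i)
      case 0
      have "\<exists>j>0. \<exists>c'. nth_default None (x # w) j = Some c' \<and> (s, c') \<in> G"
        using jd by (intro exI[of _ "Suc j"] exI[of _ d]) auto
      moreover have "delay G s w \<noteq> 0" using False by (simp add: delay_eq_0_iff)
      ultimately show ?thesis using False 0 by auto
    next
      case (Suc k)
      have "(\<forall>j>Suc k. \<forall>c'. nth_default None (x # w) j = Some c' \<longrightarrow> (s, c') \<notin> G) \<longleftrightarrow>
          (\<forall>j>k. \<forall>c'. nth_default None w j = Some c' \<longrightarrow> (s, c') \<notin> G)"
        by (metis Suc_less_eq2 Suc_mono nth_default_Cons_Suc)
      then show ?thesis using False Suc Cons.IH[of k] by auto
    qed
  qed
qed simp

lemma nth_default_serve:
  "nth_default None (serve G s w) i = (if delay G s w = Suc i then None else nth_default None w i)"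
proof (induction w arbitrary: i)
  case (Cons x w)
  show ?case
  proof (cases i)
    case 0
    then show ?thesis using Cons[of 0] delay_eq_0_iff[of G s w]
      by (auto simp: nth_default_push)
  next
    case (Suc k)
    then show ?thesis using Cons[of k] delay_eq_0_iff[of G s w]
      by (auto simp: nth_default_push)
  qed
qed simp

lemma types_eq_remdups: "types w = remdups (List.map_filter id w)"
proof (induction w)
  case (Cons x w)
  have "c \<in> set (List.map_filter id w) \<longleftrightarrow> c \<in> set (types w)" for c
    by (simp only: Cons set_remdups)
  then show ?case using Cons by (cases x) (auto simp: List.map_filter_simps simp del: set_types)
qed (simp add: List.map_filter_simps)

text \<open>The state of the sequence after position \<open>N\<close>, read backwards in time: entry \<open>i\<close> belongs to
  position \<open>N - i\<close>.\<close>

definition slot :: "(int \<Rightarrow> ('c, 's) item) \<Rightarrow> (int \<times> int) set \<Rightarrow> int \<Rightarrow> nat \<Rightarrow> 'c option" where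
  "slot z A N i = (if N - int i \<in> backlog z A N then Some (projl (z (N - int i))) else None)"

text \<open>The default \<open>[]\<close> for an infinite backlog keeps every value
  canonical.\<close>

definition backlog_word :: "(int \<Rightarrow> ('c, 's) item) \<Rightarrow> (int \<times> int) set \<Rightarrow> int \<Rightarrow> 'c option list" where
  "backlog_word z A N = (if finite (backlog z A N)
     then (THE w. canonical w \<and> (\<forall>i. nth_default None w i = slot z A N i)) else [])"

lemma backlog_word:
  assumes "finite (backlog z A N)"
  shows "canonical (backlog_word z A N)" "nth_default None (backlog_word z A N) i = slot z A N i"
proof -
  have "finite {i. slot z A N i \<noteq> None}"
  proof (rule finite_imageD)
    show "finite ((\<lambda>i. N - int i) ` {i. slot z A N i \<noteq> None})"
      by (rule finite_subset[OF _ assms]) (auto simp: slot_def split: if_splits)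
  qed (auto simp: inj_on_def)
  then obtain n where "\<forall>i\<in>{i. slot z A N i \<noteq> None}. i < n"
    unfolding finite_nat_set_iff_bounded by blast
  then have n: "\<And>i. slot z A N i \<noteq> None \<Longrightarrow> i < n" by blast
  define w where "w = strip_while ((=) None) (map (slot z A N) [0..<n])"
  have w: "canonical w \<and> (\<forall>i. nth_default None w i = slot z A N i)"
  proof (intro conjI allI)
    show "canonical w" by (simp add: canonical_iff_no_trailing w_def)
    fix i
    show "nth_default None w i = slot z A N i"
      using n[of i] by (cases "i < n"; cases "slot z A N i") (auto simp: w_def nth_default_def)
  qed
  have "canonical (backlog_word z A N) \<and> (\<forall>i. nth_default None (backlog_word z A N) i =
      slot z A N i)"
    unfolding backlog_word_def if_P[OF assms]
    by (rule theI[of _ w]) (use w in \<open>auto intro!: canonical_eqI\<close>)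
  then show "canonical (backlog_word z A N)" "nth_default None (backlog_word z A N) i =
      slot z A N i"
    by auto
qed

lemma slot_eq_Some_iff:
  "slot z A N i = Some c \<longleftrightarrow> N - int i \<in> backlog z A N \<and> z (N - int i) = Agent c"
  by (auto simp: slot_def backlog_def)

lemma backlog_word_eq_iff:
  assumes "finite (backlog z A N)" "canonical w"
  shows "backlog_word z A N = w \<longleftrightarrow> (\<forall>i. slot z A N i = nth_default None w i)"
  using backlog_word[OF assms(1)] assms(2) by (auto intro!: canonical_eqI)

lemma backlog_empty_iff:
  assumes "finite (backlog z A N)"
  shows "backlog z A N = {} \<longleftrightarrow> backlog_word z A N = []"
proof -
  have "(\<forall>i. slot z A N i = None) \<longleftrightarrow> backlog z A N = {}"
  proof
    assume none: "\<forall>i. slot z A N i = None"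
    show "backlog z A N = {}"
    proof (rule ccontr)
      assume "backlog z A N \<noteq> {}"
      then obtain m where m: "m \<in> backlog z A N" by auto
      then have "m \<le> N" by (auto simp: backlog_def)
      then have "N - int (nat (N - m)) = m" by simp
      then show False using none[rule_format, of "nat (N - m)"] m by (simp add: slot_def)
    qed
  qed (auto simp: slot_def)
  then show ?thesis using backlog_word_eq_iff[OF assms, of "[]"] by simp
qed

text \<open>The word reads from new to old and \<open>backlog_types\<close> from old to new. The
  inner reversal in \<open>first_appearances\<close> undoes this, and \<open>remdups\<close> then
  yields \<open>types\<close>.\<close>

lemma first_appearances_backlog:
  assumes fin: "finite (backlog z A N)"
  shows "first_appearances (backlog_types z A N) = rev (types (backlog_word z A N))"
proof -
  define w where "w = backlog_word z A N"
  have w: "nth_default None w i = slot z A N i" for i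
    using backlog_word[OF fin] by (simp add: w_def)
  define ks where "ks = filter (\<lambda>i. w ! i \<noteq> None) [0..<length w]"
  define ms where "ms = rev (map (\<lambda>i. N - int i) ks)"
  have set_ms: "set ms = backlog z A N"
  proof (intro set_eqI iffI)
    fix m assume "m \<in> set ms"
    then obtain i where i: "m = N - int i" "i < length w" "w ! i \<noteq> None"
      by (auto simp: ms_def ks_def)
    then have "slot z A N i \<noteq> None" using w[of i] by (simp add: nth_default_nth)
    then show "m \<in> backlog z A N" using i by (auto simp: slot_def split: if_splits)
  next
    fix m assume m: "m \<in> backlog z A N"
    then have "m \<le> N" by (auto simp: backlog_def)
    then have eq: "N - int (nat (N - m)) = m" by simp
    then have "slot z A N (nat (N - m)) \<noteq> None" using m by (simp add: slot_def)
    then have "nth_default None w (nat (N - m)) \<noteq> None" by (simp add: w)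
    then have "nat (N - m) \<in> set ks" by (auto simp: nth_default_def ks_def split: if_splits)
    then show "m \<in> set ms" using eq by (force simp: ms_def)
  qed
  have "sorted_wrt (<) ks" unfolding ks_def by (intro sorted_wrt_filter) simp
  then have "sorted_wrt (<) ms"
    by (auto simp: ms_def sorted_wrt_rev sorted_wrt_map elim!: sorted_wrt_mono_rel[rotated])
  then have "sorted_list_of_set (backlog z A N) = ms"
    unfolding set_ms[symmetric]
    by (intro sorted_list_of_set.idem_if_sorted_distinct) (auto simp: strict_sorted_iff)
  moreover have "projl (z (N - int i)) = the (w ! i)" if "i \<in> set ks" for i
  proof -
    have "i < length w" "w ! i \<noteq> None" using that by (auto simp: ks_def)
    then have "slot z A N i = w ! i" "w ! i \<noteq> None" using w[of i] by (auto simp: nth_default_nth)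
    then show ?thesis by (auto simp: slot_def split: if_splits)
  qed
  ultimately have "backlog_types z A N = rev (map (\<lambda>i. the (w ! i)) ks)"
    by (simp add: backlog_types_def ms_def rev_map)
  also have "map (\<lambda>i. the (w ! i)) ks = List.map_filter id w"
  proof -
    have "List.map_filter id w = map the (filter (\<lambda>x. x \<noteq> None) (map ((!) w) [0..<length w]))"
      by (simp only: List.map_filter_def map_nth) simp
    then show ?thesis by (simp add: filter_map o_def ks_def)
  qed
  finally show ?thesis by (simp add: first_appearances_def types_eq_remdups w_def)
qed

locale realization =
  fixes G :: "('s::finite \<times> 'c::finite) set" and z :: "int \<Rightarrow> ('c, 's) item"
      and A :: "(int \<times> int) set"
  assumes fcfs: "directed_fcfs G z A" and all_matched: "all_agents_matched z A"
begin

lemma match_iff: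
  "(m, n) \<in> A \<longleftrightarrow> (\<exists>s c. z n = Good s \<and> z m = Agent c \<and> n > m \<and> (s, c) \<in> G \<and>
     (\<forall>k<m. \<forall>c'. z k = Agent c' \<and> (s, c') \<in> G \<longrightarrow> (\<exists>l<n. (k, l) \<in> A)) \<and>
     \<not> (\<exists>l<n. (m, l) \<in> A))"
  using fcfs unfolding directed_fcfs_def by blast

lemma unique_good: "(m, n) \<in> A \<Longrightarrow> (m, n') \<in> A \<Longrightarrow> n = n'"
  using fcfs unfolding directed_fcfs_def by blast

lemma unique_agent: "(m, n) \<in> A \<Longrightarrow> (m', n) \<in> A \<Longrightarrow> m = m'"
  using fcfs unfolding directed_fcfs_def by blast

text \<open>An agent is matched only after all its predecessors of the same type, and there are finitely
  many positions in which this can have happened.\<close>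

lemma finite_backlog: "finite (backlog z A N)"
proof -
  have "finite {m \<in> backlog z A N. z m = Agent c}" for c
  proof (rule ccontr)
    let ?B = "{m \<in> backlog z A N. z m = Agent c}"
    assume inf: "infinite ?B"
    then have "?B \<noteq> {}" by (metis finite.emptyI)
    then obtain m where m: "m \<in> ?B" by blast
    then obtain n where n: "(m, n) \<in> A" using all_matched unfolding all_agents_matched_def by blast
    have nN: "n > N" using m n by (auto simp: backlog_def not_le[symmetric])
    have "?B \<subseteq> {k \<in> ?B. k < m} \<union> {m..N}" by (auto simp: backlog_def)
    then have "infinite {k \<in> ?B. k < m}"
      using inf finite_subset by blast
    have "\<exists>l. N < l \<and> l < n \<and> (k, l) \<in> A" if k: "k \<in> {k \<in> ?B. k < m}" for k
    proof -
      obtain s d where sd: "z m = Agent d" "(s, d) \<in> G"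
        "\<forall>k<m. \<forall>c'. z k = Agent c' \<and> (s, c') \<in> G \<longrightarrow> (\<exists>l<n. (k, l) \<in> A)"
        using n unfolding match_iff[of m n] by blast
      then have "(s, c) \<in> G" using m by simp
      then obtain l where "l < n" "(k, l) \<in> A" using sd(3) k by blast
      moreover have "l > N" using k \<open>(k, l) \<in> A\<close> by (auto simp: backlog_def not_le[symmetric])
      ultimately show ?thesis by blast
    qed
    then have "\<forall>k\<in>{k \<in> ?B. k < m}. \<exists>l. N < l \<and> l < n \<and> (k, l) \<in> A" by (rule ballI)
    from bchoice[OF this] obtain f
      where f: "\<forall>k\<in>{k \<in> ?B. k < m}. N < f k \<and> f k < n \<and> (k, f k) \<in> A" ..
    have "inj_on f {k \<in> ?B. k < m}"
    proof (rule inj_onI)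
      fix k k' assume "k \<in> {k \<in> ?B. k < m}" "k' \<in> {k \<in> ?B. k < m}" "f k = f k'"
      then have "(k, f k) \<in> A" "(k', f k) \<in> A" using bspec[OF f, of k] bspec[OF f, of k'] by auto
      then show "k = k'" by (rule unique_agent)
    qed
    moreover have "f ` {k \<in> ?B. k < m} \<subseteq> {N<..<n}" using f by auto
    ultimately have "finite {k \<in> ?B. k < m}" by (rule inj_on_finite) simp
    with \<open>infinite {k \<in> ?B. k < m}\<close> show False by (rule notE)
  qed
  then have "finite (\<Union>c. {m \<in> backlog z A N. z m = Agent c})" by (intro finite_UN_I) auto
  moreover have "backlog z A N = (\<Union>c. {m \<in> backlog z A N. z m = Agent c})"
    by (auto simp: backlog_def)
  ultimately show ?thesis by simp
qed

abbreviation "wrd \<equiv> backlog_word z A"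

lemma wrd: "canonical (wrd N)" "nth_default None (wrd N) i = slot z A N i"
  using backlog_word finite_backlog by blast+

text \<open>An earlier agent is available to the good in position \<open>n\<close> exactly if it is
  in the backlog at \<open>n - 1\<close>. Entry \<open>i\<close> of that word belongs to
  \<open>n - 1 - i\<close>, so the delay is \<open>i + 1\<close>.\<close>

lemma match_iff_delay:
  "(n - 1 - int i, n) \<in> A \<and> z (n - 1 - int i) = Agent c \<longleftrightarrow>
     (\<exists>s. z n = Good s \<and> delay G s (wrd (n - 1)) = Suc i \<and> oldest G s (wrd (n - 1)) = Some c)"
proof -
  let ?m = "n - 1 - int i"
  have old: "(\<forall>k<?m. \<forall>c'. z k = Agent c' \<and> (s, c') \<in> G \<longrightarrow> (\<exists>l<n. (k, l) \<in> A)) \<longleftrightarrow>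
      (\<forall>j>i. \<forall>c'. slot z A (n - 1) j = Some c' \<longrightarrow> (s, c') \<notin> G)" for s
  proof
    assume L: "\<forall>k<?m. \<forall>c'. z k = Agent c' \<and> (s, c') \<in> G \<longrightarrow> (\<exists>l<n. (k, l) \<in> A)"
    show "\<forall>j>i. \<forall>c'. slot z A (n - 1) j = Some c' \<longrightarrow> (s, c') \<notin> G"
    proof (intro allI impI notI)
      fix j c' assume j: "j > i" "slot z A (n - 1) j = Some c'" "(s, c') \<in> G"
      then have "n - 1 - int j < ?m" "z (n - 1 - int j) = Agent c'"
          "n - 1 - int j \<in> backlog z A (n - 1)"
        by (auto simp: slot_eq_Some_iff)
      moreover from this L j(3) obtain l where "l < n" "(n - 1 - int j, l) \<in> A" by blast
      ultimately show False by (force simp: backlog_def)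
    qed
  next
    assume R: "\<forall>j>i. \<forall>c'. slot z A (n - 1) j = Some c' \<longrightarrow> (s, c') \<notin> G"
    show "\<forall>k<?m. \<forall>c'. z k = Agent c' \<and> (s, c') \<in> G \<longrightarrow> (\<exists>l<n. (k, l) \<in> A)"
    proof (intro allI impI)
      fix k c' assume k: "k < ?m" "z k = Agent c' \<and> (s, c') \<in> G"
      define j where "j = nat (n - 1 - k)"
      have j: "j > i" "n - 1 - int j = k" using k by (auto simp: j_def)
      then have "slot z A (n - 1) j \<noteq> Some c'" using R k by blast
      then have "k \<notin> backlog z A (n - 1)" using j k by (simp add: slot_eq_Some_iff)
      then obtain l where "l \<le> n - 1" "(k, l) \<in> A" using k by (auto simp: backlog_def)
      then show "\<exists>l<n. (k, l) \<in> A" by force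
    qed
  qed
  have "(?m, n) \<in> A \<and> z ?m = Agent c \<longleftrightarrow> (\<exists>s. z n = Good s \<and> slot z A (n - 1) i = Some c \<and>
      (s, c) \<in> G \<and>
      (\<forall>j>i. \<forall>c'. slot z A (n - 1) j = Some c' \<longrightarrow> (s, c') \<notin> G))"
    unfolding match_iff[of ?m n] old slot_eq_Some_iff[of z A "n - 1" i]
    by (force simp: backlog_def)
  then show ?thesis by (simp only: delay_eq_Suc_iff wrd)
qed

lemma wrd_step: "wrd (N + 1) = arrive G (wrd N) (z (N + 1))"
proof (rule canonical_eqI)
  show "canonical (wrd (N + 1))" "canonical (arrive G (wrd N) (z (N + 1)))"
    using wrd by (auto intro: canonical_arrive)
  fix i
  show "nth_default None (wrd (N + 1)) i = nth_default None (arrive G (wrd N) (z (N + 1))) i"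
  proof (cases i)
    case 0
    \<comment> \<open>A good comes strictly after its agent, so an agent that has just arrived is
      still waiting.\<close>
    have "N + 1 \<in> backlog z A (N + 1) \<longleftrightarrow> (\<exists>c. z (N + 1) = Agent c)"
    proof -
      have "(N + 1, n) \<notin> A" if "n \<le> N + 1" for n
        using that unfolding match_iff[of "N + 1" n] by auto
      then show ?thesis by (auto simp: backlog_def)
    qed
    then have "slot z A (N + 1) 0 = (case z (N + 1) of Inl c \<Rightarrow> Some c | Inr s \<Rightarrow> None)"
      by (auto simp: slot_def split: sum.split)
    then show ?thesis using 0 by (auto simp: wrd nth_default_push split: sum.split)
  next
    case (Suc k)
    let ?m = "N - int k"
    have "?m \<in> backlog z A (N + 1) \<longleftrightarrow> ?m \<in> backlog z A N \<and> (?m, N + 1) \<notin> A"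
      by (auto simp: backlog_def zle_add1_eq_le intro: order.strict_implies_order)
        (metis order_le_less zle_add1_eq_le)+
    moreover have "N + 1 - int (Suc k) = ?m" by simp
    ultimately have s1: "slot z A (N + 1) (Suc k) =
        (if (?m, N + 1) \<in> A then None else slot z A N k)"
      by (simp add: slot_def)
    show ?thesis
    proof (cases "z (N + 1)")
      case (Inl c)
      then have "(?m, N + 1) \<notin> A" unfolding match_iff[of ?m "N + 1"] by simp
      then show ?thesis using Inl Suc s1 by (simp add: wrd)
    next
      case (Inr s)
      have "(?m, N + 1) \<in> A \<longleftrightarrow> delay G s (wrd N) = Suc k"
      proof
        assume a: "(?m, N + 1) \<in> A"
        then obtain c where "z ?m = Agent c" unfolding match_iff[of ?m "N + 1"] by blast
        then show "delay G s (wrd N) = Suc k" using a Inr match_iff_delay[of "N + 1" k c] by simp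
      next
        assume d: "delay G s (wrd N) = Suc k"
        then have "oldest G s (wrd N) \<noteq> None" using delay_eq_0_iff[of G s "wrd N"] by simp
        then obtain c where "oldest G s (wrd N) = Some c" by blast
        then show "(?m, N + 1) \<in> A" using d Inr match_iff_delay[of "N + 1" k c] by simp
      qed
      moreover have "nth_default None (arrive G (wrd N) (z (N + 1))) i =
          nth_default None (serve G s (wrd N)) k"
        by (simp only: Inr Suc arrive.simps nth_default_push nat.case)
      ultimately show ?thesis using Suc s1 by (simp add: wrd nth_default_serve)
    qed
  qed
qed

lemma matched_types_delay_iff:
  "(\<exists>m. (m, n) \<in> A \<and> n - m = int d) \<and> matched_types z A s c n \<longleftrightarrow>
     z n = Good s \<and> oldest G s (wrd (n - 1)) = Some c \<and> delay G s (wrd (n - 1)) = d"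
proof
  assume L: "(\<exists>m. (m, n) \<in> A \<and> n - m = int d) \<and> matched_types z A s c n"
  then obtain m m' where m: "(m, n) \<in> A" "n - m = int d" "z n = Good s" "(m', n) \<in> A"
      "z m' = Agent c"
    by (auto simp: matched_types_def)
  have "m' = m" using m unique_agent by blast
  moreover have "m < n" using m(1) unfolding match_iff[of m n] by blast
  ultimately obtain i where i: "d = Suc i" "m = n - 1 - int i"
    using m(2) by (metis add_diff_cancel_left' diff_diff_eq2 diff_gt_0_iff_gt gr0_conv_Suc
        of_nat_0_less_iff of_nat_Suc diff_diff_add diff_add_cancel)
  show "z n = Good s \<and> oldest G s (wrd (n - 1)) = Some c \<and> delay G s (wrd (n - 1)) = d"
    using m \<open>m' = m\<close> i match_iff_delay[of n i c] by auto
next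
  assume R: "z n = Good s \<and> oldest G s (wrd (n - 1)) = Some c \<and> delay G s (wrd (n - 1)) = d"
  then have "d \<noteq> 0" using delay_eq_0_iff[of G s "wrd (n - 1)"] by auto
  then obtain i where i: "d = Suc i" by (cases d) auto
  then have "(n - 1 - int i, n) \<in> A \<and> z (n - 1 - int i) = Agent c"
    using R match_iff_delay[of n i c] by blast
  then show "(\<exists>m. (m, n) \<in> A \<and> n - m = int d) \<and> matched_types z A s c n"
    using R i by (auto simp: matched_types_def intro!: exI[of _ "n - 1 - int i"])
qed

lemma matched_types_iff:
  "matched_types z A s c n \<longleftrightarrow> z n = Good s \<and> oldest G s (wrd (n - 1)) = Some c"
proof
  assume L: "matched_types z A s c n"
  then obtain m where m: "(m, n) \<in> A" by (auto simp: matched_types_def)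
  then have "m < n" unfolding match_iff[of m n] by blast
  then have "n - m = int (nat (n - m))" by simp
  then show "z n = Good s \<and> oldest G s (wrd (n - 1)) = Some c"
    using L m matched_types_delay_iff[of n "nat (n - m)" s c] by blast
qed (use matched_types_delay_iff in blast)

end

section \<open>The stationary model\<close>

lemma measurable_backlog:
  fixes z :: "int \<Rightarrow> 'w \<Rightarrow> ('c::finite, 's::finite) item"
  assumes z [measurable]: "\<And>i. z i \<in> M \<rightarrow>\<^sub>M count_space UNIV"
    and A [measurable]: "\<And>m n. Measurable.pred M (\<lambda>\<omega>. (m, n) \<in> A \<omega>)"
  shows "Measurable.pred M (\<lambda>\<omega>. m \<in> backlog (\<lambda>i. z i \<omega>) (A \<omega>) N)"
    and "Measurable.pred M (\<lambda>\<omega>. finite (backlog (\<lambda>i. z i \<omega>) (A \<omega>) N))"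
    and "(\<lambda>\<omega>. backlog_word (\<lambda>i. z i \<omega>) (A \<omega>) N) \<in> M \<rightarrow>\<^sub>M count_space UNIV"
proof -
  let ?B = "\<lambda>\<omega>. backlog (\<lambda>i. z i \<omega>) (A \<omega>) N"
  have b [measurable]: "Measurable.pred M (\<lambda>\<omega>. m \<in> ?B \<omega>)" for m
    unfolding backlog_def mem_Collect_eq by measurable
  show "Measurable.pred M (\<lambda>\<omega>. m \<in> ?B \<omega>)" by measurable
  \<comment> \<open>The backlog is bounded above by \<open>N\<close>, so finiteness amounts to a
    lower bound, a condition with countable quantifiers.\<close>
  have "finite (?B \<omega>) \<longleftrightarrow> (\<exists>k. \<forall>m. m \<in> ?B \<omega> \<longrightarrow> k \<le> m)" for \<omega>
  proof
    assume "finite (?B \<omega>)"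
    then show "\<exists>k. \<forall>m. m \<in> ?B \<omega> \<longrightarrow> k \<le> m"
      by (intro exI[of _ "Min (?B \<omega>)"]) simp
  next
    assume "\<exists>k. \<forall>m. m \<in> ?B \<omega> \<longrightarrow> k \<le> m"
    then obtain k where k: "\<forall>m. m \<in> ?B \<omega> \<longrightarrow> k \<le> m" ..
    have "?B \<omega> \<subseteq> {k..N}"
    proof
      fix m assume m: "m \<in> ?B \<omega>"
      moreover from m have "m \<le> N" by (simp add: backlog_def)
      ultimately show "m \<in> {k..N}" using k by simp
    qed
    then show "finite (?B \<omega>)" by (rule finite_subset) simp
  qed
  then show fin [measurable]: "Measurable.pred M (\<lambda>\<omega>. finite (?B \<omega>))"
    by simp
  show "(\<lambda>\<omega>. backlog_word (\<lambda>i. z i \<omega>) (A \<omega>) N) \<in> M \<rightarrow>\<^sub>M count_space UNIV"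
  proof (rule measurable_count_space_countable)
    fix w :: "'c option list"
    have slot: "slot (\<lambda>i. z i \<omega>) (A \<omega>) N i = x \<longleftrightarrow> (case x of
        None \<Rightarrow> N - int i \<notin> ?B \<omega>
      | Some c \<Rightarrow> N - int i \<in> ?B \<omega> \<and> z (N - int i) \<omega> = Agent c)" for \<omega> i x
      by (cases x) (auto simp: slot_eq_Some_iff, auto simp: slot_def)
    have [measurable]: "Measurable.pred M (\<lambda>\<omega>. slot (\<lambda>i. z i \<omega>) (A \<omega>) N i = x)" for i x
      unfolding slot by (cases x) (simp_all only: option.case, measurable)
    have "backlog_word (\<lambda>i. z i \<omega>) (A \<omega>) N = w \<longleftrightarrow> canonical w \<and>
        (if finite (?B \<omega>) then \<forall>i. slot (\<lambda>i. z i \<omega>) (A \<omega>) N i = nth_default None w i else w = [])"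
            for \<omega>
      using backlog_word(1)[of "\<lambda>i. z i \<omega>" "A \<omega>" N] backlog_word_eq_iff[of "\<lambda>i. z i \<omega>" "A \<omega>" N w]
      by (auto simp: backlog_word_def)
    then show "{\<omega> \<in> space M. backlog_word (\<lambda>i. z i \<omega>) (A \<omega>) N = w} \<in> sets M"
      by simp
  qed
qed

lemma backlog_shift: "m \<in> backlog (\<lambda>i. z (i + 1)) {(m, n). (m + 1, n + 1) \<in> A} N \<longleftrightarrow> m +
    1 \<in> backlog z A (N + 1)"
proof -
  have "(\<exists>n\<le>N. (m + 1, n + 1) \<in> A) \<longleftrightarrow> (\<exists>n\<le>N + 1. (m + 1, n) \<in> A)"
  proof
    assume "\<exists>n\<le>N + 1. (m + 1, n) \<in> A"
    then obtain n where "n \<le> N + 1" "(m + 1, n) \<in> A" by blast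
    then show "\<exists>n\<le>N. (m + 1, n + 1) \<in> A" by (intro exI[of _ "n - 1"]) auto
  next
    assume "\<exists>n\<le>N. (m + 1, n + 1) \<in> A"
    then obtain n where "n \<le> N" "(m + 1, n + 1) \<in> A" by blast
    then show "\<exists>n\<le>N + 1. (m + 1, n) \<in> A" by (intro exI[of _ "n + 1"]) auto
  qed
  then have "(\<forall>n\<le>N. (m + 1, n + 1) \<notin> A) \<longleftrightarrow> (\<forall>n\<le>N + 1. (m + 1, n) \<notin> A)" by blast
  then show ?thesis by (simp add: backlog_def)
qed

lemma backlog_word_shift:
  "backlog_word (\<lambda>i. z (i + 1)) {(m, n). (m + 1, n + 1) \<in> A} N = backlog_word z A (N + 1)"
proof -
  have img: "backlog z A (N + 1) = (\<lambda>m. m + 1) ` backlog (\<lambda>i. z (i + 1)) {(m, n). (m + 1, n +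
      1) \<in> A} N"
  proof (intro set_eqI iffI)
    fix m assume "m \<in> backlog z A (N + 1)"
    then show "m \<in> (\<lambda>m. m + 1) ` backlog (\<lambda>i. z (i + 1)) {(m, n). (m + 1, n + 1) \<in> A} N"
      by (intro image_eqI[of _ _ "m - 1"]) (auto simp: backlog_shift)
  qed (auto simp: backlog_shift)
  have "finite (backlog z A (N + 1)) \<longleftrightarrow> finite (backlog (\<lambda>i. z (i + 1)) {(m, n). (m + 1, n +
      1) \<in> A} N)"
    unfolding img by (rule finite_image_iff) simp
  moreover have "slot (\<lambda>i. z (i + 1)) {(m, n). (m + 1, n + 1) \<in> A} N i = slot z A (N + 1) i" for i
  proof -
    have "N + 1 - int i = (N - int i) + 1" by simp
    then show ?thesis by (simp only: slot_def backlog_shift)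
  qed
  ultimately show ?thesis by (simp add: backlog_word_def)
qed

locale fcfs_model = fcfs_rates lbar mbar \<alpha> \<beta> G + prob_space M
  for lbar mbar :: real and \<alpha> :: "'c::finite pmf" and \<beta> :: "'s::finite pmf"
    and G :: "('s \<times> 'c) set" and M :: "'w measure" +
  fixes z :: "int \<Rightarrow> 'w \<Rightarrow> ('c, 's) item" and A :: "'w \<Rightarrow> (int \<times> int) set"
  assumes iid: "iid_items M lbar mbar \<alpha> \<beta> z"
    and matching: "stationary_matching M G z A"
begin

abbreviation waiting :: "int \<Rightarrow> 'w \<Rightarrow> int set" where
  "waiting N \<omega> \<equiv> backlog (\<lambda>i. z i \<omega>) (A \<omega>) N"

lemma z_meas [measurable]: "z i \<in> M \<rightarrow>\<^sub>M count_space UNIV"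
  using iid by (auto simp: iid_items_def indep_vars_def)

lemma A_meas [measurable]: "Measurable.pred M (\<lambda>\<omega>. (m, n) \<in> A \<omega>)"
  using matching by (simp add: stationary_matching_def pred_def)

definition X :: "int \<Rightarrow> 'w \<Rightarrow> 'c option list" where
  "X N \<omega> = backlog_word (\<lambda>i. z i \<omega>) (A \<omega>) N"

lemma X_meas [measurable]: "X N \<in> M \<rightarrow>\<^sub>M count_space UNIV"
  unfolding X_def by (rule measurable_backlog(3)) measurable

lemmas backlog_meas [measurable] = measurable_backlog(1,2)[of z M A, OF z_meas A_meas]

lemma AE_realization: "AE \<omega> in M. realization G (\<lambda>i. z i \<omega>) (A \<omega>)"
  using matching by (auto simp: stationary_matching_def realization_def)

lemma prob_item: "\<P>(\<omega> in M. z n \<omega> = i) = pmf item_pmf i"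
  using iid by (cases i) (auto simp: iid_items_def pmf_item_Inl pmf_item_Inr type_rate_def)

text \<open>This is where joint stationarity enters. The word is a measurable function of items and
  matching together, and the word at \<open>N + 1\<close> is the word at \<open>N\<close> of the
  shifted pair.\<close>

lemma prob_X_Suc: "\<P>(\<omega> in M. X N \<omega> = w) = \<P>(\<omega> in M. X (N + 1) \<omega> = w)"
proof -
  define S where "S = (\<Pi>\<^sub>M i\<in>(UNIV :: int set). count_space (UNIV :: ('c, 's) item set)) \<Otimes>\<^sub>M
      (\<Pi>\<^sub>M p\<in>(UNIV :: (int \<times> int) set). count_space (UNIV :: bool set))"
  define Y where "Y = (\<lambda>\<omega>. (\<lambda>i. z i \<omega>, \<lambda>(m, n). (m, n) \<in> A \<omega>))"
  define Y' where "Y' = (\<lambda>\<omega>. (\<lambda>i. z (i + 1) \<omega>, \<lambda>(m, n). (m + 1, n + 1) \<in> A \<omega>))"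
  have eq: "distr M S Y = distr M S Y'"
    using matching by (simp add: stationary_matching_def jointly_stationary_def S_def Y_def Y'_def
        Let_def)
  have product: "(\<lambda>\<omega>. (\<lambda>i. f i \<omega>, \<lambda>(m, n). Q m n \<omega>)) \<in> M \<rightarrow>\<^sub>M S"
    if "\<And>i. f i \<in> M \<rightarrow>\<^sub>M count_space UNIV" "\<And>m n. Measurable.pred M (Q m n)"
    for f :: "int \<Rightarrow> 'w \<Rightarrow> ('c, 's) item" and Q :: "int \<Rightarrow> int \<Rightarrow> 'w \<Rightarrow> bool"
    unfolding S_def
  proof (rule measurable_Pair)
    show "(\<lambda>\<omega> i. f i \<omega>) \<in> M \<rightarrow>\<^sub>M (\<Pi>\<^sub>M i\<in>UNIV. count_space UNIV)"
      by (rule measurable_PiM_single') (use that(1) in simp_all)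
    show "(\<lambda>\<omega> p. case p of (m, n) \<Rightarrow> Q m n \<omega>) \<in> M \<rightarrow>\<^sub>M (\<Pi>\<^sub>M p\<in>UNIV. count_space UNIV)"
      by (rule measurable_PiM_single') (use that(2) in \<open>simp_all add: split_beta\<close>)
  qed
  have Y: "Y \<in> M \<rightarrow>\<^sub>M S" unfolding Y_def by (rule product) measurable
  have Y': "Y' \<in> M \<rightarrow>\<^sub>M S" unfolding Y'_def by (rule product) measurable
  let ?w = "\<lambda>y. backlog_word (fst y) {p. snd y p} N"
  have "?w \<in> S \<rightarrow>\<^sub>M count_space UNIV"
  proof (rule measurable_backlog(3)[of "\<lambda>i y. fst y i" S "\<lambda>y. {p. snd y p}", simplified])
    show "(\<lambda>y. fst y i) \<in> S \<rightarrow>\<^sub>M count_space UNIV" for i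
      unfolding S_def by measurable
    show "Measurable.pred S (\<lambda>y. snd y (m, n))" for m n
      unfolding S_def by measurable
  qed
  then have E: "{y \<in> space S. ?w y = w} \<in> sets S" by simp
  have wY: "?w (Y \<omega>) = X N \<omega>" for \<omega>
    by (simp add: Y_def X_def)
  have wY': "?w (Y' \<omega>) = X (N + 1) \<omega>" for \<omega>
    unfolding Y'_def X_def fst_conv snd_conv by (rule backlog_word_shift)
  have "measure (distr M S Y) {y \<in> space S. ?w y = w} = \<P>(\<omega> in M. X N \<omega> = w)"
    unfolding measure_distr[OF Y E] using measurable_space[OF Y]
    by (intro arg_cong[of _ _ prob]) (auto simp: wY)
  moreover have "measure (distr M S Y') {y \<in> space S. ?w y = w} = \<P>(\<omega> in M. X (N + 1) \<omega> = w)"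
    unfolding measure_distr[OF Y' E] using measurable_space[OF Y']
    by (intro arg_cong[of _ _ prob]) (auto simp: wY')
  ultimately show ?thesis using eq by simp
qed

lemma prob_X_const: "\<P>(\<omega> in M. X N \<omega> = w) = \<P>(\<omega> in M. X N' \<omega> = w)"
proof -
  have "\<P>(\<omega> in M. X N \<omega> = w) = \<P>(\<omega> in M. X (N + int k) \<omega> = w)" for N k
  proof (induction k)
    case (Suc k)
    have "N + int (Suc k) = N + int k + 1" by simp
    then show ?case by (simp only: Suc.IH prob_X_Suc[of "N + int k"])
  qed simp
  note shift = this
  show ?thesis
  proof (cases "N \<le> N'")
    case True
    then have "N + int (nat (N' - N)) = N'" by simp
    with shift[of N "nat (N' - N)"] show ?thesis by (simp only:)
  next
    case False
    then have "N' + int (nat (N - N')) = N" by simp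
    with shift[of N' "nat (N - N')"] show ?thesis by (simp only:)
  qed
qed

text \<open>A word outside the support is either not canonical or contains an agent of a type of
  rate zero, which would have to occur at a definite position.\<close>

lemma prob_X_support:
  assumes "w \<notin> set_pmf word_pmf"
  shows "\<P>(\<omega> in M. X N \<omega> = w) = 0"
proof (cases "canonical w")
  case False
  have "canonical (X N \<omega>)" for \<omega>
    by (cases "finite (waiting N \<omega>)") (simp_all add: X_def backlog_word(1), simp add:
        backlog_word_def)
  then have "{\<omega> \<in> space M. X N \<omega> = w} = {}" using False by auto
  then show ?thesis by (simp only: measure_empty)
next
  case True
  then have "weight w = 0" using assms total_mass_ge_1 by (simp add: set_pmf_iff pmf_word)
  then obtain c where c: "Some c \<in> set w" "la {c} = 0" using weight_eq_0D by blast
  then obtain i where i: "i < length w" "w ! i = Some c" by (auto simp: in_set_conv_nth)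
  have "\<P>(\<omega> in M. X N \<omega> = w) \<le> \<P>(\<omega> in M. z (N - int i) \<omega> = Agent c)"
  proof (rule finite_measure_mono_AE)
    show "AE \<omega> in M. \<omega> \<in> {\<omega> \<in> space M. X N \<omega> = w} \<longrightarrow> \<omega> \<in> {\<omega> \<in> space M. z (N - int i) \<omega> = Agent c}"
      using AE_realization
    proof eventually_elim
      case (elim \<omega>)
      have fin: "finite (waiting N \<omega>)" by (rule realization.finite_backlog[OF elim])
      show ?case
      proof
        assume \<omega>: "\<omega> \<in> {\<omega> \<in> space M. X N \<omega> = w}"
        then have "slot (\<lambda>i. z i \<omega>) (A \<omega>) N i = nth_default None w i"
          using backlog_word(2)[OF fin, of i] by (simp add: X_def)
        then have "slot (\<lambda>i. z i \<omega>) (A \<omega>) N i = Some c" using i by (simp add: nth_default_nth)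
        then show "\<omega> \<in> {\<omega> \<in> space M. z (N - int i) \<omega> = Agent c}"
          using \<omega> by (simp add: slot_eq_Some_iff)
      qed
    qed
  qed measurable
  also have "\<dots> = 0" using c by (simp add: prob_item pmf_item_Inl)
  finally show ?thesis by (simp add: measure_le_0_iff)
qed

lemma driven_process_X: "driven_process (arrive G) item_pmf word_pmf [] M z X"
proof (intro driven_process.intro driven_process_axioms.intro)
  show "driven_chain (arrive G) item_pmf word_pmf []" by (rule chain.driven_chain_axioms)
  show "prob_space M" by (rule prob_space_axioms)
  show "indep_vars (\<lambda>_. count_space UNIV) z UNIV" using iid by (simp add: iid_items_def)
  show "AE \<omega> in M. \<forall>N. X (N + 1) \<omega> = arrive G (X N \<omega>) (z (N + 1) \<omega>)"
    using AE_realization by eventually_elim (simp add: X_def realization.wrd_step)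
  show "\<P>(\<omega> in M. z n \<omega> = i) = pmf item_pmf i" for n i by (rule prob_item)
  show "X N \<in> M \<rightarrow>\<^sub>M count_space UNIV" for N by (rule X_meas)
  show "\<P>(\<omega> in M. X N \<omega> = w) = \<P>(\<omega> in M. X N' \<omega> = w)" for N N' w
    by (rule prob_X_const)
  show "\<P>(\<omega> in M. X N \<omega> = w) = 0" if "w \<notin> set_pmf word_pmf" for N w
    using that by (rule prob_X_support)
qed

sublocale proc: driven_process "arrive G" item_pmf word_pmf "[]" M z X
  by (rule driven_process_X)

section \<open>The law of first appearances\<close>

lemma pi_Y_eq:
  assumes "distinct Cs"
  shows "pi_Y M z A N Cs = mass (rev Cs) / total_mass"
proof -
  have "pi_Y M z A N Cs = \<P>(\<omega> in M. types (X N \<omega>) = rev Cs)"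
    unfolding pi_Y_def
  proof (rule prob_eq_AE)
    show "AE \<omega> in M. (finite (waiting N \<omega>) \<and>
        first_appearances (backlog_types (\<lambda>i. z i \<omega>) (A \<omega>) N) = Cs) \<longleftrightarrow> types (X N \<omega>) = rev Cs"
      using AE_realization
    proof eventually_elim
      case (elim \<omega>)
      have fin: "finite (waiting N \<omega>)" by (rule realization.finite_backlog[OF elim])
      show ?case by (auto simp: fin first_appearances_backlog[OF fin] X_def rev_swap)
    qed
    \<comment> \<open>Measurability is obtained through the word \<open>X N\<close>; the finiteness
      condition in the event makes the rewriting valid.\<close>
    have "{\<omega> \<in> space M. finite (waiting N \<omega>) \<and>
          first_appearances (backlog_types (\<lambda>i. z i \<omega>) (A \<omega>) N) = Cs} =
        {\<omega> \<in> space M. finite (waiting N \<omega>) \<and> rev (types (X N \<omega>)) = Cs}"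
      by (auto simp: first_appearances_backlog X_def)
    also have "\<dots> \<in> events" by measurable
    finally show "{\<omega> \<in> space M. finite (waiting N \<omega>) \<and>
          first_appearances (backlog_types (\<lambda>i. z i \<omega>) (A \<omega>) N) = Cs} \<in> events" .
  qed measurable
  also have "\<dots> = measure_pmf.prob word_pmf {w. types w = rev Cs}" by (rule proc.prob_W)
  also have "\<dots> = mass (rev Cs) / total_mass"
    by (rule prob_word_pmf) (simp_all add: word_measure_types assms mass_nonneg)
  finally show ?thesis .
qed

lemma prob_backlog_empty: "\<P>(\<omega> in M. waiting N \<omega> = {}) = 1 / total_mass"
proof -
  have "\<P>(\<omega> in M. waiting N \<omega> = {}) = \<P>(\<omega> in M. X N \<omega> = [])"
  proof (rule prob_eq_AE)
    show "AE \<omega> in M. waiting N \<omega> = {} \<longleftrightarrow> X N \<omega> = []"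
      using AE_realization
    proof eventually_elim
      case (elim \<omega>)
      show ?case by (simp add: X_def backlog_empty_iff[OF realization.finite_backlog[OF elim]])
    qed
    have "{\<omega> \<in> space M. waiting N \<omega> = {}} =
        {\<omega> \<in> space M. \<forall>m. m \<notin> waiting N \<omega>}" by auto
    also have "\<dots> \<in> events" by measurable
    finally show "{\<omega> \<in> space M. waiting N \<omega> = {}} \<in> events" .
  qed measurable
  also have "\<dots> = measure_pmf.prob word_pmf {w. w = []}" by (rule proc.prob_W)
  also have "\<dots> = 1 / total_mass" by (simp add: measure_pmf_single pmf_word)
  finally show ?thesis .
qed

text \<open>\<open>mass\<close> divides both rates by \<open>\<Lambda>\<close>, which cancels, and
  consumes the types from the last appearance backwards; hence the reversal.\<close>

lemma mass_eq_prod: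
  "mass (rev Cs) = (\<Prod>h = 1..length Cs. la {Cs ! (h - 1)} / net_rate lbar mbar \<alpha> \<beta> G Cs h)"
proof (induction Cs rule: rev_induct)
  case (snoc c Cs)
  have len: "length (Cs @ [c]) = Suc (length Cs)" by simp
  have Suc: "(\<Prod>h = 1..Suc k. f h) = (\<Prod>h = 1..k. f h) * f (Suc k)" for f :: "nat \<Rightarrow> real" and k
    by simp
  have "(\<Prod>h = 1..length (Cs @ [c]). la {(Cs @ [c]) ! (h - 1)} / net_rate lbar mbar \<alpha> \<beta> G
      (Cs @ [c]) h) =
      (\<Prod>h = 1..length Cs. la {(Cs @ [c]) ! (h - 1)} / net_rate lbar mbar \<alpha> \<beta> G (Cs @ [c]) h) *
      (la {c} / net_rate lbar mbar \<alpha> \<beta> G (Cs @ [c]) (Suc (length Cs)))"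
    by (simp only: len Suc diff_Suc_1 nth_append_length)
  also have "(\<Prod>h = 1..length Cs. la {(Cs @ [c]) ! (h - 1)} / net_rate lbar mbar \<alpha> \<beta> G (Cs @ [c])
      h) = mass (rev Cs)"
    unfolding snoc by (intro prod.cong) (auto simp: nth_append net_rate_def)
  also have "la {c} / net_rate lbar mbar \<alpha> \<beta> G (Cs @ [c]) (Suc (length Cs)) =
      la {c} / \<Lambda> / gap_rate (insert c (set Cs))"
    using \<Lambda>_pos by (simp add: net_rate_def gap_rate_def)
  finally show ?case by (simp add: mult.commute)
qed simp

lemma sum_pi_Y: "(\<Sum>C \<in> UNIV. \<Sum>Cs \<in> permutations_of_set C. pi_Y M z A N Cs) = 1"
proof -
  have "(\<Sum>C \<in> UNIV. \<Sum>Cs \<in> permutations_of_set C. pi_Y M z A N Cs) =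
      (\<Sum>Cs | distinct Cs. pi_Y M z A N Cs)"
    by (rule sum_distinct_by_set[symmetric])
  also have "\<dots> = (\<Sum>R | distinct R. pi_Y M z A N (rev R))"
    by (rule sum_rev_distinct[symmetric])
  also have "\<dots> = (\<Sum>R | distinct R. mass R / total_mass)"
    by (intro sum.cong) (auto simp: pi_Y_eq)
  also have "\<dots> = 1"
    using total_mass_ge_1 by (simp add: sum_divide_distrib[symmetric] total_mass_def[symmetric])
  finally show ?thesis .
qed

section \<open>Matching rates and delay distributions\<close>

definition match_prob :: "'s \<Rightarrow> 'c \<Rightarrow> real" where
  "match_prob s c = measure_pmf.prob (pair_pmf word_pmf item_pmf) {(w, i). i = Good s \<and>
      oldest G s w = Some c}"

definition delayed_match_prob :: "'s \<Rightarrow> 'c \<Rightarrow> nat \<Rightarrow> real" where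
  "delayed_match_prob s c d = measure_pmf.prob (pair_pmf word_pmf item_pmf)
     {(w, i). i = Good s \<and> oldest G s w = Some c \<and> delay G s w = d}"

lemma matched_types_meas [measurable]: "Measurable.pred M (\<lambda>\<omega>. matched_types (\<lambda>i. z i \<omega>) (A \<omega>) s c
    n)"
  unfolding matched_types_def by measurable

lemma prob_matched: "\<P>(\<omega> in M. matched_types (\<lambda>i. z i \<omega>) (A \<omega>) s c n) = match_prob s c"
proof -
  have "\<P>(\<omega> in M. matched_types (\<lambda>i. z i \<omega>) (A \<omega>) s c n) =
      \<P>(\<omega> in M. (\<lambda>w i. i = Good s \<and> oldest G s w = Some c) (X (n - 1) \<omega>) (z (n - 1 + 1) \<omega>))"
  proof (rule prob_eq_AE)
    show "AE \<omega> in M. matched_types (\<lambda>i. z i \<omega>) (A \<omega>) s c n \<longleftrightarrow>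
        (\<lambda>w i. i = Good s \<and> oldest G s w = Some c) (X (n - 1) \<omega>) (z (n - 1 + 1) \<omega>)"
      using AE_realization by eventually_elim (simp add: X_def realization.matched_types_iff)
  qed measurable
  also have "\<dots> = match_prob s c"
    unfolding match_prob_def by (rule proc.prob_W_z[of "\<lambda>w i. i = Good s \<and> oldest G s w = Some c"
        "n - 1"])
  finally show ?thesis .
qed

lemma prob_delayed_match:
  "\<P>(\<omega> in M. (\<exists>m. (m, n) \<in> A \<omega> \<and> n - m = int d) \<and> matched_types (\<lambda>i. z i \<omega>) (A \<omega>) s c n) =
     delayed_match_prob s c d"
proof -
  have "\<P>(\<omega> in M. (\<exists>m. (m, n) \<in> A \<omega> \<and> n - m = int d) \<and> matched_types (\<lambda>i. z i \<omega>) (A \<omega>) s c n) =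
      \<P>(\<omega> in M. (\<lambda>w i. i = Good s \<and> oldest G s w = Some c \<and> delay G s w = d) (X (n - 1) \<omega>) (z (n -
          1 + 1) \<omega>))"
  proof (rule prob_eq_AE)
    show "AE \<omega> in M. (\<exists>m. (m, n) \<in> A \<omega> \<and> n - m = int d) \<and> matched_types (\<lambda>i. z i \<omega>) (A \<omega>) s c n \<longleftrightarrow>
        (\<lambda>w i. i = Good s \<and> oldest G s w = Some c \<and> delay G s w = d) (X (n - 1) \<omega>) (z (n - 1 +
            1) \<omega>)"
      using AE_realization by eventually_elim (simp add: X_def realization.matched_types_delay_iff)
  qed measurable
  also have "\<dots> = delayed_match_prob s c d"
    unfolding delayed_match_prob_def
    by (rule proc.prob_W_z[of "\<lambda>w i. i = Good s \<and> oldest G s w = Some c \<and> delay G s w = d" "n - 1"])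
  finally show ?thesis .
qed

lemma pair_delay_prob_eq: "pair_delay_prob M z A n s c d =
    delayed_match_prob s c d / match_prob s c"
  unfolding pair_delay_prob_def cond_prob_def prob_delayed_match prob_matched ..

lemma delayed_match_prob_le: "delayed_match_prob s c d \<le> match_prob s c"
  unfolding delayed_match_prob_def match_prob_def by (rule measure_pmf.finite_measure_mono) auto

lemma delayed_match_prob_nonneg: "delayed_match_prob s c d \<ge> 0"
  by (simp add: delayed_match_prob_def)

lemma match_prob_incompatible: "(s, c) \<notin> G \<Longrightarrow> match_prob s c = 0"
proof -
  assume "(s, c) \<notin> G"
  then have none: "{(w, i). i = Good s \<and> oldest G s w = Some c} = {}"
      using oldest_in[of G s _ c] by auto
  show ?thesis unfolding match_prob_def none by simp
qed

lemma delayed_match_prob_eq_sum: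
  assumes sc: "(s, c) \<in> G"
  shows "delayed_match_prob s c d = type_rate mbar \<beta> {s} / \<Lambda> *
    (\<Sum>Cs | distinct Cs. pi_Y M z A N Cs * delay_prob s c Cs d)"
proof -
  let ?E = "\<lambda>R. {w. types w = R \<and> oldest G s w = Some c \<and> delay G s w = d}"
  have eq: "{(w, i). i = Good s \<and> oldest G s w = Some c \<and> delay G s w = d} =
      {w. oldest G s w = Some c \<and> delay G s w = d} \<times> {Inr s :: ('c, 's) item}" by auto
  have "delayed_match_prob s c d = measure_pmf.prob word_pmf {w. oldest G s w = Some c \<and>
      delay G s w = d} * (type_rate mbar \<beta> {s} / \<Lambda>)"
    unfolding delayed_match_prob_def eq
    by (subst measure_pmf_prob_product) (simp_all add: measure_pmf_single pmf_item_Inr)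
  also have "{w. oldest G s w = Some c \<and> delay G s w = d} = (\<Union>R\<in>{R. distinct R}. ?E R)" by auto
  also have "measure_pmf.prob word_pmf (\<Union>R\<in>{R. distinct R}. ?E R) =
      (\<Sum>R | distinct R. measure_pmf.prob word_pmf (?E R))"
    by (rule measure_pmf.finite_measure_finite_Union) (auto simp: finite_distinct
        disjoint_family_on_def)
  also have "\<dots> = (\<Sum>R | distinct R. mass R * delay_prob s c (rev R) d / total_mass)"
    by (intro sum.cong refl prob_word_pmf)
      (auto simp: word_measure_delay[OF sc] mass_nonneg delay_prob_nonneg)
  also have "\<dots> = (\<Sum>R | distinct R. pi_Y M z A N (rev R) * delay_prob s c (rev R) d)"
    by (intro sum.cong) (auto simp: pi_Y_eq)
  also have "\<dots> = (\<Sum>Cs | distinct Cs. pi_Y M z A N Cs * delay_prob s c Cs d)"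
    by (rule sum_rev_distinct)
  finally show ?thesis by (simp add: mult.commute)
qed

text \<open>\<open>match_prob\<close> counts per position and the matching rate per good. The law of
  large numbers holds for matches and for goods separately, and the positive frequency
  \<open>mbar / \<Lambda>\<close> of goods allows dividing the limits. Uniqueness of limits at
  almost every point justifies the definite description.\<close>

lemma matching_rate_eq: "matching_rate M z A s c = match_prob s c * \<Lambda> / mbar"
proof -
  define goods :: "nat \<Rightarrow> 'w \<Rightarrow> real" where
    "goods N \<omega> = (\<Sum>n<N. of_bool (\<exists>s'. z (int n + 1) \<omega> = Good s'))" for N \<omega>
  define matches :: "nat \<Rightarrow> 'w \<Rightarrow> real" where
    "matches N \<omega> = (\<Sum>n<N. of_bool (matched_types (\<lambda>i. z i \<omega>) (A \<omega>) s c (int n + 1)))" for N \<omega>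
  have count: "real (card {n \<in> {1..int N}. P n}) = (\<Sum>n<N. of_bool (P (int n + 1)))" for P N
  proof -
    have "real (card {n \<in> {1..int N}. P n}) = (\<Sum>n\<in>{1..int N}. of_bool (P n))"
      by (simp add: Int_def)
    also have "\<dots> = (\<Sum>n<N. of_bool (P (int n + 1)))"
      by (rule sum.reindex_bij_witness[of _ "\<lambda>n. int n + 1" "\<lambda>n. nat (n - 1)"]) auto
    finally show ?thesis .
  qed
  have gp: "measure_pmf.prob (pair_pmf word_pmf item_pmf) {(w, i). \<exists>s'. i = Good s'} = mbar / \<Lambda>"
  proof -
    have eq: "{(w, i). \<exists>s'. i = Good s'} = (UNIV :: 'c option list set) \<times> (range Inr :: ('c, 's)
        item set)" by auto
    have "measure_pmf.prob (pair_pmf word_pmf item_pmf) {(w, i). \<exists>s'. i = Good s'} =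
        measure_pmf.prob item_pmf (range Inr)"
      unfolding eq by (subst measure_pmf_prob_product) simp_all
    also have "\<dots> = (\<Sum>s\<in>UNIV. pmf item_pmf (Inr s))"
      by (subst measure_measure_pmf_finite) (auto simp: sum.reindex)
    also have "\<dots> = type_rate mbar \<beta> UNIV / \<Lambda>"
      by (simp add: pmf_item_Inr type_rate_def sum_divide_distrib)
    finally show ?thesis by (simp add: type_rate_UNIV)
  qed
  have "AE \<omega> in M. (\<lambda>N. matches N \<omega> / real N) \<longlonglongrightarrow> match_prob s c"
    using proc.law_of_large_numbers[of "\<lambda>w i. i = Good s \<and> oldest G s w = Some c"] AE_realization
    by eventually_elim (simp add: matches_def match_prob_def realization.matched_types_iff X_def)
  moreover have "AE \<omega> in M. (\<lambda>N. goods N \<omega> / real N) \<longlonglongrightarrow> mbar / \<Lambda>"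
    using proc.law_of_large_numbers[of "\<lambda>w i. \<exists>s'. i = Good s'"]
    by (simp only: goods_def gp)
  ultimately have lim: "AE \<omega> in M. (\<lambda>N. matches N \<omega> / goods N \<omega>) \<longlonglongrightarrow> match_prob s c * \<Lambda> / mbar"
  proof eventually_elim
    case (elim \<omega>)
    have "(\<lambda>N. (matches N \<omega> / real N) / (goods N \<omega> / real N)) \<longlonglongrightarrow> match_prob s c / (mbar / \<Lambda>)"
      by (rule tendsto_divide[OF elim(1,2)]) (use mbar_pos \<Lambda>_pos in simp)
    moreover have "\<forall>\<^sub>F N in sequentially. (matches N \<omega> / real N) / (goods N \<omega> / real N) =
        matches N \<omega> / goods N \<omega>"
      using eventually_gt_at_top[of 0] by eventually_elim auto
    ultimately have "(\<lambda>N. matches N \<omega> / goods N \<omega>) \<longlonglongrightarrow> match_prob s c / (mbar / \<Lambda>)"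
      by (rule Lim_transform_eventually)
    then show ?case by simp
  qed
  show ?thesis
    unfolding matching_rate_def count
  proof (rule the_equality)
    show lim': "AE \<omega> in M. (\<lambda>N. (\<Sum>n<N. of_bool (matched_types (\<lambda>i. z i \<omega>) (A \<omega>) s c (int n + 1))) /
        (\<Sum>n<N. of_bool (\<exists>s'. z (int n + 1) \<omega> = Good s'))) \<longlonglongrightarrow> match_prob s c * \<Lambda> / mbar"
      using lim by (simp only: matches_def goods_def)
    fix r :: real
    assume "AE \<omega> in M. (\<lambda>N. (\<Sum>n<N. of_bool (matched_types (\<lambda>i. z i \<omega>) (A \<omega>) s c (int n + 1))) /
        (\<Sum>n<N. of_bool (\<exists>s'. z (int n + 1) \<omega> = Good s'))) \<longlonglongrightarrow> r"
    with lim' have "AE \<omega> in M. r = match_prob s c * \<Lambda> / mbar"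
      by eventually_elim (rule LIMSEQ_unique)
    then show "r = match_prob s c * \<Lambda> / mbar" by simp
  qed
qed

text \<open>With the delay fixed, the agent in \<open>m\<close> and the good in \<open>m + d\<close>
  form the same pair, so the agent's view is the sum over good types of the view from the
  good.\<close>

lemma prob_agent_delay:
  assumes d: "d \<ge> 1"
  shows "\<P>(\<omega> in M. (\<exists>n. (m, n) \<in> A \<omega> \<and> n - m = int d) \<and> z m \<omega> = Agent c) =
    (\<Sum>s\<in>UNIV. delayed_match_prob s c d)"
proof -
  let ?n = "m + int d"
  let ?E = "\<lambda>s. {\<omega> \<in> space M. (\<exists>m. (m, ?n) \<in> A \<omega> \<and> ?n - m = int d) \<and>
      matched_types (\<lambda>i. z i \<omega>) (A \<omega>) s c ?n}"
  have "\<P>(\<omega> in M. (\<exists>n. (m, n) \<in> A \<omega> \<and> n - m = int d) \<and> z m \<omega> = Agent c) = prob (\<Union>s\<in>UNIV. ?E s)"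
  proof (rule finite_measure_eq_AE)
    show "AE \<omega> in M. (\<omega> \<in> {\<omega> \<in> space M. (\<exists>n. (m, n) \<in> A \<omega> \<and> n - m = int d) \<and> z m \<omega> = Agent c}) =
        (\<omega> \<in> (\<Union>s\<in>UNIV. ?E s))"
      using AE_realization
    proof eventually_elim
      case (elim \<omega>)
      interpret realization G "\<lambda>i. z i \<omega>" "A \<omega>" by (rule elim)
      have "(\<exists>n. (m, n) \<in> A \<omega> \<and> n - m = int d) \<longleftrightarrow> (m, ?n) \<in> A \<omega>"
        by (metis add.commute add_diff_cancel_left' diff_add_cancel)
      moreover have "(\<exists>m. (m, ?n) \<in> A \<omega> \<and> ?n - m = int d) \<longleftrightarrow> (m, ?n) \<in> A \<omega>"
        by auto
      moreover have "(m, ?n) \<in> A \<omega> \<and> z m \<omega> = Agent c \<longleftrightarrow> (m, ?n) \<in> A \<omega> \<and>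
          (\<exists>s. matched_types (\<lambda>i. z i \<omega>) (A \<omega>) s c ?n)"
      proof
        assume L: "(m, ?n) \<in> A \<omega> \<and> z m \<omega> = Agent c"
        then obtain s where "z ?n \<omega> = Good s" using match_iff[of m ?n] by blast
        then show "(m, ?n) \<in> A \<omega> \<and> (\<exists>s. matched_types (\<lambda>i. z i \<omega>) (A \<omega>) s c ?n)"
          using L by (auto simp: matched_types_def)
      next
        assume R: "(m, ?n) \<in> A \<omega> \<and> (\<exists>s. matched_types (\<lambda>i. z i \<omega>) (A \<omega>) s c ?n)"
        then show "(m, ?n) \<in> A \<omega> \<and> z m \<omega> = Agent c"
          using unique_agent by (auto simp: matched_types_def)
      qed
      ultimately show ?case by blast
    qed
  qed measurable
  also have "\<dots> = (\<Sum>s\<in>UNIV. prob (?E s))"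
    by (rule finite_measure_finite_Union) (auto simp: disjoint_family_on_def matched_types_def)
  finally show ?thesis by (simp only: prob_delayed_match)
qed

lemma delayed_match_prob_sums: "(\<lambda>d. delayed_match_prob s c (Suc d)) sums match_prob s c"
proof -
  let ?E = "\<lambda>d. {(w, i :: ('c, 's) item). i = Good s \<and> oldest G s w = Some c \<and> delay G s w = Suc d}"
  have "(\<lambda>d. measure_pmf.prob (pair_pmf word_pmf item_pmf) (?E d)) sums measure_pmf.prob
      (pair_pmf word_pmf item_pmf) (\<Union>d. ?E d)"
    by (rule measure_pmf.finite_measure_UNION) (auto simp: disjoint_family_on_def)
  moreover have "(\<Union>d. ?E d) = {(w, i :: ('c, 's) item). i = Good s \<and> oldest G s w = Some c}"
  proof (intro set_eqI iffI)
    fix p :: "'c option list \<times> ('c, 's) item"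
    assume "p \<in> {(w, i). i = Good s \<and> oldest G s w = Some c}"
    then obtain w where w: "p = (w, Good s)" "oldest G s w = Some c" by auto
    then have "delay G s w \<noteq> 0" using delay_eq_0_iff[of G s w] by simp
    then obtain d where "delay G s w = Suc d" by (cases "delay G s w") auto
    then show "p \<in> (\<Union>d. ?E d)" using w by auto
  qed auto
  ultimately show ?thesis by (simp only: delayed_match_prob_def match_prob_def)
qed

text \<open>Every agent is matched after some delay, so summing over delays gives the agent rate.\<close>

lemma sum_match_prob: "(\<Sum>s\<in>UNIV. match_prob s c) = la {c} / \<Lambda>"
proof -
  define P where "P d \<omega> \<longleftrightarrow> (\<exists>n. (0, n) \<in> A \<omega> \<and> n - 0 = int (Suc d)) \<and> z 0 \<omega> = Agent c" for d \<omega>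
  have [measurable]: "Measurable.pred M (P d)" for d unfolding P_def by measurable
  have "(\<lambda>d. \<P>(\<omega> in M. P d \<omega>)) sums \<P>(\<omega> in M. z 0 \<omega> = Agent c)"
  proof (rule prob_sums)
    show "AE \<omega> in M. (\<forall>d. P d \<omega> \<longrightarrow> z 0 \<omega> = Agent c) \<and> (z 0 \<omega> = Agent c \<longrightarrow> (\<exists>!d. P d \<omega>))"
      using AE_realization
    proof eventually_elim
      case (elim \<omega>)
      interpret realization G "\<lambda>i. z i \<omega>" "A \<omega>" by (rule elim)
      have "\<exists>!d. P d \<omega>" if c: "z 0 \<omega> = Agent c"
      proof -
        obtain n where n: "(0, n) \<in> A \<omega>" using all_matched c by (auto simp: all_agents_matched_def)
        then have "n > 0" using match_iff[of 0 n] by blast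
        show ?thesis
        proof (rule ex1I)
          show "P (nat (n - 1)) \<omega>"
            using n c \<open>n > 0\<close> by (auto simp: P_def intro!: exI[of _ n])
          fix d assume "P d \<omega>"
          then have "(0, int (Suc d)) \<in> A \<omega>" by (auto simp: P_def)
          then have "n = int (Suc d)" by (rule unique_good[OF n])
          then show "d = nat (n - 1)" by simp
        qed
      qed
      then show ?case by (simp add: P_def)
    qed
  qed measurable
  moreover have "\<P>(\<omega> in M. P d \<omega>) = (\<Sum>s\<in>UNIV. delayed_match_prob s c (Suc d))" for d
    unfolding P_def by (rule prob_agent_delay) simp
  moreover have "(\<lambda>d. \<Sum>s\<in>UNIV. delayed_match_prob s c (Suc d)) sums (\<Sum>s\<in>UNIV. match_prob s c)"
    by (intro sums_sum delayed_match_prob_sums)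
  ultimately have "(\<Sum>s\<in>UNIV. match_prob s c) = \<P>(\<omega> in M. z 0 \<omega> = Agent c)"
    by (simp add: sums_iff)
  then show ?thesis by (simp add: prob_item pmf_item_Inl)
qed

lemma sum_compatible:
  assumes "\<And>s. (s, c) \<notin> G \<Longrightarrow> F s = (0 :: real)"
  shows "(\<Sum>s\<in>UNIV. F s) = (\<Sum>s\<in>compat_goods G {c}. F s)"
  by (rule sum.mono_neutral_right) (auto simp: compat_goods_def assms)

text \<open>By \<open>sum_match_prob\<close> the normalizing sum of rates is the arrival probability
  of type \<open>c\<close> up to the factor \<open>\<Lambda> / mbar\<close>, which cancels in the
  mixture weights.\<close>

lemma agent_delay_prob_eq:
  assumes d: "d \<ge> 1"
  shows "agent_delay_prob M z A m c d =
    (\<Sum>s \<in> compat_goods G {c}.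
       matching_rate M z A s c / (\<Sum>s' \<in> compat_goods G {c}. matching_rate M z A s' c) *
       pair_delay_prob M z A n s c d)"
proof -
  have total: "(\<Sum>s' \<in> compat_goods G {c}. matching_rate M z A s' c) = (la {c} / \<Lambda>) * \<Lambda> / mbar"
  proof -
    have "(\<Sum>s' \<in> compat_goods G {c}. match_prob s' c) = la {c} / \<Lambda>"
      using sum_compatible[of c "\<lambda>s. match_prob s c"] match_prob_incompatible by
          (simp add: sum_match_prob)
    then show ?thesis
      unfolding matching_rate_eq by (simp only: sum_divide_distrib[symmetric]
          sum_distrib_right[symmetric])
  qed
  have zero: "match_prob s c = 0 \<Longrightarrow> delayed_match_prob s c d = 0" for s
    using delayed_match_prob_le[of s c d] delayed_match_prob_nonneg[of s c d] by simp
  have "agent_delay_prob M z A m c d = (\<Sum>s\<in>UNIV. delayed_match_prob s c d) / (la {c} / \<Lambda>)"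
    unfolding agent_delay_prob_def cond_prob_def prob_agent_delay[OF d]
    by (simp add: prob_item pmf_item_Inl)
  also have "(\<Sum>s\<in>UNIV. delayed_match_prob s c d) =
      (\<Sum>s\<in>compat_goods G {c}. delayed_match_prob s c d)"
    by (rule sum_compatible) (simp add: zero match_prob_incompatible)
  also have "\<dots> / (la {c} / \<Lambda>) = (\<Sum>s\<in>compat_goods G {c}. delayed_match_prob s c d / (la {c} / \<Lambda>))"
    by (rule sum_divide_distrib)
  also have "\<dots> = (\<Sum>s \<in> compat_goods G {c}.
       matching_rate M z A s c / (\<Sum>s' \<in> compat_goods G {c}. matching_rate M z A s' c) *
       pair_delay_prob M z A n s c d)"
  proof (rule sum.cong[OF refl])
    fix s
    \<comment> \<open>For a pair that is never matched, the conditional probability is a division by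
      zero with value 0, and the left side vanishes too.\<close>
    show "delayed_match_prob s c d / (la {c} / \<Lambda>) =
       matching_rate M z A s c / (\<Sum>s' \<in> compat_goods G {c}. matching_rate M z A s' c) *
           pair_delay_prob M z A n s c d"
      unfolding total unfolding matching_rate_eq pair_delay_prob_eq
      using zero[of s] mbar_pos \<Lambda>_pos by (cases "match_prob s c = 0") auto
  qed
  finally show ?thesis .
qed

lemma pair_delay_prob_formula:
  assumes sc: "(s, c) \<in> G"
  shows "pair_delay_prob M z A n s c d =
    1 / matching_rate M z A s c * (type_rate mbar \<beta> {s} / mbar) *
    (\<Sum>k = 1..CARD('c). \<Sum>C | card C = k. \<Sum>Cs \<in> permutations_of_set C. \<Sum>l = 1..k.
       pi_Y M z A N Cs *
       of_bool (Cs ! (l - 1) = c \<and> s \<notin> compat_goods G (set (take (l - 1) Cs))) *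
       geo Cs l d)"
    (is "_ = _ * _ * ?T")
proof -
  have "(\<Sum>Cs | distinct Cs. pi_Y M z A N Cs * delay_prob s c Cs d) =
    (\<Sum>k = 1..CARD('c). \<Sum>C | card C = k. \<Sum>Cs \<in> permutations_of_set C. pi_Y M z A N Cs *
        delay_prob s c Cs d)"
    by (rule sum_distinct_by_length) (simp add: delay_prob_def)
  also have "\<dots> = ?T"
  proof (intro sum.cong refl)
    fix k and C :: "'c set" and Cs
    assume "C \<in> {C. card C = k}" "Cs \<in> permutations_of_set C"
    then have "length Cs = k" by (auto simp: permutations_of_set_def distinct_card)
    then show "pi_Y M z A N Cs * delay_prob s c Cs d = (\<Sum>l = 1..k.
       pi_Y M z A N Cs * of_bool (Cs ! (l - 1) = c \<and> s \<notin> compat_goods G (set (take (l - 1) Cs))) *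
           geo Cs l d)"
      unfolding delay_prob_def sum_distrib_left by (simp only: mult.assoc)
  qed
  finally have dm: "delayed_match_prob s c d = type_rate mbar \<beta> {s} / \<Lambda> * ?T"
    unfolding delayed_match_prob_eq_sum[OF sc, of d N] by (simp only: mult.assoc)
  \<comment> \<open>This passes from probabilities per position to the rate per good: with
    \<open>r\<close> the matching probability per position, \<open>r * L / b\<close> is the matching
    rate and \<open>L\<close> cancels.\<close>
  have "t / L * T / r = 1 / (r * L / b) * (t / b) * T" if "b > 0" "L > 0" for t L T r b :: real
    using that by (cases "r = 0") (auto simp: field_simps)
  from this[OF mbar_pos \<Lambda>_pos] show ?thesis
    unfolding pair_delay_prob_eq matching_rate_eq dm .
qed

end

theorem theorem9:
  fixes M :: "'w measure"
    and lbar mbar :: real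
    and \<alpha> :: "'c::finite pmf" and \<beta> :: "'s::finite pmf"
    and G :: "('s \<times> 'c) set"
    and z :: "int \<Rightarrow> 'w \<Rightarrow> ('c, 's) item"
    and A :: "'w \<Rightarrow> (int \<times> int) set"
  assumes "prob_space M"
    and "lbar > 0" and "mbar > 0"
    and "iid_items M lbar mbar \<alpha> \<beta> z"
    and "stability_condition lbar mbar \<alpha> \<beta> G"
    and "stationary_matching M G z A"
  shows
    "(\<forall>n N s c. \<forall>d\<ge>1. (s, c) \<in> G \<and> matching_rate M z A s c > 0 \<longrightarrow>
        pair_delay_prob M z A n s c d =
          1 / matching_rate M z A s c * (type_rate mbar \<beta> {s} / mbar) *
          (\<Sum>k = 1..CARD('c). \<Sum>C | card C = k. \<Sum>Cs \<in> permutations_of_set C. \<Sum>l = 1..k.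
             pi_Y M z A N Cs *
             of_bool (Cs ! (l - 1) = c \<and> s \<notin> compat_goods G (set (take (l - 1) Cs))) *
             geometric_sum_prob lbar mbar \<alpha> \<beta> G Cs l d)) \<and>
     (\<forall>m n c. \<forall>d\<ge>1.
        agent_delay_prob M z A m c d =
          (\<Sum>s \<in> compat_goods G {c}.
             matching_rate M z A s c / (\<Sum>s' \<in> compat_goods G {c}. matching_rate M z A s' c) *
             pair_delay_prob M z A n s c d)) \<and>
     (\<forall>N Cs. distinct Cs \<longrightarrow>
        pi_Y M z A N Cs =
          \<P>(\<omega> in M. backlog (\<lambda>i. z i \<omega>) (A \<omega>) N = {}) *
          (\<Prod>h = 1..length Cs. type_rate lbar \<alpha> {Cs ! (h - 1)} / net_rate lbar mbar \<alpha> \<beta> G Cs h)) \<and>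
     (\<forall>N. (\<Sum>C \<in> UNIV. \<Sum>Cs \<in> permutations_of_set C. pi_Y M z A N Cs) = 1)"
proof -
  interpret prob_space M by fact
  interpret fcfs_model lbar mbar \<alpha> \<beta> G M z A
    by unfold_locales fact+
  show ?thesis
    by (intro conjI allI impI pair_delay_prob_formula agent_delay_prob_eq sum_pi_Y)
      (simp_all add: pi_Y_eq prob_backlog_empty mass_eq_prod)
qed

end
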